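(* Suppose $\mathfrak{C}_{AR(1)}\subseteq\mathfrak{C}$, let $a_1\in\{1,2\}$, $a_2\in\{n-1,n\}$ with $a_1\le a_2$, let $\hat\rho$ be the corresponding estimator of the autoregressive parameter, and suppose $k\le a_2-a_1$. Let $0<C<\infty$, $W_{FGLS}(C)=\{y\in\mathbb{R}^n:T_{FGLS}(y)\ge C\}$ and $W_{OLS}(C)=\{y\in\mathbb{R}^n:T_{OLS}(y)\ge C\}$. Then items 1–3 below hold with $(T,W,N^*,K)=(T_{FGLS},W_{FGLS}(C),N_2^*(a_1,a_2),K_{FGLS})$, and they also hold with $(T,W,N^*,K)=(T_{OLS},W_{OLS}(C),N_0^*(a_1,a_2),K_{OLS})$: 1. Suppose $e_+\notin N^*$ and $T(e_++\mu_0^* )>C$ hold for some (and hence all) $\mu_0^*\in\mathfrak{M}_0$, or $e_-\notin N^*$ and $T(e_-+\mu_0^* )>C$ hold for some (and hence all) $\mu_0^*\in\mathfrak{M}_0$. Then $\sup_{\Sigma\in\mathfrak{C}}P_{\mu_0,\sigma^2\Sigma}(W)=1$ for every $\mu_0\in\mathfrak{M}_0$ and every $0<\sigma^2<\infty$. In particular, the size of the test equals one. 2. Suppose $e_+\notin N^*$ and $T(e_++\mu_0^* )<C$ hold for some (and hence all) $\mu_0^*\in\mathfrak{M}_0$, or $e_-\notin N^*$ and $T(e_-+\mu_0^* )<C$ hold for some (and hence all) $\mu_0^*\in\mathfrak{M}_0$. Then $\inf_{\Sigma\in\mathfrak{C}}P_{\mu_0,\sigma^2\Sigma}(W)=0$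 for every $\mu_0\in\mathfrak{M}_0$ and every $0<\sigma^2<\infty$, and hence $\inf_{\mu_1\in\mathfrak{M}_1}\inf_{\Sigma\in\mathfrak{C}}P_{\mu_1,\sigma^2\Sigma}(W)=0$ for every $0<\sigma^2<\infty$. In particular, the test is biased. Furthermore, for every $\mu_1\in\mathfrak{M}_1$, $\inf_{0<\sigma^2<\infty}\inf_{\Sigma\in\mathfrak{C}}P_{\mu_1,\sigma^2\Sigma}(W)=0$. In particular, the infimal power of the test equals zero. 3. Suppose $e_+\in\mathfrak{M}$ and $R\hat\beta(e_+)\ne0$. Then there exists a constant $K(e_+)$, which (for the given choice of $a_1,a_2$) depends only on $e_+$, $R$, and $X$, such that for every $\mu_0\in\mathfrak{M}_0$, every $0<\sigma<\infty$, and every $M\ge0$ $$\inf_{\gamma\in\mathbb{R},|\gamma|\ge M}\ \inf_{\Sigma\in\mathfrak{C}}P_{\mu_0+\gamma e_+,\sigma^2\Sigma}(W)\le K(e_+)\le\sup_{\Sigma\in\mathfrak{C}}P_{\mu_0,\sigma^2\Sigma}(W);$$ note that $\mu_0+\gamma e_+\in\mathfrak{M}_1$ for $\gamma\ne0$. Furthermore, if $\hat\rho$ is the Yule–Walker estimator (i.e. $a_1=1$, $a_2=n$), then $K(e_+)=1$ and hence $\sup_{\Sigma\in\mathfrak{C}}P_{\mu_0,\sigma^2\Sigma}(W)=1$ for every $\mu_0\in\mathfrak{M}_0$ and every $0<\sigma^2<\infty$. If $e_-\in\mathfrak{M}$ and $R\hat\beta(e_-)\ne0$, the analogous statements hold with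 $e_+$ replaced by $e_-$, where the constant $K(e_-)$ now depends only on $e_-$, $R$, and $X$.
   Context: Framework: $n,k,q$ are integers with $1\le k<n$, $q\ge1$; $X$ is a fixed real $n\times k$ matrix of rank $k$; $R$ is a fixed real $q\times k$ matrix of rank $q$; $r\in\mathbb{R}^q$. $\mathfrak{C}$ (covariance model) is a nonempty set of symmetric positive definite $n\times n$ matrices such that $\sigma^2\in(0,\infty)$ and $\Sigma\in\mathfrak{C}$ are uniquely determined by $\sigma^2\Sigma$. $\mathfrak{M}=\operatorname{span}(X)$, $\mathfrak{M}_0=\{X\beta:\beta\in\mathbb{R}^k,\ R\beta=r\}$, $\mathfrak{M}_1=\mathfrak{M}\setminus\mathfrak{M}_0$. $P_{\mu,\Phi}$ is the Gaussian measure on $\mathbb{R}^n$ with mean $\mu$ and covariance matrix $\Phi$. The testing problem is $H_0:\mu\in\mathfrak{M}_0$ versus $H_1:\mu\in\mathfrak{M}_1$ (in both cases $0<\sigma^2<\infty$, $\Sigma\in\mathfrak{C}$ arbitrary), observation $\sim P_{\mu,\sigma^2\Sigma}$. For a rejection region $W$, size is the supremum of $P_{\mu,\sigma^2\Sigma}(W)$ over $H_0$, infimal power the infimum over $H_1$; the test is biased if the infimal power is strictly smaller than the size. $\Lambda(\rho)$ denotes the $n\times n$ matrix with $(i,j)$ entry $\rho^{|i-j|}$ for $\rho\in\mathbb{R}$; $\mathfrak{C}_{AR(1)}=\{\Lambda(\rho):\rho\in(-1,1)\}$. $e_+=(1,\dots,1)'$, $e_-=(-1,1,\dots,(-1)^n)'$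 in $\mathbb{R}^n$. $\hat\beta(y)=(X'X)^{-1}X'y$, $\hat u(y)=y-X\hat\beta(y)$ with coordinates $\hat u_t(y)$. Estimator of $\rho$: $\hat\rho(y)=\sum_{t=2}^n\hat u_t(y)\hat u_{t-1}(y)\big/\sum_{t=a_1}^{a_2}\hat u_t^2(y)$ for $y\notin N_0(a_1,a_2):=\{y:\sum_{t=a_1}^{a_2}\hat u_t^2(y)=0\}$, undefined on $N_0(a_1,a_2)$. Exceptional sets: $N_1(a_1,a_2)=\{y:|\sum_{t=2}^n\hat u_t(y)\hat u_{t-1}(y)|=\sum_{t=a_1}^{a_2}\hat u_t^2(y)\}$ (which contains $N_0(a_1,a_2)$); $\mathbb{R}^n\setminus N_2(a_1,a_2)=\{y\in\mathbb{R}^n\setminus N_1(a_1,a_2):\det(X'\Lambda^{-1}(\hat\rho(y))X)\ne0\}$; $\mathbb{R}^n\setminus N_2^*(a_1,a_2)=\{y\in\mathbb{R}^n\setminus N_2(a_1,a_2):\tilde\sigma^2(y)\ne0,\ \det(R(X'\Lambda^{-1}(\hat\rho(y))X)^{-1}R')\ne0\}$; $\mathbb{R}^n\setminus N_0^*(a_1,a_2)=\{y\in\mathbb{R}^n\setminus N_0(a_1,a_2):\det(R(X'X)^{-1}X'\Lambda(\hat\rho(y))X(X'X)^{-1}R')\ne0\}$. FGLS quantities (on $\mathbb{R}^n\setminus N_2(a_1,a_2)$): $\tilde\beta(y)=(X'\Lambda^{-1}(\hat\rho(y))X)^{-1}X'\Lambda^{-1}(\hat\rho(y))y$, $\tilde\sigma^2(y)=(n-k)^{-1}(y-X\tilde\beta(y))'\Lambda^{-1}(\hat\rho(y))(y-X\tilde\beta(y))$,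 $\tilde\Omega(y)=\tilde\sigma^2(y)R(X'\Lambda^{-1}(\hat\rho(y))X)^{-1}R'$. $T_{FGLS}(y)=(R\tilde\beta(y)-r)'\tilde\Omega^{-1}(y)(R\tilde\beta(y)-r)$ for $y\notin N_2^*(a_1,a_2)$ and $T_{FGLS}(y)=0$ otherwise. OLS quantities: $\hat\sigma^2(y)=(n-k)^{-1}\hat u(y)'\hat u(y)$, $\hat\Omega(y)=\hat\sigma^2(y)R(X'X)^{-1}X'\Lambda(\hat\rho(y))X(X'X)^{-1}R'$ (on $\mathbb{R}^n\setminus N_0(a_1,a_2)$). $T_{OLS}(y)=(R\hat\beta(y)-r)'\hat\Omega^{-1}(y)(R\hat\beta(y)-r)$ for $y\notin N_0^*(a_1,a_2)$ and $T_{OLS}(y)=0$ otherwise. *)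

theory Defs
  imports "HOL-Analysis.Analysis"
begin

(* Vectors in R^n are indexed by a finite linearly ordered type 'n with CARD('n) = n;
   the order of the type is the order of time, and "pos i" is the number, counted from 1,
   of the index i. *)

definition pos :: "'n::{finite,linorder} \<Rightarrow> nat" where
  "pos i = card {..i}"

lemma bij_betw_pos:
  "bij_betw (pos :: 'n \<Rightarrow> nat) UNIV {1..CARD('n::{finite,linorder})}"
proof -
  have le: "pos i < pos j" if "i < j" for i j :: 'n
    unfolding pos_def using that by (intro psubset_card_mono) (auto simp: psubset_eq)
  have inj: "inj (pos :: 'n \<Rightarrow> nat)"
    by (rule injI) (metis le less_irrefl neq_iff)
  have "pos i \<in> {1..CARD('n)}" for i :: 'n
    unfolding pos_def by (auto simp: Suc_le_eq card_gt_0_iff intro!: card_mono)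
  then have "range (pos :: 'n \<Rightarrow> nat) \<subseteq> {1..CARD('n)}" by auto
  moreover have "card (range (pos :: 'n \<Rightarrow> nat)) = card {1..CARD('n)}"
    using inj by (simp add: card_image)
  ultimately have "range (pos :: 'n \<Rightarrow> nat) = {1..CARD('n)}"
    by (intro card_subset_eq) auto
  with inj show ?thesis by (simp add: bij_betw_def)
qed

definition coord :: "real ^ 'n::{finite,linorder} \<Rightarrow> nat \<Rightarrow> real" where
  "coord y t = y $ (inv pos t)"

lemma coord_pos: "coord y (pos i) = y $ i"
  using bij_betw_pos[where 'n='a] by (simp add: coord_def bij_betw_def)

definition e_plus :: "real ^ 'n::{finite,linorder}" where
  "e_plus = (\<chi> i. 1)"

definition e_minus :: "real ^ 'n::{finite,linorder}" where
  "e_minus = (\<chi> i. (- 1) ^ pos i)"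

definition Lam :: "real \<Rightarrow> real ^ 'n::{finite,linorder} ^ 'n::{finite,linorder}" where
  "Lam \<rho> = (\<chi> i j. \<rho> ^ nat \<bar>int (pos i) - int (pos j)\<bar>)"

definition C_AR1 :: "(real ^ 'n::{finite,linorder} ^ 'n::{finite,linorder}) set" where
  "C_AR1 = Lam ` {-1<..<1}"

definition sym_pos_def :: "real ^ 'n ^ 'n \<Rightarrow> bool" where
  "sym_pos_def A \<longleftrightarrow> transpose A = A \<and> (\<forall>x. x \<noteq> 0 \<longrightarrow> x \<bullet> (A *v x) > 0)"

definition covariance_model :: "(real ^ 'n ^ 'n) set \<Rightarrow> bool" where
  "covariance_model \<CC> \<longleftrightarrow> \<CC> \<noteq> {} \<and> (\<forall>\<Sigma>\<in>\<CC>. sym_pos_def \<Sigma>) \<and>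
     (\<forall>s>0. \<forall>s'>0. \<forall>\<Sigma>\<in>\<CC>. \<forall>\<Sigma>'\<in>\<CC>.
        s *\<^sub>R \<Sigma> = s' *\<^sub>R \<Sigma>' \<longrightarrow> s = s' \<and> \<Sigma> = \<Sigma>')"

(* Gaussian measure with mean \<mu> and covariance matrix \<Phi>, given by its Lebesgue density;
   meant for symmetric positive definite \<Phi> only. *)
definition gaussian :: "real ^ 'n \<Rightarrow> real ^ 'n ^ 'n \<Rightarrow> (real ^ 'n) measure" where
  "gaussian \<mu> \<Phi> = density lborel (\<lambda>y. ennreal
     (exp (- ((y - \<mu>) \<bullet> (matrix_inv \<Phi> *v (y - \<mu>))) / 2) / sqrt ((2 * pi) ^ CARD('n) * det \<Phi>)))"

definition M_all :: "real ^ 'k ^ 'n \<Rightarrow> (real ^ 'n) set" where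
  "M_all X = span (columns X)"

definition M_null :: "real ^ 'k ^ 'n \<Rightarrow> real ^ 'k ^ 'q \<Rightarrow> real ^ 'q \<Rightarrow> (real ^ 'n) set" where
  "M_null X R r = {X *v \<beta> | \<beta>. R *v \<beta> = r}"

definition M_alt :: "real ^ 'k ^ 'n \<Rightarrow> real ^ 'k ^ 'q \<Rightarrow> real ^ 'q \<Rightarrow> (real ^ 'n) set" where
  "M_alt X R r = M_all X - M_null X R r"

definition test_size ::
  "real ^ 'k ^ 'n \<Rightarrow> real ^ 'k ^ 'q \<Rightarrow> real ^ 'q \<Rightarrow> (real ^ 'n ^ 'n) set \<Rightarrow> (real ^ 'n) set \<Rightarrow> real" where
  "test_size X R r \<CC> W =
     (SUP (\<mu>, s, \<Sigma>) \<in> M_null X R r \<times> {0<..} \<times> \<CC>. measure (gaussian \<mu> (s *\<^sub>R \<Sigma>)) W)"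

definition infimal_power ::
  "real ^ 'k ^ 'n \<Rightarrow> real ^ 'k ^ 'q \<Rightarrow> real ^ 'q \<Rightarrow> (real ^ 'n ^ 'n) set \<Rightarrow> (real ^ 'n) set \<Rightarrow> real" where
  "infimal_power X R r \<CC> W =
     (INF (\<mu>, s, \<Sigma>) \<in> M_alt X R r \<times> {0<..} \<times> \<CC>. measure (gaussian \<mu> (s *\<^sub>R \<Sigma>)) W)"

definition biased ::
  "real ^ 'k ^ 'n \<Rightarrow> real ^ 'k ^ 'q \<Rightarrow> real ^ 'q \<Rightarrow> (real ^ 'n ^ 'n) set \<Rightarrow> (real ^ 'n) set \<Rightarrow> bool" where
  "biased X R r \<CC> W \<longleftrightarrow> infimal_power X R r \<CC> W < test_size X R r \<CC> W"

definition beta_hat :: "real ^ 'k ^ 'n \<Rightarrow> real ^ 'n \<Rightarrow> real ^ 'k" where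
  "beta_hat X y = matrix_inv (transpose X ** X) *v (transpose X *v y)"

definition u_hat :: "real ^ 'k ^ 'n \<Rightarrow> real ^ 'n \<Rightarrow> real ^ 'n" where
  "u_hat X y = y - X *v beta_hat X y"

definition rho_num :: "real ^ 'k ^ 'n::{finite,linorder} \<Rightarrow> real ^ 'n::{finite,linorder} \<Rightarrow> real" where
  "rho_num X y = (\<Sum>t = 2..CARD('n). coord (u_hat X y) t * coord (u_hat X y) (t - 1))"

definition rho_den :: "real ^ 'k ^ 'n::{finite,linorder} \<Rightarrow> nat \<Rightarrow> nat \<Rightarrow> real ^ 'n::{finite,linorder} \<Rightarrow> real" where
  "rho_den X a1 a2 y = (\<Sum>t = a1..a2. (coord (u_hat X y) t)\<^sup>2)"

(* Only used outside N0, where the denominator is nonzero. *)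
definition rho_hat :: "real ^ 'k ^ 'n::{finite,linorder} \<Rightarrow> nat \<Rightarrow> nat \<Rightarrow> real ^ 'n::{finite,linorder} \<Rightarrow> real" where
  "rho_hat X a1 a2 y = rho_num X y / rho_den X a1 a2 y"

definition N0 :: "real ^ 'k ^ 'n::{finite,linorder} \<Rightarrow> nat \<Rightarrow> nat \<Rightarrow> (real ^ 'n::{finite,linorder}) set" where
  "N0 X a1 a2 = {y. rho_den X a1 a2 y = 0}"

definition N1 :: "real ^ 'k ^ 'n::{finite,linorder} \<Rightarrow> nat \<Rightarrow> nat \<Rightarrow> (real ^ 'n::{finite,linorder}) set" where
  "N1 X a1 a2 = {y. \<bar>rho_num X y\<bar> = rho_den X a1 a2 y}"

definition GLS_gram :: "real ^ 'k ^ 'n::{finite,linorder} \<Rightarrow> nat \<Rightarrow> nat \<Rightarrow> real ^ 'n::{finite,linorder} \<Rightarrow> real ^ 'k ^ 'k" where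
  "GLS_gram X a1 a2 y = transpose X ** matrix_inv (Lam (rho_hat X a1 a2 y)) ** X"

definition N2 :: "real ^ 'k ^ 'n::{finite,linorder} \<Rightarrow> nat \<Rightarrow> nat \<Rightarrow> (real ^ 'n::{finite,linorder}) set" where
  "N2 X a1 a2 = - {y. y \<notin> N1 X a1 a2 \<and> det (GLS_gram X a1 a2 y) \<noteq> 0}"

definition beta_tilde :: "real ^ 'k ^ 'n::{finite,linorder} \<Rightarrow> nat \<Rightarrow> nat \<Rightarrow> real ^ 'n::{finite,linorder} \<Rightarrow> real ^ 'k" where
  "beta_tilde X a1 a2 y = matrix_inv (GLS_gram X a1 a2 y) *v
     (transpose X *v (matrix_inv (Lam (rho_hat X a1 a2 y)) *v y))"

definition sigma2_tilde :: "real ^ 'k ^ 'n::{finite,linorder} \<Rightarrow> nat \<Rightarrow> nat \<Rightarrow> real ^ 'n::{finite,linorder} \<Rightarrow> real" where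
  "sigma2_tilde X a1 a2 y = (let v = y - X *v beta_tilde X a1 a2 y in
     (v \<bullet> (matrix_inv (Lam (rho_hat X a1 a2 y)) *v v)) / (real CARD('n) - real CARD('k)))"

definition Omega_tilde ::
  "real ^ 'k ^ 'n::{finite,linorder} \<Rightarrow> real ^ 'k ^ 'q \<Rightarrow> nat \<Rightarrow> nat \<Rightarrow> real ^ 'n::{finite,linorder} \<Rightarrow> real ^ 'q ^ 'q" where
  "Omega_tilde X R a1 a2 y =
     sigma2_tilde X a1 a2 y *\<^sub>R (R ** matrix_inv (GLS_gram X a1 a2 y) ** transpose R)"

definition N2_star ::
  "real ^ 'k ^ 'n::{finite,linorder} \<Rightarrow> real ^ 'k ^ 'q \<Rightarrow> nat \<Rightarrow> nat \<Rightarrow> (real ^ 'n::{finite,linorder}) set" where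
  "N2_star X R a1 a2 = - {y. y \<notin> N2 X a1 a2 \<and> sigma2_tilde X a1 a2 y \<noteq> 0 \<and>
     det (R ** matrix_inv (GLS_gram X a1 a2 y) ** transpose R) \<noteq> 0}"

definition T_FGLS ::
  "real ^ 'k ^ 'n::{finite,linorder} \<Rightarrow> real ^ 'k ^ 'q \<Rightarrow> nat \<Rightarrow> nat \<Rightarrow> real ^ 'q \<Rightarrow> real ^ 'n::{finite,linorder} \<Rightarrow> real" where
  "T_FGLS X R a1 a2 r y =
     (if y \<notin> N2_star X R a1 a2
      then let v = R *v beta_tilde X a1 a2 y - r in v \<bullet> (matrix_inv (Omega_tilde X R a1 a2 y) *v v)
      else 0)"

definition sigma2_hat :: "real ^ 'k ^ 'n \<Rightarrow> real ^ 'n \<Rightarrow> real" where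
  "sigma2_hat X y = (u_hat X y \<bullet> u_hat X y) / (real CARD('n) - real CARD('k))"

definition OLS_sandwich ::
  "real ^ 'k ^ 'n::{finite,linorder} \<Rightarrow> real ^ 'k ^ 'q \<Rightarrow> nat \<Rightarrow> nat \<Rightarrow> real ^ 'n::{finite,linorder} \<Rightarrow> real ^ 'q ^ 'q" where
  "OLS_sandwich X R a1 a2 y =
     R ** matrix_inv (transpose X ** X) ** transpose X ** Lam (rho_hat X a1 a2 y) **
     X ** matrix_inv (transpose X ** X) ** transpose R"

definition Omega_hat ::
  "real ^ 'k ^ 'n::{finite,linorder} \<Rightarrow> real ^ 'k ^ 'q \<Rightarrow> nat \<Rightarrow> nat \<Rightarrow> real ^ 'n::{finite,linorder} \<Rightarrow> real ^ 'q ^ 'q" where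
  "Omega_hat X R a1 a2 y = sigma2_hat X y *\<^sub>R OLS_sandwich X R a1 a2 y"

definition N0_star ::
  "real ^ 'k ^ 'n::{finite,linorder} \<Rightarrow> real ^ 'k ^ 'q \<Rightarrow> nat \<Rightarrow> nat \<Rightarrow> (real ^ 'n::{finite,linorder}) set" where
  "N0_star X R a1 a2 = - {y. y \<notin> N0 X a1 a2 \<and> det (OLS_sandwich X R a1 a2 y) \<noteq> 0}"

definition T_OLS ::
  "real ^ 'k ^ 'n::{finite,linorder} \<Rightarrow> real ^ 'k ^ 'q \<Rightarrow> nat \<Rightarrow> nat \<Rightarrow> real ^ 'q \<Rightarrow> real ^ 'n::{finite,linorder} \<Rightarrow> real" where
  "T_OLS X R a1 a2 r y =
     (if y \<notin> N0_star X R a1 a2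
      then let v = R *v beta_hat X y - r in v \<bullet> (matrix_inv (Omega_hat X R a1 a2 y) *v v)
      else 0)"

end

theory Submission
  imports Defs "HOL-Probability.Probability" "HOL-Computational_Algebra.Polynomial"
begin

text \<open>
  Both statistics are Wald quadratic forms \<open>(R b(y) - r)' \<Omega>(y)^{-1} (R b(y) - r)\<close> on an open
  domain, in which the estimator \<open>b\<close> is equivariant, and the weight \<open>\<Omega>\<close> is homogeneous of degree
  two, under \<open>y \<mapsto> c y + X \<beta>\<close>. The consequence that carries the proof is that, for \<open>\<mu>0\<close> in the null
  space, the value at \<open>\<mu>0 + c y\<close> does not depend on \<open>\<mu>0\<close> or on \<open>c \<noteq> 0\<close>. The locale
  \<open>equivariant_wald\<close> states this situation, the limit theorems are proved in it, and the FGLS and OLS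
  statistics are shown to be instances.

  A Gaussian vector with covariance matrix \<open>\<Lambda>(\<rho>)\<close> is a lower triangular image of a standard normal
  vector: the first value is standard normal, and the innovations have variance \<open>1 - \<rho>\<^sup>2\<close>. When
  \<open>\<rho>\<close> tends to \<open>s = 1\<close> or \<open>s = -1\<close> the innovations vanish, and the observation tends to a point
  \<open>\<mu>0 + g e\<close>, where \<open>e\<close> is \<open>e_plus\<close> or \<open>e_minus\<close> and \<open>g \<noteq> 0\<close> almost surely. If \<open>e\<close> is in the
  domain, the statistic is continuous there and has the same value at all these points. By dominated
  convergence the rejection probability tends to 1 or to 0, according to whether that value is above
  or below the critical value (\<open>rejection_tendsto\<close>). The same limit holds when the distance of the
  mean from \<open>\<mu>0\<close> is of smaller order than the standard deviation, which gives the statements about power. That the test is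
  biased also requires a positive size; for this the statistic is shown to be unbounded.

  If \<open>e = X \<beta>\<close> lies in the column space, then \<open>\<mu>0 + g e\<close> is outside the domain and the next order
  matters. After division by the innovation standard deviation, which leaves the statistic
  unchanged, the observation is \<open>c e\<close> plus a convergent term \<open>w\<close>, with \<open>\<bar>c\<bar> \<rightarrow> \<infinity>\<close>. The statistic then
  grows like \<open>c\<^sup>2\<close> times \<open>v' \<Omega>(w)^{-1} v\<close> with \<open>v = R \<beta> \<noteq> 0\<close>, so it is the sign of this number that
  decides, for every critical value. The probability \<open>K\<close> of a positive sign is the limit of the
  rejection probabilities under \<open>\<mu>0 + \<gamma> e\<close> for each \<open>\<gamma>\<close>, zero included
  (\<open>rejection_tendsto_crossing\<close>), and therefore separates the infimum from the supremum. For the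
  Yule--Walker estimator \<open>\<bar>\<rho>\<bar> < 1\<close> always holds, \<open>\<Omega>\<close> is positive definite, and \<open>K = 1\<close>.

  This argument requires the bad points (outside the domain, or with \<open>v' \<Omega>^{-1} v = 0\<close>) to form a null
  set. The condition \<open>k \<le> a2 - a1\<close> yields a residual vector \<open>u\<close> supported in the window of the
  denominator; there the estimate of \<open>\<rho>\<close> is inside \<open>(-1, 1)\<close> and every matrix in the construction is
  positive definite. Along each line through \<open>u\<close> all quantities are rational functions of the
  parameter that do not vanish at \<open>u\<close>, so the line contains finitely many bad points, and Fubini's
  theorem for dilations about \<open>u\<close> finishes the proof (\<open>AE_not_in_line_finite\<close>).
\<close>

section \<open>Matrices with positive quadratic form\<close>

lemma matrix_inv_right:
  fixes A :: "real ^ 'n ^ 'n"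
  assumes "det A \<noteq> 0"
  shows "A ** matrix_inv A = mat 1"
  using assms unfolding invertible_det_nz[symmetric] invertible_def matrix_inv_def
  by (metis (mono_tags, lifting) someI_ex)

lemma matrix_inv_left:
  fixes A :: "real ^ 'n ^ 'n"
  assumes "det A \<noteq> 0"
  shows "matrix_inv A ** A = mat 1"
  using matrix_inv_right[OF assms] matrix_left_right_inverse by blast

lemma matrix_inv_eqI:
  fixes A :: "real ^ 'n ^ 'n"
  assumes "A ** B = mat 1"
  shows "matrix_inv A = B" and "det A \<noteq> 0"
proof -
  have "det A * det B = 1"
    using assms by (metis det_I det_mul)
  then show d: "det A \<noteq> 0" by auto
  have "matrix_inv A = matrix_inv A ** (A ** B)" using assms by simp
  also have "\<dots> = B" by (simp add: matrix_mul_assoc matrix_inv_left[OF d])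
  finally show "matrix_inv A = B" .
qed

lemma matrix_inv_scaleR:
  fixes A :: "real ^ 'n ^ 'n"
  assumes "det A \<noteq> 0" "c \<noteq> 0"
  shows "matrix_inv (c *\<^sub>R A) = (1 / c) *\<^sub>R matrix_inv A"
  by (rule matrix_inv_eqI(1)) (use assms in \<open>simp add: matrix_scalar_ac scalar_matrix_assoc matrix_inv_right\<close>)

lemma det_scaleR:
  fixes A :: "real ^ 'n ^ 'n"
  shows "det (c *\<^sub>R A) = c ^ CARD('n) * det A"
proof -
  have "c *\<^sub>R A = (\<chi> i. c *s A $ i)" by (simp add: vec_eq_iff)
  then have "det (c *\<^sub>R A) = prod (\<lambda>_. c) (UNIV :: 'n set) * det (\<chi> i. A $ i)"
    by (simp only: det_rows_mul)
  then show ?thesis by simp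
qed

text \<open>Cramer's rule writes each entry of an inverse as a quotient of polynomials in the entries of the
  matrix. Both the continuity of matrix inversion and its compatibility with rational functions rest on
  this form.\<close>

lemma matrix_inv_cramer:
  fixes A :: "real ^ 'n ^ 'n"
  assumes "det A \<noteq> 0"
  shows "matrix_inv A $ i $ j = det (\<chi> a b. if b = i then axis j 1 $ a else A $ a $ b) / det A"
proof -
  have "A *v column j (matrix_inv A) = column j (A ** matrix_inv A)"
    by (simp add: matrix_vector_mult_def matrix_matrix_mult_def column_def vec_eq_iff)
  also have "\<dots> = axis j 1"
    by (simp add: matrix_inv_right[OF assms] column_def vec_eq_iff mat_def axis_def)
  finally have "column j (matrix_inv A) =
      (\<chi> k. det (\<chi> a b. if b = k then axis j 1 $ a else A $ a $ b) / det A)"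
    using cramer[OF assms] by blast
  then show ?thesis
    by (simp add: column_def vec_eq_iff)
qed

text \<open>The condition on the quadratic form alone is inherited by inverses and congruences through direct
  substitution.\<close>

definition pos_form :: "real ^ 'n ^ 'n \<Rightarrow> bool" where
  "pos_form A \<longleftrightarrow> (\<forall>x. x \<noteq> 0 \<longrightarrow> 0 < x \<bullet> (A *v x))"

lemma pos_form_det: "pos_form A \<Longrightarrow> det A \<noteq> 0"
  unfolding pos_form_def
  by (metis inner_zero_right invertible_det_nz invertible_left_inverse less_irrefl
      matrix_left_invertible_ker)

lemma pos_form_inverse:
  assumes "pos_form A"
  shows "pos_form (matrix_inv A)"
  unfolding pos_form_def
proof (intro allI impI)
  fix x :: "real ^ 'a" assume "x \<noteq> 0"
  define y where "y = matrix_inv A *v x"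
  have x: "A *v y = x"
    by (simp add: y_def matrix_vector_mul_assoc matrix_inv_right[OF pos_form_det[OF assms]])
  with \<open>x \<noteq> 0\<close> have "y \<noteq> 0" by auto
  then have "0 < y \<bullet> (A *v y)" using assms by (simp add: pos_form_def)
  then show "0 < x \<bullet> (matrix_inv A *v x)"
    by (simp add: x y_def[symmetric] inner_commute)
qed

lemma inner_matrix_transpose:
  fixes A :: "real ^ 'm ^ 'n"
  shows "x \<bullet> (transpose A *v y) = (A *v x) \<bullet> y"
  by (metis dot_lmul_matrix inner_commute transpose_matrix_vector)

lemma pos_form_congruence:
  fixes A :: "real ^ 'n ^ 'n" and B :: "real ^ 'm ^ 'n"
  assumes "pos_form A" and "inj ((*v) B)"
  shows "pos_form (transpose B ** A ** B)"
  unfolding pos_form_def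
proof (intro allI impI)
  fix x :: "real ^ 'm" assume "x \<noteq> 0"
  then have "B *v x \<noteq> 0"
    using assms(2) by (metis injD matrix_vector_mult_0_right)
  then have "0 < (B *v x) \<bullet> (A *v (B *v x))"
    using assms(1) by (simp add: pos_form_def)
  then show "0 < x \<bullet> ((transpose B ** A ** B) *v x)"
    by (simp only: matrix_vector_mul_assoc[symmetric] inner_matrix_transpose)
qed

lemma pos_form_scaleR: "pos_form A \<Longrightarrow> 0 < c \<Longrightarrow> pos_form (c *\<^sub>R A)"
  by (simp add: pos_form_def scaleR_matrix_vector_assoc[symmetric])

lemma pos_form_mat_1: "pos_form (mat 1)"
  by (simp add: pos_form_def)

lemma continuous_on_matrix_mult [continuous_intros]:
  fixes f :: "'a::topological_space \<Rightarrow> real ^ 'n ^ 'm" and g :: "'a \<Rightarrow> real ^ 'p ^ 'n"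
  assumes "continuous_on S f" "continuous_on S g"
  shows "continuous_on S (\<lambda>x. f x ** g x)"
  unfolding matrix_matrix_mult_def by (intro continuous_intros assms)

lemma continuous_on_matrix_vector_mult [continuous_intros]:
  fixes f :: "'a::topological_space \<Rightarrow> real ^ 'n ^ 'm" and g :: "'a \<Rightarrow> real ^ 'n"
  assumes "continuous_on S f" "continuous_on S g"
  shows "continuous_on S (\<lambda>x. f x *v g x)"
  unfolding matrix_vector_mult_def by (intro continuous_intros assms)

lemma continuous_on_det [continuous_intros]:
  fixes f :: "'a::topological_space \<Rightarrow> real ^ 'n ^ 'n"
  assumes "continuous_on S f"
  shows "continuous_on S (\<lambda>x. det (f x))"
  unfolding det_def by (intro continuous_intros assms)

lemma continuous_on_matrix_inv [continuous_intros]: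
  fixes f :: "'a::topological_space \<Rightarrow> real ^ 'n ^ 'n"
  assumes f: "continuous_on S f" and det: "\<And>x. x \<in> S \<Longrightarrow> det (f x) \<noteq> 0"
  shows "continuous_on S (\<lambda>x. matrix_inv (f x))"
proof -
  have "continuous_on S (\<lambda>x. if b = i then axis j 1 $ a else f x $ a $ b)" for i j a b
    by (cases "b = i") (auto intro!: continuous_intros f)
  then have *: "continuous_on S (\<lambda>x. \<chi> a b. if b = i then axis j 1 $ a else f x $ a $ b)" for i j
    by (intro continuous_on_vec_lambda)
  have "continuous_on S (\<lambda>x. \<chi> i j. det (\<chi> a b. if b = i then axis j 1 $ a else f x $ a $ b) / det (f x))"
    by (intro continuous_on_vec_lambda continuous_on_divide continuous_on_det * f) (simp add: det)
  then show ?thesis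
    by (rule continuous_on_eq) (simp add: vec_eq_iff matrix_inv_cramer det)
qed

section \<open>Lebesgue measure under invertible linear maps\<close>

lemma nn_integral_lborel_shift:
  fixes f :: "'a::euclidean_space \<Rightarrow> ennreal"
  assumes [measurable]: "f \<in> borel_measurable borel"
  shows "(\<integral>\<^sup>+x. f (c + x) \<partial>lborel) = (\<integral>\<^sup>+x. f x \<partial>lborel)"
proof -
  have "(\<integral>\<^sup>+x. f x \<partial>lborel) = (\<integral>\<^sup>+x. f x \<partial>distr lborel borel ((+) c))"
    by (simp add: lborel_distr_plus)
  also have "\<dots> = (\<integral>\<^sup>+x. f (c + x) \<partial>lborel)"
    by (subst nn_integral_distr) auto
  finally show ?thesis by simp
qed

lemma nn_integral_lborel_reflect:
  fixes f :: "'a::euclidean_space \<Rightarrow> ennreal"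
  assumes [measurable]: "f \<in> borel_measurable borel"
  shows "(\<integral>\<^sup>+x. f (c - x) \<partial>lborel) = (\<integral>\<^sup>+x. f x \<partial>lborel)"
proof -
  have "lborel = distr lborel borel (\<lambda>x. c - x)"
    using lborel_affine[of "-1" c] by (simp add: density_1)
  then have "(\<integral>\<^sup>+x. f x \<partial>lborel) = (\<integral>\<^sup>+x. f x \<partial>distr lborel borel (\<lambda>x. c - x))"
    by simp
  also have "\<dots> = (\<integral>\<^sup>+x. f (c - x) \<partial>lborel)"
    by (subst nn_integral_distr) auto
  finally show ?thesis by simp
qed

lemma matrix_vector_borel_measurable [measurable]:
  fixes A :: "real ^ 'n ^ 'm"
  shows "(*v) A \<in> borel_measurable borel"
  by (intro borel_measurable_continuous_onI continuous_intros)

text \<open>The classical double integral for the uniqueness of Haar measure: the push-forward of Lebesgue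
  measure under \<open>A\<close> is translation invariant, hence integrals with respect to it are proportional to
  Lebesgue integrals. The factor of proportionality is identified afterwards.\<close>

lemma nn_integral_linear_proportional:
  fixes A :: "real ^ 'n ^ 'n" and f g :: "real ^ 'n \<Rightarrow> ennreal"
  assumes det: "det A \<noteq> 0"
    and f [measurable]: "f \<in> borel_measurable borel" and g [measurable]: "g \<in> borel_measurable borel"
  shows "(\<integral>\<^sup>+x. f (A *v x) \<partial>lborel) * (\<integral>\<^sup>+x. g x \<partial>lborel) =
    (\<integral>\<^sup>+x. f x \<partial>lborel) * (\<integral>\<^sup>+x. g (A *v x) \<partial>lborel)"
proof -
  have inv: "A *v (matrix_inv A *v y) = y" for y
    by (simp add: matrix_vector_mul_assoc matrix_inv_right[OF det])
  \<comment> \<open>Translate \<open>x\<close> by the preimage of \<open>y\<close>, exchange, translate \<open>y\<close>, exchange, and reflect \<open>x\<close>.\<close>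
  have "(\<integral>\<^sup>+x. f (A *v x) \<partial>lborel) * (\<integral>\<^sup>+y. g y \<partial>lborel) =
      (\<integral>\<^sup>+y. (\<integral>\<^sup>+x. f (A *v x) \<partial>lborel) * g y \<partial>lborel)"
    by (simp add: nn_integral_cmult)
  also have "\<dots> = (\<integral>\<^sup>+y. (\<integral>\<^sup>+x. f (A *v x + y) * g y \<partial>lborel) \<partial>lborel)"
  proof (intro nn_integral_cong)
    fix y
    have "(\<integral>\<^sup>+x. f (A *v x) \<partial>lborel) = (\<integral>\<^sup>+x. f (A *v (matrix_inv A *v y + x)) \<partial>lborel)"
      by (subst nn_integral_lborel_shift) auto
    then show "(\<integral>\<^sup>+x. f (A *v x) \<partial>lborel) * g y = (\<integral>\<^sup>+x. f (A *v x + y) * g y \<partial>lborel)"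
      by (simp add: matrix_vector_right_distrib inv add.commute nn_integral_multc)
  qed
  also have "\<dots> = (\<integral>\<^sup>+x. (\<integral>\<^sup>+y. f (A *v x + y) * g y \<partial>lborel) \<partial>lborel)"
    by (rule lborel_pair.Fubini') measurable
  also have "\<dots> = (\<integral>\<^sup>+x. (\<integral>\<^sup>+y. f y * g (y - A *v x) \<partial>lborel) \<partial>lborel)"
  proof (rule nn_integral_cong)
    fix x
    show "(\<integral>\<^sup>+y. f (A *v x + y) * g y \<partial>lborel) = (\<integral>\<^sup>+y. f y * g (y - A *v x) \<partial>lborel)"
      using nn_integral_lborel_shift[of "\<lambda>y. f y * g (y - A *v x)" "A *v x"] by simp
  qed
  also have "\<dots> = (\<integral>\<^sup>+y. (\<integral>\<^sup>+x. f y * g (y - A *v x) \<partial>lborel) \<partial>lborel)"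
    by (rule lborel_pair.Fubini') measurable
  also have "\<dots> = (\<integral>\<^sup>+y. f y * (\<integral>\<^sup>+x. g (A *v x) \<partial>lborel) \<partial>lborel)"
  proof (intro nn_integral_cong)
    fix y
    have "(\<integral>\<^sup>+x. g (A *v x) \<partial>lborel) = (\<integral>\<^sup>+x. g (A *v (matrix_inv A *v y - x)) \<partial>lborel)"
      by (subst nn_integral_lborel_reflect) auto
    then show "(\<integral>\<^sup>+x. f y * g (y - A *v x) \<partial>lborel) = f y * (\<integral>\<^sup>+x. g (A *v x) \<partial>lborel)"
      by (simp add: matrix_vector_mult_diff_distrib inv nn_integral_cmult)
  qed
  also have "\<dots> = (\<integral>\<^sup>+x. f x \<partial>lborel) * (\<integral>\<^sup>+x. g (A *v x) \<partial>lborel)"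
    by (simp add: nn_integral_multc)
  finally show ?thesis .
qed

definition gauss_kernel :: "real ^ 'n \<Rightarrow> ennreal" where
  "gauss_kernel x = ennreal (exp (- (x \<bullet> x) / 2))"

lemma gauss_kernel_measurable [measurable]: "gauss_kernel \<in> borel_measurable borel"
  unfolding gauss_kernel_def by measurable

lemma nn_integral_gauss_kernel:
  "(\<integral>\<^sup>+x. gauss_kernel x \<partial>(lborel :: (real ^ 'n) measure)) = ennreal (sqrt ((2 * pi) ^ CARD('n)))"
proof -
  have one: "(\<integral>\<^sup>+x. ennreal (exp (- x\<^sup>2 / 2)) \<partial>lborel) = ennreal (sqrt (2 * pi))"
  proof -
    have "(\<integral>\<^sup>+x. ennreal (std_normal_density x) \<partial>lborel) = 1"
      using prob_space.emeasure_space_1[OF prob_space_normal_density[of 1 0]]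
      by (simp add: emeasure_density)
    then have "ennreal (sqrt (2 * pi)) * (\<integral>\<^sup>+x. ennreal (std_normal_density x) \<partial>lborel) = ennreal (sqrt (2 * pi))"
      by simp
    then show ?thesis
      by (subst (asm) nn_integral_cmult[symmetric])
        (auto simp: ennreal_mult'[symmetric] normal_density_def real_sqrt_mult)
  qed
  have "(\<integral>\<^sup>+x. gauss_kernel x \<partial>(lborel :: (real ^ 'n) measure)) =
    (\<integral>\<^sup>+x. (\<Prod>b\<in>Basis. ennreal (exp (- (x \<bullet> b)\<^sup>2 / 2))) \<partial>(lborel :: (real ^ 'n) measure))"
  proof (intro nn_integral_cong)
    fix x :: "real ^ 'n"
    have "- (x \<bullet> x) / 2 = (\<Sum>b\<in>Basis. - (x \<bullet> b)\<^sup>2 / 2)"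
      by (subst euclidean_inner) (simp add: power2_eq_square sum_negf sum_divide_distrib)
    then show "gauss_kernel x = (\<Prod>b\<in>Basis. ennreal (exp (- (x \<bullet> b)\<^sup>2 / 2)))"
      by (simp add: gauss_kernel_def exp_sum prod_ennreal)
  qed
  also have "\<dots> = (\<Prod>b\<in>(Basis :: (real ^ 'n) set). \<integral>\<^sup>+x. ennreal (exp (- x\<^sup>2 / 2)) \<partial>lborel)"
    by (rule nn_integral_lborel_prod) auto
  also have "\<dots> = ennreal (sqrt ((2 * pi) ^ CARD('n)))"
    by (simp only: one prod_constant real_sqrt_power ennreal_power real_sqrt_ge_zero
        mult_nonneg_nonneg zero_le_numeral pi_ge_zero) simp
  finally show ?thesis .
qed

lemma gauss_kernel_integral_cancel:
  "a * (\<integral>\<^sup>+x. gauss_kernel x \<partial>(lborel :: (real ^ 'n) measure)) =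
   b * (\<integral>\<^sup>+x. gauss_kernel x \<partial>(lborel :: (real ^ 'n) measure)) \<longleftrightarrow> a = b"
proof -
  have "\<not> sqrt ((2 * pi) ^ CARD('n)) \<le> 0" unfolding not_le by simp
  then show ?thesis unfolding nn_integral_gauss_kernel mult_right_ennreal_cancel by blast
qed

text \<open>The factor in \<open>\<integral> f(A x) dx = vol_scale A * \<integral> f(x) dx\<close>, read off from the Gaussian
  kernel because that function has a finite, positive and known integral.\<close>

definition vol_scale :: "real ^ 'n ^ 'n \<Rightarrow> real" where
  "vol_scale A = enn2real (\<integral>\<^sup>+x. gauss_kernel (A *v x) \<partial>lborel) / sqrt ((2 * pi) ^ CARD('n))"

lemma
  fixes A :: "real ^ 'n ^ 'n"
  assumes det: "det A \<noteq> 0"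
  shows nn_integral_vol_scale: "f \<in> borel_measurable borel \<Longrightarrow>
      (\<integral>\<^sup>+x. f (A *v x) \<partial>lborel) = ennreal (vol_scale A) * (\<integral>\<^sup>+x. f x \<partial>lborel)"
    and vol_scale_pos: "0 < vol_scale A"
proof -
  let ?I = "sqrt ((2 * pi) ^ CARD('n))"
  have I: "?I > 0" by simp
  define J where "J = (\<integral>\<^sup>+x. gauss_kernel (A *v x) \<partial>lborel)"
  define J' where "J' = (\<integral>\<^sup>+x. gauss_kernel (matrix_inv A *v x) \<partial>lborel)"
  have inv: "matrix_inv A *v (A *v y) = y" for y
    by (simp add: matrix_vector_mul_assoc matrix_inv_left[OF det])
  \<comment> \<open>The inverse matrix serves to exclude that the integral \<open>J\<close> is zero or infinite.\<close>
  have "ennreal ?I * ennreal ?I = J' * J"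
    using nn_integral_linear_proportional[OF det, of "\<lambda>x. gauss_kernel (matrix_inv A *v x)" gauss_kernel]
    by (simp add: inv nn_integral_gauss_kernel J_def J'_def)
  then have JJ: "J' * J = ennreal (?I * ?I)"
    by (metis I ennreal_mult less_imp_le)
  have pos: "ennreal (?I * ?I) \<noteq> 0"
    using I by (metis ennreal_eq_0_iff linorder_not_le mult_pos_pos)
  have "J \<noteq> 0" "J' \<noteq> 0" using JJ pos by auto
  have "J \<noteq> \<infinity>" using JJ \<open>J' \<noteq> 0\<close> by (metis ennreal_mult_eq_top_iff ennreal_neq_top infinity_ennreal_def)
  with \<open>J \<noteq> 0\<close> obtain j where j: "J = ennreal j" "j > 0"
    by (metis ennreal_cases ennreal_eq_0_iff infinity_ennreal_def linorder_not_le)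
  have v: "vol_scale A = j / ?I"
    using j by (simp add: vol_scale_def J_def[symmetric])
  then show "0 < vol_scale A" using j I by simp
  assume f: "f \<in> borel_measurable borel"
  have "(\<integral>\<^sup>+x. f (A *v x) \<partial>lborel) * ennreal ?I = (\<integral>\<^sup>+x. f x \<partial>lborel) * J"
    using nn_integral_linear_proportional[OF det f gauss_kernel_measurable]
    by (simp only: nn_integral_gauss_kernel J_def)
  also have "J = ennreal (vol_scale A) * ennreal ?I"
    using I j by (subst ennreal_mult[symmetric]) (auto simp: v)
  finally have "(\<integral>\<^sup>+x. f (A *v x) \<partial>lborel) * ennreal ?I =
      (ennreal (vol_scale A) * (\<integral>\<^sup>+x. f x \<partial>lborel)) * ennreal ?I"
    by (simp only: mult_ac)
  then show "(\<integral>\<^sup>+x. f (A *v x) \<partial>lborel) = ennreal (vol_scale A) * (\<integral>\<^sup>+x. f x \<partial>lborel)"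
    using I unfolding mult_right_ennreal_cancel by linarith
qed

lemma vol_scale_mult:
  fixes A B :: "real ^ 'n ^ 'n"
  assumes "det A \<noteq> 0" "det B \<noteq> 0"
  shows "vol_scale (A ** B) = vol_scale A * vol_scale B"
proof -
  have AB: "det (A ** B) \<noteq> 0" using assms by (simp add: det_mul)
  have "ennreal (vol_scale (A ** B)) * (\<integral>\<^sup>+x. gauss_kernel (x :: real ^ 'n) \<partial>lborel) =
      (\<integral>\<^sup>+x. gauss_kernel (A *v (B *v x)) \<partial>lborel)"
    using nn_integral_vol_scale[OF AB gauss_kernel_measurable] by (simp add: matrix_vector_mul_assoc)
  also have "\<dots> = ennreal (vol_scale B) * (\<integral>\<^sup>+x. gauss_kernel (A *v x) \<partial>lborel)"
    by (rule nn_integral_vol_scale[OF assms(2), of "\<lambda>x. gauss_kernel (A *v x)"]) measurable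
  also have "\<dots> = (ennreal (vol_scale A) * ennreal (vol_scale B)) * (\<integral>\<^sup>+x. gauss_kernel (x :: real ^ 'n) \<partial>lborel)"
    by (simp add: nn_integral_vol_scale[OF assms(1) gauss_kernel_measurable] mult_ac)
  finally have "ennreal (vol_scale (A ** B)) = ennreal (vol_scale A * vol_scale B)"
    by (subst (asm) gauss_kernel_integral_cancel)
      (simp add: ennreal_mult vol_scale_pos assms less_imp_le)
  then show ?thesis
    using vol_scale_pos[OF assms(1)] vol_scale_pos[OF assms(2)] vol_scale_pos[OF AB]
    by (metis ennreal_inj less_imp_le mult_pos_pos)
qed

lemma vol_scale_diagonal:
  fixes A :: "real ^ 'n ^ 'n"
  assumes diag: "\<And>i j. i \<noteq> j \<Longrightarrow> A $ i $ j = 0" and det: "det A \<noteq> 0"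
  shows "vol_scale A * \<bar>det A\<bar> = 1"
proof -
  have nz: "A $ i $ i \<noteq> 0" for i
    using det by (simp add: det_diagonal diag)
  define c where "c = (\<lambda>b :: real ^ 'n. b \<bullet> (A *v b))"
  have axis: "c (axis i 1) = A $ i $ i" for i
    by (simp add: c_def inner_axis' matrix_vector_mult_basis column_def)
  have Av: "A *v x = 0 + (\<Sum>j\<in>Basis. (c j * (x \<bullet> j)) *\<^sub>R j)" for x
  proof (subst euclidean_eq_iff, intro ballI)
    fix b :: "real ^ 'n" assume "b \<in> Basis"
    then obtain i where b: "b = axis i 1" by (auto simp: Basis_vec_def)
    have "(A *v x) $ i = A $ i $ i * x $ i"
      unfolding matrix_vector_mult_def
      by (simp, subst sum.remove[of UNIV i]) (auto intro!: sum.neutral simp: diag)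
    then show "(A *v x) \<bullet> b = (0 + (\<Sum>j\<in>Basis. (c j * (x \<bullet> j)) *\<^sub>R j)) \<bullet> b"
      using \<open>b \<in> Basis\<close> by (simp add: inner_sum_left_Basis) (simp add: b axis inner_axis)
  qed
  have prod: "(\<Prod>j\<in>Basis. \<bar>c j\<bar>) = \<bar>det A\<bar>"
  proof -
    have "(\<Prod>j\<in>(Basis :: (real ^ 'n) set). \<bar>c j\<bar>) = (\<Prod>i\<in>UNIV. \<bar>c (axis i 1)\<bar>)"
      by (rule prod.reindex_bij_betw[symmetric]) (auto simp: bij_betw_def inj_on_def axis_eq_axis Basis_vec_def)
    then show ?thesis by (simp add: axis det_diagonal[OF diag] abs_prod)
  qed
  have "lborel = density (distr lborel borel ((*v) A)) (\<lambda>_. ennreal (\<Prod>j\<in>Basis. \<bar>c j\<bar>))"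
    unfolding Av by (rule lborel_affine_euclidean) (auto simp: Basis_vec_def axis nz)
  then have "(\<integral>\<^sup>+x. gauss_kernel (x :: real ^ 'n) \<partial>lborel) =
      (\<integral>\<^sup>+x. gauss_kernel x \<partial>density (distr lborel borel ((*v) A)) (\<lambda>_. ennreal \<bar>det A\<bar>))"
    unfolding prod by (rule arg_cong)
  also have "\<dots> = (\<integral>\<^sup>+x. ennreal \<bar>det A\<bar> * gauss_kernel (A *v x) \<partial>lborel)"
    by (subst nn_integral_density) (auto simp: nn_integral_distr)
  also have "\<dots> = ennreal \<bar>det A\<bar> * (ennreal (vol_scale A) * (\<integral>\<^sup>+x. gauss_kernel (x :: real ^ 'n) \<partial>lborel))"
    by (simp add: nn_integral_cmult nn_integral_vol_scale[OF det gauss_kernel_measurable])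
  also have "\<dots> = ennreal (vol_scale A * \<bar>det A\<bar>) * (\<integral>\<^sup>+x. gauss_kernel (x :: real ^ 'n) \<partial>lborel)"
    using vol_scale_pos[OF det] by (simp add: ennreal_mult mult_ac)
  finally have "ennreal 1 = ennreal (vol_scale A * \<bar>det A\<bar>)"
    using gauss_kernel_integral_cancel[of 1 "ennreal (vol_scale A * \<bar>det A\<bar>)", where 'n = 'n] by simp
  then show ?thesis
    using vol_scale_pos[OF det] by (metis ennreal_inj mult_nonneg_nonneg abs_ge_zero less_imp_le zero_le_one)
qed

text \<open>Both \<open>vol_scale\<close> and the absolute determinant are multiplicative on invertible matrices, so it
  suffices to compare them on diagonal matrices, transpositions and shears. A transposition is an
  involution and a shear is conjugate to its own square; either property forces a positive
  multiplicative function to be 1 there.\<close>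

lemma vol_scale_det:
  fixes A :: "real ^ 'n ^ 'n"
  shows "det A \<noteq> 0 \<Longrightarrow> vol_scale A * \<bar>det A\<bar> = 1"
proof (induction A rule: induct_matrix_elementary_alt)
  case (1 A B)
  then show ?case
    by (simp add: det_mul vol_scale_mult abs_mult)
      (metis (no_types, lifting) mult.assoc mult.left_commute mult.right_neutral)
next
  case (2 A i)
  then show ?case by (simp add: det_zero_row)
next
  case (3 A)
  then show ?case by (simp add: vol_scale_diagonal)
next
  case (4 m n)
  let ?T = "\<chi> i j. (mat 1 :: real ^ 'n ^ 'n) $ i $ Transposition.transpose m n j"
  have T: "?T *v x = (\<chi> i. x $ Transposition.transpose m n i)" for x :: "real ^ 'n"
  proof -
    have "(?T *v x) $ i = x $ Transposition.transpose m n i" for i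
    proof -
      have sw: "i = Transposition.transpose m n j \<longleftrightarrow> j = Transposition.transpose m n i" for j
        by (metis transpose_involutory)
      have "(?T *v x) $ i = (\<Sum>j\<in>UNIV. if j = Transposition.transpose m n i then x $ j else 0)"
        unfolding matrix_vector_mult_def vec_lambda_beta mat_def
        by (rule sum.cong) (auto simp: sw)
      then show ?thesis by simp
    qed
    then show ?thesis by (simp add: vec_eq_iff)
  qed
  have TT: "?T ** ?T = mat 1"
    by (simp only: matrix_eq matrix_vector_mul_assoc[symmetric] T) (simp add: vec_eq_iff)
  then have "det ?T * det ?T = 1"
    by (metis det_I det_mul)
  then have "\<bar>det ?T\<bar> = 1"
    unfolding square_eq_1_iff by linarith
  moreover have "vol_scale (mat 1 :: real ^ 'n ^ 'n) = 1"
    using vol_scale_diagonal[of "mat 1 :: real ^ 'n ^ 'n"] by (simp only: det_I) (simp add: mat_def)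
  then have "vol_scale ?T * vol_scale ?T = 1"
    using vol_scale_mult[OF 4(2) 4(2)] TT by metis
  then have "vol_scale ?T = 1"
    using vol_scale_pos[OF 4(2)] unfolding square_eq_1_iff by linarith
  ultimately show ?case by simp
next
  case (5 m n)
  let ?S = "\<chi> i j. of_bool (i = m \<and> j = n \<or> i = j) :: real ^ 'n ^ 'n"
  let ?D = "\<chi> i j. if i = j then (if i = m then 2 else 1) else 0 :: real ^ 'n ^ 'n"
  have S: "?S *v x = (\<chi> i. x $ i + (if i = m then x $ n else 0))" for x :: "real ^ 'n"
  proof -
    have "(?S *v x) $ i = x $ i + (if i = m then x $ n else 0)" for i
    proof -
      have "(?S *v x) $ i = (\<Sum>j\<in>UNIV. (if j = i then x $ j else 0) + (if j = n then (if i = m then x $ j else 0) else 0))"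
        unfolding matrix_vector_mult_def vec_lambda_beta using 5(1) by (intro sum.cong) auto
      then show ?thesis by (simp only: sum.distrib sum.delta finite) simp
    qed
    then show ?thesis by (simp add: vec_eq_iff)
  qed
  have D: "?D *v x = (\<chi> i. (if i = m then 2 else 1) * x $ i)" for x :: "real ^ 'n"
  proof -
    have "(?D *v x) $ i = (if i = m then 2 else 1) * x $ i" for i
    proof -
      have "(?D *v x) $ i = (\<Sum>j\<in>UNIV. if j = i then (if i = m then 2 else 1) * x $ j else 0)"
        unfolding matrix_vector_mult_def vec_lambda_beta by (intro sum.cong) auto
      then show ?thesis by simp
    qed
    then show ?thesis by (simp add: vec_eq_iff)
  qed
  \<comment> \<open>Doubling one coordinate conjugates the shear to its own square, so a multiplicative
    function that does not vanish on it takes the value 1 there.\<close>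
  have conj: "?D ** ?S = ?S ** ?S ** ?D"
    using 5(1) by (simp only: matrix_eq matrix_vector_mul_assoc[symmetric] S D) (simp add: vec_eq_iff)
  have dD: "det ?D \<noteq> 0" by (subst det_diagonal) auto
  have SS: "det (?S ** ?S) \<noteq> 0" using 5(2) unfolding det_mul mult_eq_0_iff by blast
  have idem: "s = 1" if "d * s = s * s * d" "d \<noteq> 0" "s \<noteq> 0" for d s :: real
    using that by auto
  have "det ?D * det ?S = det ?S * det ?S * det ?D"
    using arg_cong[OF conj, of det] unfolding det_mul .
  then have "det ?S = 1" using dD 5(2) by (rule idem)
  moreover have "vol_scale ?D * vol_scale ?S = vol_scale ?S * vol_scale ?S * vol_scale ?D"
    using arg_cong[OF conj, of vol_scale]
    by (simp only: vol_scale_mult[OF dD 5(2)] vol_scale_mult[OF SS dD] vol_scale_mult[OF 5(2) 5(2)])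
  then have "vol_scale ?S = 1"
    using vol_scale_pos[OF 5(2)] vol_scale_pos[OF dD] by (intro idem) (assumption, linarith+)
  ultimately show ?case by simp
qed

lemma nn_integral_linear_change:
  fixes A :: "real ^ 'n ^ 'n"
  assumes det: "det A \<noteq> 0" and f [measurable]: "f \<in> borel_measurable borel"
  shows "(\<integral>\<^sup>+x. f x \<partial>lborel) = (\<integral>\<^sup>+x. ennreal \<bar>det A\<bar> * f (A *v x) \<partial>lborel)"
proof -
  have "(\<integral>\<^sup>+x. ennreal \<bar>det A\<bar> * f (A *v x) \<partial>lborel) =
      ennreal (\<bar>det A\<bar> * vol_scale A) * (\<integral>\<^sup>+x. f x \<partial>lborel)"
    using vol_scale_pos[OF det]
    by (simp add: nn_integral_cmult nn_integral_vol_scale[OF det f] ennreal_mult mult.assoc)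
  then show ?thesis
    using vol_scale_det[OF det] by (simp add: mult.commute)
qed

lemma AE_lborel_linear:
  fixes A :: "real ^ 'n ^ 'n"
  assumes det: "det A \<noteq> 0" and AE: "AE x in lborel. P x"
  shows "AE x in lborel. P (A *v x)"
proof -
  from AE obtain N where N: "{x. \<not> P x} \<subseteq> N" "N \<in> sets borel" "emeasure lborel N = 0"
    by (auto elim!: AE_E)
  have [measurable]: "N \<in> sets borel" by fact
  have "(\<integral>\<^sup>+x. indicator N (A *v x) \<partial>lborel) = 0"
    using nn_integral_vol_scale[OF det, of "indicator N"] N(3) by simp
  then have "AE x in lborel. A *v x \<notin> N"
    by (subst (asm) nn_integral_0_iff_AE) (auto simp: indicator_eq_0_iff)
  then show ?thesis by (rule AE_mp) (use N(1) in auto)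
qed

section \<open>Gaussian measures as affine images of the standard one\<close>

abbreviation std_gaussian :: "(real ^ 'n) measure" where
  "std_gaussian \<equiv> gaussian 0 (mat 1)"

lemma matrix_inv_mat_1: "matrix_inv (mat 1 :: real ^ 'n ^ 'n) = mat 1"
  by (rule matrix_inv_eqI) simp

lemma sets_gaussian [simp, measurable_cong]: "sets (gaussian \<mu> \<Phi>) = sets borel"
  by (simp add: gaussian_def)

lemma space_gaussian [simp]: "space (gaussian \<mu> \<Phi>) = UNIV"
  by (simp add: gaussian_def)

lemma std_gaussian_eq:
  "(std_gaussian :: (real ^ 'n) measure) =
    density lborel (\<lambda>x. gauss_kernel x / ennreal (sqrt ((2 * pi) ^ CARD('n))))"
  unfolding gaussian_def
  by (rule arg_cong[where f = "density lborel"])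
    (simp add: gauss_kernel_def matrix_inv_mat_1 divide_ennreal)

lemma prob_space_std_gaussian: "prob_space (std_gaussian :: (real ^ 'n) measure)"
proof
  show "emeasure (std_gaussian :: (real ^ 'n) measure) (space std_gaussian) = 1"
    by (simp add: std_gaussian_eq emeasure_density nn_integral_divide nn_integral_gauss_kernel)
qed

lemma AE_std_gaussian: "(AE x in std_gaussian. P x) \<longleftrightarrow> (AE x in lborel. P x)"
  unfolding std_gaussian_eq
  by (subst AE_density) (auto simp: gauss_kernel_def divide_ennreal)

lemma gaussian_factor:
  fixes A :: "real ^ 'n ^ 'n"
  assumes det: "det A \<noteq> 0"
  shows "gaussian \<mu> (A ** transpose A) = distr std_gaussian borel (\<lambda>x. \<mu> + A *v x)"
proof (rule measure_eqI)
  fix S assume "S \<in> sets (gaussian \<mu> (A ** transpose A))"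
  then have [measurable]: "S \<in> sets borel" by simp
  let ?\<Phi> = "A ** transpose A"
  let ?c = "sqrt ((2 * pi) ^ CARD('n))"
  have detT: "det (transpose A) \<noteq> 0" using det by simp
  have inv: "matrix_inv ?\<Phi> = transpose (matrix_inv A) ** matrix_inv A"
  proof (rule matrix_inv_eqI(1))
    have "?\<Phi> ** (transpose (matrix_inv A) ** matrix_inv A) =
        A ** (transpose A ** transpose (matrix_inv A)) ** matrix_inv A"
      by (simp add: matrix_mul_assoc)
    then show "?\<Phi> ** (transpose (matrix_inv A) ** matrix_inv A) = mat 1"
      by (simp add: matrix_transpose_mul[symmetric] matrix_inv_left[OF det] matrix_inv_right[OF det])
  qed
  have quad: "(A *v x) \<bullet> (matrix_inv ?\<Phi> *v (A *v x)) = x \<bullet> x" for x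
  proof -
    have Ax: "matrix_inv A *v (A *v x) = x"
      by (simp add: matrix_vector_mul_assoc matrix_inv_left[OF det])
    show ?thesis
      unfolding inv by (simp only: matrix_vector_mul_assoc[symmetric] inner_matrix_transpose Ax)
  qed
  have sq: "sqrt ((2 * pi) ^ CARD('n) * det ?\<Phi>) = ?c * \<bar>det A\<bar>"
    by (simp add: real_sqrt_mult det_mul)
  have pre [measurable]: "(\<lambda>x. \<mu> + A *v x) -` S \<in> sets borel"
    by (rule measurable_sets_borel[of _ borel]) auto
  define h where "h y = ennreal (exp (- ((y - \<mu>) \<bullet> (matrix_inv ?\<Phi> *v (y - \<mu>))) / 2) /
    sqrt ((2 * pi) ^ CARD('n) * det ?\<Phi>)) * indicator S y" for y
  have [measurable]: "h \<in> borel_measurable borel"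
    unfolding h_def by measurable
  have "emeasure (gaussian \<mu> ?\<Phi>) S = (\<integral>\<^sup>+y. h y \<partial>lborel)"
    by (simp add: gaussian_def emeasure_density h_def)
  also have "\<dots> = (\<integral>\<^sup>+y. h (\<mu> + y) \<partial>lborel)"
    by (rule nn_integral_lborel_shift[symmetric]) measurable
  also have "\<dots> = (\<integral>\<^sup>+x. ennreal \<bar>det A\<bar> * h (\<mu> + A *v x) \<partial>lborel)"
    by (rule nn_integral_linear_change[OF det]) measurable
  also have "\<dots> = (\<integral>\<^sup>+x. gauss_kernel x / ennreal ?c * indicator ((\<lambda>x. \<mu> + A *v x) -` S) x \<partial>lborel)"
  proof (intro nn_integral_cong)
    fix x
    have "h (\<mu> + A *v x) = ennreal (exp (- (x \<bullet> x) / 2) / (?c * \<bar>det A\<bar>)) * indicator S (\<mu> + A *v x)"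
      unfolding h_def sq by (simp add: quad)
    then show "ennreal \<bar>det A\<bar> * h (\<mu> + A *v x) =
        gauss_kernel x / ennreal ?c * indicator ((\<lambda>x. \<mu> + A *v x) -` S) x"
      using det by (simp add: gauss_kernel_def divide_ennreal mult.assoc[symmetric] ennreal_mult[symmetric] indicator_def)
  qed
  also have "\<dots> = emeasure std_gaussian ((\<lambda>x. \<mu> + A *v x) -` S)"
    unfolding std_gaussian_eq by (rule emeasure_density[symmetric]) auto
  also have "\<dots> = emeasure (distr std_gaussian borel (\<lambda>x. \<mu> + A *v x)) S"
    by (subst emeasure_distr) auto
  finally show "emeasure (gaussian \<mu> ?\<Phi>) S = emeasure (distr std_gaussian borel (\<lambda>x. \<mu> + A *v x)) S" .
qed simp

text \<open>The columns of the factor are obtained by Gram--Schmidt for the inner product given by the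
  inverse covariance matrix. The factorization shows that the density of an arbitrary Gaussian measure
  has total mass one, so that rejection probabilities over a whole covariance model are bounded
  by 1.\<close>

lemma sym_pos_def_factor:
  fixes \<Phi> :: "real ^ 'n ^ 'n"
  assumes "sym_pos_def \<Phi>"
  shows "\<exists>A. det A \<noteq> 0 \<and> \<Phi> = A ** transpose A"
proof -
  define Q where "Q = matrix_inv \<Phi>"
  have pf: "pos_form \<Phi>" using assms by (simp add: sym_pos_def_def pos_form_def)
  note d = pos_form_det[OF pf]
  have Qpos: "x \<noteq> 0 \<Longrightarrow> 0 < x \<bullet> (Q *v x)" for x
    using pos_form_inverse[OF pf] by (simp add: Q_def pos_form_def)
  have Qsym: "transpose Q = Q"
  proof -
    have "\<Phi> ** transpose Q = transpose (Q ** \<Phi>)"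
      using assms by (simp add: matrix_transpose_mul sym_pos_def_def)
    then show ?thesis
      by (metis Q_def d matrix_inv_eqI(1) matrix_inv_left transpose_mat)
  qed
  have sym: "x \<bullet> (Q *v y) = y \<bullet> (Q *v x)" for x y
    by (metis Qsym inner_commute inner_matrix_transpose)
  have "\<exists>b. \<forall>i\<in>I. \<forall>j\<in>I. b i \<bullet> (Q *v b j) = of_bool (i = j)" if "finite I" for I :: "'n set"
    using that
  proof (induction I)
    case (insert m I)
    then obtain b where b: "\<And>i j. i \<in> I \<Longrightarrow> j \<in> I \<Longrightarrow> b i \<bullet> (Q *v b j) = of_bool (i = j)" by blast
    have "dim (b ` I) \<le> card I"
      by (meson card_image_le dim_le_card' finite_imageI insert.hyps(1) le_trans)
    also have "\<dots> < CARD('n)"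
      using insert.hyps by (metis card_seteq finite not_less subset_UNIV UNIV_I)
    finally have "span (b ` I) \<noteq> UNIV"
      by (metis dim_UNIV dim_span DIM_cart DIM_real mult.right_neutral less_irrefl)
    then obtain x where x: "x \<notin> span (b ` I)" by auto
    define y where "y = x - (\<Sum>i\<in>I. (b i \<bullet> (Q *v x)) *\<^sub>R b i)"
    have "(\<Sum>i\<in>I. (b i \<bullet> (Q *v x)) *\<^sub>R b i) \<in> span (b ` I)"
      by (intro span_sum span_scale span_base) auto
    then have "y \<noteq> 0" using x by (auto simp: y_def)
    then have q: "0 < y \<bullet> (Q *v y)" by (rule Qpos)
    have orth: "y \<bullet> (Q *v b j) = 0" if "j \<in> I" for j
    proof -
      have "y \<bullet> (Q *v b j) = x \<bullet> (Q *v b j) - (\<Sum>i\<in>I. (b i \<bullet> (Q *v x)) * (b i \<bullet> (Q *v b j)))"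
        by (simp add: y_def inner_diff_left inner_sum_left)
      also have "(\<Sum>i\<in>I. (b i \<bullet> (Q *v x)) * (b i \<bullet> (Q *v b j))) = (\<Sum>i\<in>I. if i = j then b i \<bullet> (Q *v x) else 0)"
        by (intro sum.cong) (auto simp: b that)
      finally show ?thesis using that insert.hyps by (simp add: sym)
    qed
    define z where "z = (1 / sqrt (y \<bullet> (Q *v y))) *\<^sub>R y"
    have zz: "z \<bullet> (Q *v z) = 1" using q by (simp add: z_def matrix_vector_mult_scaleR)
    have zj: "z \<bullet> (Q *v b j) = 0" "b j \<bullet> (Q *v z) = 0" if "j \<in> I" for j
      using orth[OF that] sym[of "b j" z] by (simp_all add: z_def)
    show ?case
      by (rule exI[of _ "b(m := z)"]) (use insert.hyps zz zj b in auto)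
  qed simp
  from this[of UNIV] obtain b :: "'n \<Rightarrow> real ^ 'n" where "\<forall>i\<in>UNIV. \<forall>j\<in>UNIV. b i \<bullet> (Q *v b j) = of_bool (i = j)"
    by auto
  then have b: "b i \<bullet> (Q *v b j) = of_bool (i = j)" for i j by simp
  define A where "A = transpose (\<chi> i. b i)"
  have col: "A *v axis j 1 = b j" for j
    by (simp add: matrix_vector_mult_basis A_def column_def transpose_def vec_eq_iff)
  have AQA: "transpose A ** (Q ** A) = mat 1"
  proof -
    have "(transpose A ** (Q ** A)) $ i $ j = mat 1 $ i $ j" for i j
    proof -
      have "(transpose A ** (Q ** A)) $ i $ j = axis i 1 \<bullet> ((transpose A ** (Q ** A)) *v axis j 1)"
        by (simp add: inner_axis' matrix_vector_mult_basis column_def)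
      also have "\<dots> = b i \<bullet> (Q *v b j)"
        by (simp only: matrix_vector_mul_assoc[symmetric] inner_matrix_transpose col)
      finally show ?thesis by (simp add: b mat_def)
    qed
    then show ?thesis by (simp add: vec_eq_iff)
  qed
  have dA: "det A \<noteq> 0" using matrix_inv_eqI(2)[OF AQA] by simp
  have "(Q ** A) ** transpose A = mat 1" using AQA matrix_left_right_inverse by blast
  then have "matrix_inv Q = A ** transpose A" by (intro matrix_inv_eqI) (simp add: matrix_mul_assoc)
  moreover have "matrix_inv Q = \<Phi>"
    unfolding Q_def by (rule matrix_inv_eqI) (rule matrix_inv_left[OF d])
  ultimately show ?thesis using dA by metis
qed

lemma measure_gaussian_factor:
  fixes A :: "real ^ 'n ^ 'n"
  assumes "det A \<noteq> 0" and [measurable]: "W \<in> sets borel"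
  shows "measure (gaussian \<mu> (A ** transpose A)) W = measure std_gaussian {x. \<mu> + A *v x \<in> W}"
  unfolding gaussian_factor[OF assms(1)] by (subst measure_distr) (auto simp: vimage_def)

lemma prob_space_gaussian:
  fixes \<Phi> :: "real ^ 'n ^ 'n"
  assumes "sym_pos_def \<Phi>"
  shows "prob_space (gaussian \<mu> \<Phi>)"
proof -
  obtain A where "det A \<noteq> 0" and A: "\<Phi> = A ** transpose A"
    using sym_pos_def_factor[OF assms] by blast
  then show ?thesis
    unfolding A gaussian_factor[OF \<open>det A \<noteq> 0\<close>]
    by (intro prob_space.prob_space_distr[OF prob_space_std_gaussian]) measurable
qed

section \<open>The AR(1) correlation matrix\<close>

lemma pos_inj: "pos i = pos j \<longleftrightarrow> i = j"
  using bij_betw_pos by (metis bij_betw_def injD)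

lemma pos_bounds: "1 \<le> pos i" "pos (i :: 'n::{finite,linorder}) \<le> CARD('n::{finite,linorder})"
  using bij_betw_pos[where 'n = 'n] by (auto simp: bij_betw_def)

lemma pos_inv: "1 \<le> t \<Longrightarrow> t \<le> CARD('n::{finite,linorder}) \<Longrightarrow> pos (inv pos t :: 'n) = t"
  using bij_betw_pos[where 'n = 'n] by (metis atLeastAtMost_iff bij_betw_def f_inv_into_f)

text \<open>The powers \<open>\<rho>^(i - j)\<close> below the diagonal: the matrix that solves the recursion
  \<open>y\<^sub>t = \<rho> y\<^sub>t\<^sub>-\<^sub>1 + innovation\<close>. Its inverse is \<open>ar_diff\<close>, which forms the quasi-differences
  \<open>y\<^sub>t - \<rho> y\<^sub>t\<^sub>-\<^sub>1\<close>.\<close>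

definition ar_lower :: "real \<Rightarrow> real ^ 'n::{finite,linorder} ^ 'n::{finite,linorder}" where
  "ar_lower \<rho> = (\<chi> i j. if pos j \<le> pos i then \<rho> ^ (pos i - pos j) else 0)"

definition ar_diff :: "real \<Rightarrow> real ^ 'n::{finite,linorder} ^ 'n::{finite,linorder}" where
  "ar_diff \<rho> = (\<chi> i j. if i = j then 1 else if pos i = Suc (pos j) then - \<rho> else 0)"

definition ar_diag :: "real \<Rightarrow> real ^ 'n::{finite,linorder} ^ 'n::{finite,linorder}" where
  "ar_diag v = (\<chi> i j. if i = j then (if pos i = 1 then 1 else v) else 0)"

lemma ar_diff_row:
  fixes f :: "'n::{finite,linorder} \<Rightarrow> real"
  shows "(\<Sum>k\<in>UNIV. ar_diff \<rho> $ i $ k * f k) =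
    f i - (if pos i = 1 then 0 else \<rho> * f (inv pos (pos i - 1)))"
proof (cases "pos i = 1")
  case True
  then have "ar_diff \<rho> $ i $ k * f k = (if k = i then f k else 0)" for k
    using pos_bounds(1)[of k] by (auto simp: ar_diff_def)
  then show ?thesis using True by simp
next
  case False
  define h :: 'n where "h = inv pos (pos i - 1)"
  have ph: "pos i = Suc (pos h)"
    using False pos_bounds[of i] pos_inv[where 'n = 'n, of "pos i - 1"] by (simp add: h_def)
  then have "h \<noteq> i" by auto
  have "ar_diff \<rho> $ i $ k * f k = (if k = i then f k else 0) + (if k = h then - \<rho> * f k else 0)" for k
    using \<open>h \<noteq> i\<close> ph by (auto simp: ar_diff_def pos_inj)
  then show ?thesis using False by (simp add: sum.distrib h_def)
qed

lemma ar_diff_lower: "ar_diff \<rho> ** ar_lower \<rho> = (mat 1 :: real ^ 'n::{finite,linorder} ^ 'n::{finite,linorder})"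
proof -
  have "(ar_diff \<rho> ** ar_lower \<rho>) $ i $ j = mat 1 $ i $ j" for i j :: 'n
  proof -
    have "(ar_diff \<rho> ** ar_lower \<rho>) $ i $ j = (\<Sum>k\<in>UNIV. ar_diff \<rho> $ i $ k * ar_lower \<rho> $ k $ j)"
      by (simp add: matrix_matrix_mult_def)
    also have "\<dots> = ar_lower \<rho> $ i $ j - (if pos i = 1 then 0 else \<rho> * ar_lower \<rho> $ inv pos (pos i - 1) $ j)"
      by (rule ar_diff_row)
    also have "\<dots> = mat 1 $ i $ j"
    proof (cases "pos i = 1")
      case True
      then show ?thesis using pos_bounds(1)[of j] by (auto simp: ar_lower_def mat_def pos_inj[symmetric])
    next
      case False
      define h :: 'n where "h = inv pos (pos i - 1)"
      have ph: "pos i = Suc (pos h)"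
        using False pos_bounds[of i] pos_inv[where 'n = 'n, of "pos i - 1"] by (simp add: h_def)
      show ?thesis unfolding h_def[symmetric]
        by (cases "pos j \<le> pos h") (use pos_bounds(1)[of j] in \<open>auto simp: ar_lower_def mat_def ph pos_inj[symmetric] Suc_diff_le\<close>)
    qed
    finally show ?thesis .
  qed
  then show ?thesis by (simp add: vec_eq_iff)
qed

lemma ar_lower_diff: "ar_lower \<rho> ** ar_diff \<rho> = mat 1"
  using ar_diff_lower matrix_left_right_inverse by blast

lemma det_ar_lower: "det (ar_lower \<rho>) \<noteq> 0"
  by (rule matrix_inv_eqI(2)[OF ar_lower_diff])

text \<open>Quasi-differencing the rows of the correlation matrix annihilates everything below the diagonal,
  since there consecutive rows are proportional with factor \<open>\<rho>\<close>.\<close>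

lemma ar_diff_Lam: "ar_diff \<rho> ** Lam \<rho> =
    ar_diag (1 - \<rho>\<^sup>2) ** transpose (ar_lower \<rho> :: real ^ 'n::{finite,linorder} ^ 'n::{finite,linorder})"
proof -
  have "(ar_diff \<rho> ** Lam \<rho>) $ i $ j = (ar_diag (1 - \<rho>\<^sup>2) ** transpose (ar_lower \<rho>)) $ i $ j" for i j :: 'n
  proof -
    have "(ar_diff \<rho> ** Lam \<rho>) $ i $ j = (\<Sum>k\<in>UNIV. ar_diff \<rho> $ i $ k * Lam \<rho> $ k $ j)"
      by (simp add: matrix_matrix_mult_def)
    also have "\<dots> = Lam \<rho> $ i $ j - (if pos i = 1 then 0 else \<rho> * Lam \<rho> $ inv pos (pos i - 1) $ j)"
      by (rule ar_diff_row)
    also have "\<dots> = (if pos i = 1 then 1 else 1 - \<rho>\<^sup>2) * ar_lower \<rho> $ j $ i"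
    proof (cases "pos i = 1")
      case True
      then show ?thesis using pos_bounds(1)[of j] by (auto simp: ar_lower_def Lam_def nat_diff_distrib' abs_if)
    next
      case False
      define h :: 'n where "h = inv pos (pos i - 1)"
      have ph: "pos i = Suc (pos h)"
        using False pos_bounds[of i] pos_inv[where 'n = 'n, of "pos i - 1"] by (simp add: h_def)
      have L: "Lam \<rho> $ a $ b = \<rho> ^ (max (pos a) (pos b) - min (pos a) (pos b))" for a b :: 'n
        by (auto simp: Lam_def max_def min_def abs_if nat_diff_distrib' intro!: arg_cong[where f = "\<lambda>x. \<rho> ^ x"])
      show ?thesis
      proof (cases "pos j \<le> pos h")
        case True
        then show ?thesis unfolding h_def[symmetric] using False
          by (simp add: L ar_lower_def ph max_def min_def Suc_diff_le)
      next
        case F: False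
        then obtain d where "pos j = Suc (pos h) + d" using nat_le_iff_add[of "Suc (pos h)" "pos j"] by auto
        then show ?thesis unfolding h_def[symmetric] using False
          by (simp add: L ar_lower_def ph max_def min_def algebra_simps power2_eq_square)
      qed
    qed
    also have "\<dots> = (\<Sum>k\<in>UNIV. if k = i then (if pos i = 1 then 1 else 1 - \<rho>\<^sup>2) * ar_lower \<rho> $ j $ k else 0)"
      by simp
    also have "\<dots> = (ar_diag (1 - \<rho>\<^sup>2) ** transpose (ar_lower \<rho>)) $ i $ j"
      unfolding matrix_matrix_mult_def ar_diag_def transpose_def vec_lambda_beta
      by (intro sum.cong) auto
    finally show ?thesis .
  qed
  then show ?thesis by (simp add: vec_eq_iff)
qed

text \<open>The innovations form of a stationary AR(1) process: multiplication by the lower triangular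
  factor solves the recursion, and the diagonal factor holds the variances of the first value and
  of the innovations.\<close>

lemma Lam_factor: "Lam \<rho> = ar_lower \<rho> ** ar_diag (1 - \<rho>\<^sup>2) ** transpose (ar_lower \<rho>)"
proof -
  have "Lam \<rho> = (ar_lower \<rho> ** ar_diff \<rho>) ** Lam \<rho>"
    by (simp add: ar_lower_diff)
  also have "\<dots> = ar_lower \<rho> ** (ar_diff \<rho> ** Lam \<rho>)"
    by (simp only: matrix_mul_assoc)
  finally show ?thesis by (simp only: ar_diff_Lam matrix_mul_assoc)
qed

lemma det_ar_diag: "v \<noteq> 0 \<Longrightarrow> det (ar_diag v) \<noteq> 0"
  unfolding ar_diag_def by (subst det_diagonal) auto

lemma ar_diag_mult_vec: "ar_diag v *v x = (\<chi> i. (if pos i = 1 then 1 else v) * x $ i)"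
proof -
  have "(ar_diag v *v x) $ i = (if pos i = 1 then 1 else v) * x $ i" for i
  proof -
    have "(ar_diag v *v x) $ i = (\<Sum>k\<in>UNIV. if k = i then (if pos i = 1 then 1 else v) * x $ k else 0)"
      unfolding matrix_vector_mult_def ar_diag_def vec_lambda_beta by (intro sum.cong) auto
    then show ?thesis by simp
  qed
  then show ?thesis by (simp add: vec_eq_iff)
qed

lemma det_Lam: "\<rho>\<^sup>2 \<noteq> 1 \<Longrightarrow> det (Lam \<rho>) \<noteq> 0"
  unfolding Lam_factor by (simp add: det_mul det_ar_lower det_ar_diag)

lemma pos_form_Lam:
  assumes "\<bar>\<rho>\<bar> < 1"
  shows "pos_form (Lam \<rho> :: real ^ 'n::{finite,linorder} ^ 'n::{finite,linorder})"
proof -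
  have v: "0 < 1 - \<rho>\<^sup>2" using assms by (simp add: abs_square_less_1)
  have "pos_form (ar_diag (1 - \<rho>\<^sup>2) :: real ^ 'n::{finite,linorder} ^ 'n::{finite,linorder})"
    unfolding pos_form_def
  proof (intro allI impI)
    fix x :: "real ^ 'n::{finite,linorder}" assume "x \<noteq> 0"
    then obtain i where "x $ i \<noteq> 0" by (auto simp: vec_eq_iff)
    with v have "0 < (\<Sum>i\<in>UNIV. (if pos i = 1 then 1 else 1 - \<rho>\<^sup>2) * (x $ i * x $ i))"
      by (intro sum_pos2[of _ i]) (auto simp: zero_less_mult_iff)
    then show "0 < x \<bullet> (ar_diag (1 - \<rho>\<^sup>2) *v x)"
      by (simp add: inner_vec_def ar_diag_mult_vec mult.left_commute)
  qed
  moreover have "inj ((*v) (transpose (ar_lower \<rho> :: real ^ 'n::{finite,linorder} ^ 'n::{finite,linorder})))"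
    by (intro inj_matrix_vector_mult) (simp only: invertible_det_nz det_transpose det_ar_lower not_False_eq_True)
  ultimately show ?thesis
    unfolding Lam_factor by (metis pos_form_congruence transpose_transpose)
qed

definition ar_root :: "real \<Rightarrow> real ^ 'n::{finite,linorder} ^ 'n::{finite,linorder}" where
  "ar_root \<rho> = ar_lower \<rho> ** ar_diag (sqrt (1 - \<rho>\<^sup>2))"

lemma Lam_root:
  assumes "\<bar>\<rho>\<bar> < 1"
  shows "Lam \<rho> = ar_root \<rho> ** transpose (ar_root \<rho> :: real ^ 'n::{finite,linorder} ^ 'n::{finite,linorder})"
    and "det (ar_root \<rho> :: real ^ 'n::{finite,linorder} ^ 'n::{finite,linorder}) \<noteq> 0"
proof -
  have v: "0 < 1 - \<rho>\<^sup>2" using assms by (simp add: abs_square_less_1)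
  have "ar_diag (sqrt (1 - \<rho>\<^sup>2)) ** ar_diag (sqrt (1 - \<rho>\<^sup>2)) = (ar_diag (1 - \<rho>\<^sup>2) :: real ^ 'n::{finite,linorder} ^ 'n::{finite,linorder})"
    using v by (simp add: matrix_eq matrix_vector_mul_assoc[symmetric] ar_diag_mult_vec vec_eq_iff)
  moreover have "transpose (ar_diag v) = (ar_diag v :: real ^ 'n::{finite,linorder} ^ 'n::{finite,linorder})" for v
    by (simp add: ar_diag_def transpose_def vec_eq_iff)
  ultimately show "Lam \<rho> = ar_root \<rho> ** transpose (ar_root \<rho> :: real ^ 'n::{finite,linorder} ^ 'n::{finite,linorder})"
    unfolding Lam_factor ar_root_def by (metis matrix_mul_assoc matrix_transpose_mul)
  show "det (ar_root \<rho> :: real ^ 'n::{finite,linorder} ^ 'n::{finite,linorder}) \<noteq> 0"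
    using v by (simp add: ar_root_def det_mul det_ar_lower det_ar_diag)
qed

definition first_time :: "'n::{finite,linorder}" where
  "first_time = inv pos 1"

lemma pos_first_time: "pos first_time = 1"
  unfolding first_time_def by (rule pos_inv) (auto simp: Suc_le_eq)

text \<open>The splitting of an AR(1) sample into the contribution of its first value and that of the
  innovations. Near a unit root the second part is of smaller order.\<close>

lemma ar_root_apply:
  "ar_root \<rho> *v z = z $ first_time *\<^sub>R (ar_lower \<rho> *v axis first_time 1) +
     sqrt (1 - \<rho>\<^sup>2) *\<^sub>R (ar_lower \<rho> *v (z - z $ first_time *\<^sub>R axis first_time 1))"
proof -
  have "pos i = 1 \<longleftrightarrow> i = first_time" for i :: 'a
    by (metis pos_first_time pos_inj)
  then have "ar_diag v *v z = z $ first_time *\<^sub>R axis first_time 1 + v *\<^sub>R (z - z $ first_time *\<^sub>R axis first_time 1)" for v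
    by (auto simp: ar_diag_mult_vec vec_eq_iff axis_def)
  then show ?thesis
    by (simp add: ar_root_def matrix_vector_mul_assoc[symmetric] matrix_vector_right_distrib matrix_vector_mult_scaleR)
qed

lemma measure_gaussian_Lam:
  assumes "\<bar>\<rho>\<bar> < 1" "0 < \<sigma>2" and W: "W \<in> sets borel"
  shows "measure (gaussian (\<mu> :: real ^ 'n::{finite,linorder}) (\<sigma>2 *\<^sub>R Lam \<rho>)) W = measure std_gaussian {z. \<mu> + sqrt \<sigma>2 *\<^sub>R (ar_root \<rho> *v z) \<in> W}"
proof -
  have "\<sigma>2 *\<^sub>R Lam \<rho> = (sqrt \<sigma>2 *\<^sub>R ar_root \<rho>) ** transpose (sqrt \<sigma>2 *\<^sub>R ar_root \<rho> :: real ^ 'n::{finite,linorder} ^ 'n::{finite,linorder})"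
    using assms by (simp add: Lam_root transpose_scalar matrix_scalar_ac scalar_matrix_assoc[symmetric])
  moreover have "det (sqrt \<sigma>2 *\<^sub>R ar_root \<rho> :: real ^ 'n::{finite,linorder} ^ 'n::{finite,linorder}) \<noteq> 0"
    using assms Lam_root(2)[OF assms(1)] by (simp add: det_scaleR)
  ultimately show ?thesis
    by (simp add: measure_gaussian_factor[OF _ W] scaleR_matrix_vector_assoc)
qed

text \<open>The two directions in which the AR(1) matrices concentrate: the vectors of powers of
  \<open>s = 1\<close> and of \<open>s = -1\<close>.\<close>

definition unit_dir :: "real \<Rightarrow> real ^ 'n::{finite,linorder}" where
  "unit_dir s = (\<chi> i. s ^ pos i)"

lemma unit_dir_simps: "unit_dir 1 = e_plus" "unit_dir (- 1) = e_minus"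
  by (simp_all add: unit_dir_def e_plus_def e_minus_def)

lemma ar_lower_axis: "ar_lower \<rho> *v axis first_time 1 = (\<chi> i. \<rho> ^ (pos i - 1))"
  by (simp add: matrix_vector_mult_basis column_def ar_lower_def pos_first_time pos_bounds(1)[simplified])

lemma ar_lower_axis_unit:
  assumes "s \<in> {1, -1}"
  shows "ar_lower s *v axis first_time 1 = s *\<^sub>R unit_dir s"
proof -
  have "s ^ (pos i - 1) = s * s ^ pos i" for i :: 'a
    using assms pos_bounds(1)[of i] by (cases "pos i") (auto simp: mult.assoc[symmetric])
  then show ?thesis by (simp add: ar_lower_axis unit_dir_def vec_eq_iff)
qed

lemma continuous_ar_lower: "continuous_on UNIV ar_lower"
proof -
  have "continuous_on UNIV (\<lambda>\<rho>. if pos j \<le> pos i then \<rho> ^ (pos i - pos j) else 0 :: real)" for i j :: 'a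
    by (cases "pos j \<le> pos i") (auto intro!: continuous_intros)
  then show ?thesis
    unfolding ar_lower_def by (intro continuous_on_vec_lambda)
qed

lemma continuous_on_Lam [continuous_intros]:
  "continuous_on S f \<Longrightarrow> continuous_on S (\<lambda>x. Lam (f x))"
  unfolding Lam_def by (intro continuous_on_vec_lambda continuous_intros)

text \<open>Autoregressive parameters that approach the unit root \<open>s\<close> from inside \<open>(-1, 1)\<close>.\<close>

definition near_unit :: "real \<Rightarrow> nat \<Rightarrow> real" where
  "near_unit s m = s * (1 - 1 / real (m + 2))"

lemma near_unit_bound: "s \<in> {1, -1} \<Longrightarrow> \<bar>near_unit s m\<bar> < 1"
  by (auto simp: near_unit_def abs_mult)

lemma near_unit_x: "(\<lambda>m. 1 - 1 / real (m + 2)) \<longlonglongrightarrow> 1"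
proof -
  have "(\<lambda>m. 1 / real (m + 2)) \<longlonglongrightarrow> 0"
    by (rule LIMSEQ_ignore_initial_segment[OF lim_1_over_n])
  from tendsto_diff[OF tendsto_const this, of 1] show ?thesis by simp
qed

lemma near_unit_tendsto: "near_unit s \<longlonglongrightarrow> s"
  unfolding near_unit_def using tendsto_mult_left[OF near_unit_x, of s] by simp

definition near_innovation_sd :: "real \<Rightarrow> nat \<Rightarrow> real" where
  "near_innovation_sd s m = sqrt (1 - (near_unit s m)\<^sup>2)"

lemma near_innovation_sd_pos: "s \<in> {1, -1} \<Longrightarrow> 0 < near_innovation_sd s m"
  using near_unit_bound[of s m] by (simp add: near_innovation_sd_def abs_square_less_1)

lemma near_innovation_sd_tendsto:
  assumes "s \<in> {1, -1}"
  shows "near_innovation_sd s \<longlonglongrightarrow> 0"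
proof -
  have "(\<lambda>m. sqrt (1 - (near_unit s m)\<^sup>2)) \<longlonglongrightarrow> sqrt (1 - s\<^sup>2)"
    by (intro tendsto_intros near_unit_tendsto)
  then show ?thesis using assms by (auto simp: near_innovation_sd_def[abs_def])
qed

lemma ar_lower_near_tendsto:
  "(\<lambda>m. ar_lower (near_unit s m) *v z) \<longlonglongrightarrow> ar_lower s *v z"
proof -
  have "continuous_on UNIV (\<lambda>\<rho>. ar_lower \<rho> *v z)"
    by (intro continuous_intros continuous_ar_lower)
  then show ?thesis
    by (rule continuous_on_tendsto_compose) (auto intro: near_unit_tendsto)
qed

text \<open>The first column of the factor converges at rate \<open>1 - \<bar>\<rho>\<bar>\<close>, faster than
  the innovation standard deviation \<open>sqrt (1 - \<rho>\<^sup>2)\<close> vanishes. Hence the first value does not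
  contribute to the rescaled limit beyond a multiple of \<open>unit_dir s\<close>.\<close>

lemma ar_lower_axis_rate:
  assumes s: "s \<in> {1, -1}"
  shows "(\<lambda>m. (1 / near_innovation_sd s m) *\<^sub>R (ar_lower (near_unit s m) *v axis first_time 1 - s *\<^sub>R unit_dir s))
    \<longlonglongrightarrow> 0"
proof (rule vec_tendstoI)
  fix i :: 'a
  define k where "k = pos i - 1"
  define x where "x m = 1 - 1 / real (m + 2)" for m
  have x: "0 \<le> x m" "x m < 1" for m by (auto simp: x_def)
  have xlim: "x \<longlonglongrightarrow> 1" unfolding x_def by (rule near_unit_x)
  have "(\<lambda>m. s ^ k * (- (sqrt (1 - x m) / sqrt (1 + x m) * (\<Sum>j<k. x m ^ j)))) \<longlonglongrightarrow>
      s ^ k * (- (sqrt (1 - 1) / sqrt (1 + 1) * (\<Sum>j<k. 1 ^ j)))"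
    by (intro tendsto_intros xlim) auto
  moreover have "((1 / near_innovation_sd s m) *\<^sub>R (ar_lower (near_unit s m) *v axis first_time 1 - s *\<^sub>R unit_dir s)) $ i
      = s ^ k * (- (sqrt (1 - x m) / sqrt (1 + x m) * (\<Sum>j<k. x m ^ j)))" for m
  proof -
    have r: "near_unit s m = s * x m" by (simp add: near_unit_def x_def)
    have "1 - (near_unit s m)\<^sup>2 = (1 - x m) * (1 + x m)"
      using s by (auto simp: r power2_eq_square algebra_simps)
    then have sd: "near_innovation_sd s m = sqrt (1 - x m) * sqrt (1 + x m)"
      by (simp add: near_innovation_sd_def real_sqrt_mult)
    have "(ar_lower (near_unit s m) *v axis first_time 1 - s *\<^sub>R unit_dir s) $ i = s ^ k * (x m ^ k - 1)"
      unfolding ar_lower_axis_unit[OF s, symmetric] ar_lower_axis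
      by (simp add: r power_mult_distrib k_def algebra_simps)
    also have "\<dots> = - (s ^ k * ((1 - x m) * (\<Sum>j<k. x m ^ j)))"
    proof -
      have "x m ^ k - 1 = - ((1 - x m) * (\<Sum>j<k. x m ^ j))"
        using one_diff_power_eq[of "x m" k] by linarith
      then show ?thesis by (simp only: mult_minus_right)
    qed
    finally have c: "(ar_lower (near_unit s m) *v axis first_time 1 - s *\<^sub>R unit_dir s) $ i =
        - (s ^ k * ((1 - x m) * (\<Sum>j<k. x m ^ j)))" .
    define a b where "a = sqrt (1 - x m)" and "b = sqrt (1 + x m)"
    have ab: "1 - x m = a * a" "0 < a" "0 < b" using x[of m] by (auto simp: a_def b_def)
    show ?thesis
      unfolding vector_scaleR_component c sd a_def[symmetric] b_def[symmetric] ab(1)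
      using ab(2,3) by (simp add: field_simps)
  qed
  ultimately show "(\<lambda>m. ((1 / near_innovation_sd s m) *\<^sub>R (ar_lower (near_unit s m) *v axis first_time 1 - s *\<^sub>R unit_dir s)) $ i)
    \<longlonglongrightarrow> 0 $ i"
    by simp
qed

section \<open>Zero sets of functions that are rational along lines\<close>

text \<open>A set that every line through one point meets in a finite set only is a null set: this is
  Fubini's theorem for dilations about that point.\<close>

lemma AE_not_in_line_finite:
  fixes Z :: "'a::euclidean_space set"
  assumes Z [measurable]: "Z \<in> sets borel" and fin: "\<And>v. finite {t. u + t *\<^sub>R v \<in> Z}"
  shows "AE y in lborel. y \<notin> Z"
proof -
  \<comment> \<open>The pairs \<open>(v, t)\<close> with \<open>u + t v \<in> Z\<close> form a null set; slice it at some \<open>t \<noteq> 0\<close>.\<close>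
  have meas: "{x \<in> space (lborel \<Otimes>\<^sub>M lborel). \<not> u + snd x *\<^sub>R fst x \<in> Z}
      \<in> sets ((lborel :: 'a measure) \<Otimes>\<^sub>M (lborel :: real measure))"
    by measurable
  have "AE t in lborel. u + t *\<^sub>R v \<notin> Z" for v
    using AE_not_in[OF finite_imp_null_set_lborel[OF fin[of v]]] by simp
  then have "AE v in lborel. AE t in lborel. u + t *\<^sub>R v \<notin> Z" by simp
  then have "AE t in lborel. AE v in lborel. u + t *\<^sub>R v \<notin> Z"
    using lborel_pair.AE_commute[OF meas] by simp
  moreover have "AE t in lborel. t \<noteq> (0 :: real)" by (rule AE_lborel_singleton)
  ultimately have "AE t in lborel. t \<noteq> (0 :: real) \<and> (AE v in lborel. u + t *\<^sub>R v \<notin> Z)" by eventually_elim simp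
  moreover have "ae_filter (lborel :: real measure) \<noteq> bot"
    by (simp add: ae_filter_eq_bot_iff)
  ultimately obtain t :: real where t: "t \<noteq> 0" and AE: "AE v in lborel. u + t *\<^sub>R v \<notin> Z"
    using eventually_happens' by blast
  define g where "g y = - (1 / t) *\<^sub>R u + (1 / t) *\<^sub>R y" for y
  have g: "u + t *\<^sub>R g y = y" for y
    using t by (simp add: g_def scaleR_diff_right)
  have "lborel = density (distr lborel borel g) (\<lambda>_. ennreal (\<bar>1 / t\<bar> ^ DIM('a)))"
    unfolding g_def using lborel_affine[of "1 / t" "- (1 / t) *\<^sub>R u"] t by simp
  then have "AE v in density (distr lborel borel g) (\<lambda>_. ennreal (\<bar>1 / t\<bar> ^ DIM('a))). u + t *\<^sub>R v \<notin> Z"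
    using AE by metis
  then have "AE v in distr lborel borel g. u + t *\<^sub>R v \<notin> Z"
    using t by (subst (asm) AE_density) auto
  then have "AE y in lborel. u + t *\<^sub>R g y \<notin> Z"
    by (subst (asm) AE_distr_iff) (simp_all add: g_def[abs_def])
  then show ?thesis by (simp add: g)
qed

text \<open>Agreement with a quotient of polynomials off finitely many points; with \<open>x / 0 = 0\<close>
  this class is closed under all field operations.\<close>

definition rational_fun :: "(real \<Rightarrow> real) \<Rightarrow> bool" where
  "rational_fun f \<longleftrightarrow> (\<exists>p q. q \<noteq> 0 \<and> (\<forall>t. poly q t \<noteq> 0 \<longrightarrow> f t = poly p t / poly q t))"

lemma rational_funI: "q \<noteq> 0 \<Longrightarrow> (\<And>t. poly q t \<noteq> 0 \<Longrightarrow> f t = poly p t / poly q t) \<Longrightarrow> rational_fun f"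
  unfolding rational_fun_def by blast

lemma rational_const: "rational_fun (\<lambda>_. c)"
  by (rule rational_funI[of 1 _ "[:c:]"]) auto

lemma rational_ident: "rational_fun (\<lambda>t. t)"
  by (rule rational_funI[of 1 _ "[:0, 1:]"]) auto

lemma rational_add:
  assumes "rational_fun f" "rational_fun g"
  shows "rational_fun (\<lambda>t. f t + g t)"
proof -
  from assms obtain p q p' q' where
    "q \<noteq> 0" "\<And>t. poly q t \<noteq> 0 \<Longrightarrow> f t = poly p t / poly q t"
    "q' \<noteq> 0" "\<And>t. poly q' t \<noteq> 0 \<Longrightarrow> g t = poly p' t / poly q' t"
    unfolding rational_fun_def by blast
  then show ?thesis
    by (intro rational_funI[of "q * q'" _ "p * q' + p' * q"]) (auto simp: field_simps)
qed

lemma rational_mult: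
  assumes "rational_fun f" "rational_fun g"
  shows "rational_fun (\<lambda>t. f t * g t)"
proof -
  from assms obtain p q p' q' where
    "q \<noteq> 0" "\<And>t. poly q t \<noteq> 0 \<Longrightarrow> f t = poly p t / poly q t"
    "q' \<noteq> 0" "\<And>t. poly q' t \<noteq> 0 \<Longrightarrow> g t = poly p' t / poly q' t"
    unfolding rational_fun_def by blast
  then show ?thesis
    by (intro rational_funI[of "q * q'" _ "p * p'"]) auto
qed

lemma rational_inverse:
  assumes "rational_fun f"
  shows "rational_fun (\<lambda>t. inverse (f t))"
proof -
  from assms obtain p q where f: "q \<noteq> 0" "\<And>t. poly q t \<noteq> 0 \<Longrightarrow> f t = poly p t / poly q t"
    unfolding rational_fun_def by blast
  show ?thesis
  proof (cases "p = 0")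
    case True
    then show ?thesis using f by (intro rational_funI[of q _ 0]) auto
  next
    case False
    then show ?thesis using f by (intro rational_funI[of "p * q" _ "q * q"]) auto
  qed
qed

lemma rational_divide: "rational_fun f \<Longrightarrow> rational_fun g \<Longrightarrow> rational_fun (\<lambda>t. f t / g t)"
  unfolding divide_inverse by (intro rational_mult rational_inverse)

lemma rational_diff: "rational_fun f \<Longrightarrow> rational_fun g \<Longrightarrow> rational_fun (\<lambda>t. f t - g t)"
  using rational_add[of f "\<lambda>t. (-1) * g t"] rational_mult[OF rational_const[of "-1"], of g] by simp

lemma rational_sum: "(\<And>i. i \<in> I \<Longrightarrow> rational_fun (f i)) \<Longrightarrow> rational_fun (\<lambda>t. \<Sum>i\<in>I. f i t)"
  by (induction I rule: infinite_finite_induct) (auto intro: rational_const rational_add)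

lemma rational_prod: "(\<And>i. i \<in> I \<Longrightarrow> rational_fun (f i)) \<Longrightarrow> rational_fun (\<lambda>t. \<Prod>i\<in>I. f i t)"
  by (induction I rule: infinite_finite_induct) (auto intro: rational_const rational_mult)

lemma rational_power: "rational_fun f \<Longrightarrow> rational_fun (\<lambda>t. f t ^ n)"
  by (induction n) (auto intro: rational_const rational_mult)

lemmas rational_intros = rational_const rational_ident rational_add rational_diff rational_mult
  rational_divide rational_sum rational_prod rational_power

lemma rational_cong:
  assumes "rational_fun g" "finite {t. f t \<noteq> g t}"
  shows "rational_fun f"
proof -
  from assms(1) obtain p q where g: "q \<noteq> 0" "\<And>t. poly q t \<noteq> 0 \<Longrightarrow> g t = poly p t / poly q t"
    unfolding rational_fun_def by blast
  define w where "w = (\<Prod>a\<in>{t. f t \<noteq> g t}. [:- a, 1:])"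
  have "w \<noteq> 0" using assms(2) by (simp add: w_def)
  moreover have "poly w t \<noteq> 0 \<Longrightarrow> f t = g t" for t
    using assms(2) by (auto simp: w_def poly_prod)
  ultimately show ?thesis using g
    by (intro rational_funI[of "q * w" _ "p * w"]) auto
qed

text \<open>A rational function either vanishes off a finite set or has finitely many zeros. Continuity at a
  point with nonzero value excludes the first alternative, and it is required because the
  representation as a quotient ignores finitely many values.\<close>

lemma rational_finite_zeros:
  assumes "rational_fun f" and cont: "isCont f a" and nz: "f a \<noteq> 0"
  shows "finite {t. f t = 0}"
proof -
  from assms(1) obtain p q where f: "q \<noteq> 0" "\<And>t. poly q t \<noteq> 0 \<Longrightarrow> f t = poly p t / poly q t"
    unfolding rational_fun_def by blast
  have fin: "finite {t. poly q t = 0}" using f(1) by (rule poly_roots_finite)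
  have "p \<noteq> 0"
  proof
    assume "p = 0"
    have "\<forall>\<^sub>F t in at a. f t \<noteq> 0"
      using cont nz unfolding isCont_def by (rule tendsto_imp_eventually_ne)
    moreover have "\<forall>\<^sub>F t in at a. poly q t \<noteq> 0"
      using islimpt_finite[OF fin, of a] unfolding islimpt_iff_eventually by simp
    ultimately have "\<forall>\<^sub>F t in at a. False"
      by eventually_elim (use f(2) \<open>p = 0\<close> in auto)
    then show False by simp
  qed
  then have "finite {t. poly p t = 0}" by (rule poly_roots_finite)
  with fin have "finite ({t. poly p t = 0} \<union> {t. poly q t = 0})" by simp
  then show ?thesis
    by (rule rev_finite_subset) (use f(2) in auto)
qed

definition rational_mat :: "(real \<Rightarrow> real ^ 'n ^ 'm) \<Rightarrow> bool" where
  "rational_mat M \<longleftrightarrow> (\<forall>i j. rational_fun (\<lambda>t. M t $ i $ j))"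

definition rational_vec :: "(real \<Rightarrow> real ^ 'n) \<Rightarrow> bool" where
  "rational_vec x \<longleftrightarrow> (\<forall>i. rational_fun (\<lambda>t. x t $ i))"

lemma rational_mat_const: "rational_mat (\<lambda>_. A)"
  by (simp add: rational_mat_def rational_const)

lemma rational_mat_mult: "rational_mat M \<Longrightarrow> rational_mat N \<Longrightarrow> rational_mat (\<lambda>t. M t ** N t)"
  by (simp add: rational_mat_def matrix_matrix_mult_def rational_intros)

lemma rational_mat_scaleR: "rational_fun c \<Longrightarrow> rational_mat M \<Longrightarrow> rational_mat (\<lambda>t. c t *\<^sub>R M t)"
  by (simp add: rational_mat_def rational_intros)

lemma rational_mat_vec: "rational_mat M \<Longrightarrow> rational_vec x \<Longrightarrow> rational_vec (\<lambda>t. M t *v x t)"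
  by (simp add: rational_mat_def rational_vec_def matrix_vector_mult_def rational_intros)

lemma rational_vec_const: "rational_vec (\<lambda>_. x)"
  by (simp add: rational_vec_def rational_const)

lemma rational_vec_line: "rational_vec (\<lambda>t. u + t *\<^sub>R v)"
  by (simp add: rational_vec_def rational_intros)

lemma rational_vec_diff: "rational_vec x \<Longrightarrow> rational_vec y \<Longrightarrow> rational_vec (\<lambda>t. x t - y t)"
  by (simp add: rational_vec_def rational_intros)

lemma rational_inner: "rational_vec x \<Longrightarrow> rational_vec y \<Longrightarrow> rational_fun (\<lambda>t. x t \<bullet> y t)"
  by (simp add: rational_vec_def inner_vec_def rational_intros)

lemma rational_det: "rational_mat M \<Longrightarrow> rational_fun (\<lambda>t. det (M t))"
  unfolding det_def rational_mat_def by (intro rational_intros) auto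

text \<open>The exceptional parameters must be finitely many because the inverse of a singular matrix is
  unspecified.\<close>

lemma rational_mat_inv:
  assumes M: "rational_mat M" and det: "finite {t. det (M t) = 0}"
  shows "rational_mat (\<lambda>t. matrix_inv (M t))"
  unfolding rational_mat_def
proof (intro allI)
  fix i j
  have "rational_mat (\<lambda>t. \<chi> a b. if b = i then axis j 1 $ a else M t $ a $ b)"
    unfolding rational_mat_def
  proof (intro allI)
    fix a b
    show "rational_fun (\<lambda>t. (\<chi> a b. if b = i then axis j 1 $ a else M t $ a $ b) $ a $ b)"
      using M by (cases "b = i") (auto simp: rational_mat_def rational_const)
  qed
  then have "rational_fun (\<lambda>t. det (\<chi> a b. if b = i then axis j 1 $ a else M t $ a $ b) / det (M t))"
    by (intro rational_divide rational_det M)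
  then show "rational_fun (\<lambda>t. matrix_inv (M t) $ i $ j)"
    by (rule rational_cong) (rule rev_finite_subset[OF det], use matrix_inv_cramer in auto)
qed

lemmas rational_mat_intros = rational_mat_const rational_mat_mult rational_mat_scaleR rational_mat_vec
  rational_vec_const rational_vec_line rational_vec_diff rational_inner rational_det

section \<open>Limits of probabilities and extremal values\<close>

lemma (in prob_space) tendsto_prob:
  assumes A [measurable]: "\<And>m. A m \<in> events" and B [measurable]: "B \<in> events"
    and AE: "AE z in M. \<forall>\<^sub>F m in sequentially. z \<in> A m \<longleftrightarrow> z \<in> B"
  shows "(\<lambda>m. prob (A m)) \<longlonglongrightarrow> prob B"
proof -
  have "(\<lambda>m. \<integral>z. indicat_real (A m) z \<partial>M) \<longlonglongrightarrow> (\<integral>z. indicat_real B z \<partial>M)"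
  proof (rule integral_dominated_convergence[where w = "\<lambda>_. 1"])
    show "AE z in M. (\<lambda>m. indicat_real (A m) z) \<longlonglongrightarrow> indicat_real B z"
      using AE
    proof eventually_elim
      case (elim z)
      then have "\<forall>\<^sub>F m in sequentially. indicat_real (A m) z = indicat_real B z"
        by eventually_elim (simp add: indicator_def)
      then show ?case by (rule tendsto_eventually)
    qed
  qed (auto simp: indicator_def)
  then show ?thesis by simp
qed

lemma cSUP_eq_limit:
  fixes f :: "'a \<Rightarrow> real"
  assumes "\<And>x. x \<in> A \<Longrightarrow> f x \<le> c" and "\<And>m. x m \<in> A" and "(\<lambda>m::nat. f (x m)) \<longlonglongrightarrow> c"
  shows "(SUP x\<in>A. f x) = c"
proof (rule antisym)
  show "(SUP x\<in>A. f x) \<le> c" using assms by (intro cSUP_least) auto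
  have "bdd_above (f ` A)" using assms(1) by (auto simp: bdd_above_def)
  then have "f (x m) \<le> (SUP x\<in>A. f x)" for m using assms(2) by (intro cSUP_upper)
  then show "c \<le> (SUP x\<in>A. f x)" using assms(3) by (intro LIMSEQ_le_const2) auto
qed

lemma cINF_eq_limit:
  fixes f :: "'a \<Rightarrow> real"
  assumes "\<And>x. x \<in> A \<Longrightarrow> c \<le> f x" and "\<And>m. x m \<in> A" and "\<And>m. f (x m) \<le> g m" and "(g :: nat \<Rightarrow> real) \<longlonglongrightarrow> c"
  shows "(INF x\<in>A. f x) = c"
proof (rule antisym)
  show "c \<le> (INF x\<in>A. f x)" using assms by (intro cINF_greatest) auto
  have "bdd_below (f ` A)" using assms(1) by (auto simp: bdd_below_def)
  then have "(INF x\<in>A. f x) \<le> g m" for m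
    using assms(2) cINF_lower2[of f A "x m" "g m" for m] assms(3) by blast
  then show "(INF x\<in>A. f x) \<le> c" using assms(4) by (intro LIMSEQ_le_const) auto
qed

lemma M_all_range: "M_all X = range ((*v) X)"
proof -
  have "subspace (range ((*v) X))"
    by (metis linear_subspace_image matrix_vector_mul_linear subspace_UNIV)
  moreover have "columns X \<subseteq> range ((*v) X)"
    by (auto simp: columns_image_basis)
  moreover have "range ((*v) X) \<subseteq> span (columns X)"
    by (auto intro: matrix_vector_mult_in_columnspace)
  ultimately show ?thesis
    unfolding M_all_def by (metis span_minimal subset_antisym)
qed

lemma AE_first_nonzero: "AE z :: real ^ 'n::{finite,linorder} in lborel. z $ first_time + c \<noteq> 0"
proof -
  have "AE z in lborel. z \<notin> {z :: real ^ 'n::{finite,linorder}. z $ first_time + c = 0}"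
  proof (rule AE_not_in_line_finite)
    show "{z :: real ^ 'n::{finite,linorder}. z $ first_time + c = 0} \<in> sets borel" by measurable
    fix v :: "real ^ 'n::{finite,linorder}"
  \<comment> \<open>The base point is chosen such that the affine function has the value 1 there.\<close>
    let ?u = "(1 - c) *\<^sub>R axis first_time 1 :: real ^ 'n::{finite,linorder}"
    have "(?u + t *\<^sub>R v) $ first_time + c = 1 + t * v $ first_time" for t
      by (simp add: axis_def)
    moreover have "t = - 1 / v $ first_time" if "1 + t * v $ first_time = 0" for t
    proof -
      have "v $ first_time \<noteq> 0" using that by auto
      then show ?thesis using that by (simp add: field_simps)
    qed
    then have "{t. 1 + t * v $ first_time = 0} \<subseteq> {- 1 / v $ first_time}" by blast
    then have "finite {t. 1 + t * v $ first_time = 0}" by (rule finite_subset) simp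
    ultimately show "finite {t. ?u + t *\<^sub>R v \<in> {z. z $ first_time + c = 0}}" by simp
  qed
  then show ?thesis by simp
qed

section \<open>Equivariant Wald statistics under near unit roots\<close>

text \<open>The properties common to the FGLS and the OLS statistic. \<open>U\<close> is the complement of the exceptional
  set, \<open>b\<close> the estimator of the regression coefficients and \<open>Om\<close> the estimator of the covariance
  matrix of its restricted part. The assumption \<open>pos_point\<close> makes the statistic unbounded, and
  \<open>generic\<close> provides the null sets for the second-order limit.\<close>

locale equivariant_wald =
  fixes X :: "real ^ 'k ^ 'n::{finite,linorder}" and R :: "real ^ 'k ^ 'q"
    and U :: "(real ^ 'n::{finite,linorder}) set"
    and b :: "real ^ 'n::{finite,linorder} \<Rightarrow> real ^ 'k"
    and Om :: "real ^ 'n::{finite,linorder} \<Rightarrow> real ^ 'q ^ 'q"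
  assumes X_inj: "inj ((*v) X)" and R_surj: "surj ((*v) R)"
    and open_U: "open U"
    and U_affine: "c \<noteq> 0 \<Longrightarrow> y \<in> U \<Longrightarrow> c *\<^sub>R y + X *v \<beta> \<in> U"
    and b_affine: "c \<noteq> 0 \<Longrightarrow> y \<in> U \<Longrightarrow> b (c *\<^sub>R y + X *v \<beta>) = c *\<^sub>R b y + \<beta>"
    and Om_affine: "c \<noteq> 0 \<Longrightarrow> y \<in> U \<Longrightarrow> Om (c *\<^sub>R y + X *v \<beta>) = c\<^sup>2 *\<^sub>R Om y"
    and cont_b: "continuous_on U b" and cont_Om: "continuous_on U Om"
    and det_Om: "y \<in> U \<Longrightarrow> det (Om y) \<noteq> 0"
    and pos_point: "\<exists>u\<in>U. pos_form (Om u)"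
    and generic: "v \<noteq> 0 \<Longrightarrow> AE y in lborel. y \<in> U \<and> v \<bullet> (matrix_inv (Om y) *v v) \<noteq> 0"
begin

definition stat :: "real ^ 'q \<Rightarrow> real ^ 'n::{finite,linorder} \<Rightarrow> real" where
  "stat r y = (if y \<in> U then (R *v b y - r) \<bullet> (matrix_inv (Om y) *v (R *v b y - r)) else 0)"

lemma U_shift: "y \<in> U \<Longrightarrow> y + X *v \<beta> \<in> U"
  and b_shift: "y \<in> U \<Longrightarrow> b (y + X *v \<beta>) = b y + \<beta>"
  and Om_shift: "y \<in> U \<Longrightarrow> Om (y + X *v \<beta>) = Om y"
  using U_affine[of 1 y \<beta>] b_affine[of 1 y \<beta>] Om_affine[of 1 y \<beta>] by simp_all

text \<open>Invariance under the group generated by shifts within the null space and scaling about it: the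
  numerator and the weight are both multiplied by the square of \<open>c\<close>, and \<open>r\<close> is absorbed by
  \<open>\<mu>0\<close>.\<close>

lemma stat_affine:
  assumes \<mu>0: "\<mu>0 \<in> M_null X R r" and c: "c \<noteq> 0" and y: "y \<in> U"
  shows "stat r (\<mu>0 + c *\<^sub>R y) = stat 0 y"
proof -
  from \<mu>0 obtain \<beta> where \<beta>: "\<mu>0 = X *v \<beta>" "R *v \<beta> = r" by (auto simp: M_null_def)
  have "R *v b (\<mu>0 + c *\<^sub>R y) - r = c *\<^sub>R (R *v b y)"
    using b_affine[OF c y, of \<beta>] \<beta>
    by (simp add: add.commute matrix_vector_right_distrib matrix_vector_mult_scaleR)
  moreover have "matrix_inv (Om (\<mu>0 + c *\<^sub>R y)) = (1 / c\<^sup>2) *\<^sub>R matrix_inv (Om y)"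
    using Om_affine[OF c y, of \<beta>] \<beta> c det_Om[OF y] by (simp add: add.commute matrix_inv_scaleR)
  moreover have "\<mu>0 + c *\<^sub>R y \<in> U"
    using U_affine[OF c y, of \<beta>] \<beta> by (simp add: add.commute)
  ultimately show ?thesis
    using c y by (simp add: stat_def scaleR_matrix_vector_assoc[symmetric] matrix_vector_mult_scaleR power2_eq_square)
qed

lemma stat_scale:
  assumes "c \<noteq> 0" "y \<in> U"
  shows "stat 0 (c *\<^sub>R y) = stat 0 y"
proof -
  have "0 \<in> M_null X R 0" by (auto simp: M_null_def intro!: exI[of _ 0])
  then show ?thesis using stat_affine[OF _ assms, of 0 0] by simp
qed

lemma continuous_stat: "continuous_on U (stat r)"
proof -
  have "continuous_on U (\<lambda>y. (R *v b y - r) \<bullet> (matrix_inv (Om y) *v (R *v b y - r)))"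
    by (intro continuous_intros cont_b cont_Om det_Om)
  then show ?thesis by (rule continuous_on_eq) (simp add: stat_def)
qed

lemma stat_measurable [measurable]: "stat r \<in> borel_measurable borel"
proof -
  have "continuous_on U (\<lambda>y. (R *v b y - r) \<bullet> (matrix_inv (Om y) *v (R *v b y - r)))"
    by (intro continuous_intros cont_b cont_Om det_Om)
  then have "(\<lambda>y. if y \<in> U then (R *v b y - r) \<bullet> (matrix_inv (Om y) *v (R *v b y - r)) else 0) \<in> borel_measurable borel"
    using open_U by (intro borel_measurable_continuous_on_if) auto
  then show ?thesis by (simp add: stat_def[abs_def])
qed

lemma M_null_nonempty: "\<exists>\<beta>. R *v \<beta> = r"
  using R_surj by (metis surjD)

text \<open>Because the factors \<open>c m\<close> may be arbitrary nonzero numbers, this covers samples whose scale is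
  fixed as well as samples whose scale diverges.\<close>

lemma stat_tendsto:
  assumes \<mu>0: "\<mu>0 \<in> M_null X R r" and e: "e \<in> U" and g: "g \<noteq> 0" and c: "\<And>m. c m \<noteq> 0"
    and x: "x \<longlonglongrightarrow> g *\<^sub>R e"
  shows "(\<lambda>m. stat r (\<mu>0 + c m *\<^sub>R x m)) \<longlonglongrightarrow> stat 0 e"
proof -
  have ge: "g *\<^sub>R e \<in> U" using U_affine[OF g e, of 0] by simp
  then have ev: "\<forall>\<^sub>F m in sequentially. x m \<in> U"
    using x open_U by (auto dest: topological_tendstoD)
  have "isCont (stat 0) (g *\<^sub>R e)"
    using continuous_stat open_U ge by (simp add: continuous_on_eq_continuous_at)
  then have "(\<lambda>m. stat 0 (x m)) \<longlonglongrightarrow> stat 0 (g *\<^sub>R e)"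
    using x by (rule isCont_tendsto_compose)
  moreover have "\<forall>\<^sub>F m in sequentially. stat 0 (x m) = stat r (\<mu>0 + c m *\<^sub>R x m)"
    using ev by eventually_elim (simp add: stat_affine[OF \<mu>0 c])
  ultimately show ?thesis
    unfolding stat_scale[OF g e] by (rule Lim_transform_eventually)
qed

lemma near_unit_root_tendsto:
  assumes s: "s \<in> {1, -1}"
  shows "(\<lambda>m. ar_root (near_unit s m) *v z) \<longlonglongrightarrow> (z $ first_time * s) *\<^sub>R (unit_dir s :: real ^ 'n::{finite,linorder})"
proof -
  have "(\<lambda>m. z $ first_time *\<^sub>R (ar_lower (near_unit s m) *v axis first_time 1) +
      near_innovation_sd s m *\<^sub>R (ar_lower (near_unit s m) *v (z - z $ first_time *\<^sub>R axis first_time 1)))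
    \<longlonglongrightarrow> z $ first_time *\<^sub>R (ar_lower s *v axis first_time 1) +
      0 *\<^sub>R (ar_lower s *v (z - z $ first_time *\<^sub>R axis first_time 1))"
    by (intro tendsto_intros ar_lower_near_tendsto near_innovation_sd_tendsto s)
  then show ?thesis
    by (subst ar_root_apply) (simp add: near_innovation_sd_def ar_lower_axis_unit[OF s])
qed

text \<open>Near the unit root the observation is close to the line through \<open>\<mu>0\<close> in the direction
  \<open>unit_dir s\<close>, on which the statistic is constant except at \<open>\<mu>0\<close>. The condition on the means,
  relative to the standard deviations, admits both means that approach the null space at a fixed scale
  and a fixed mean with diverging scale.\<close>

lemma rejection_tendsto:
  assumes s: "s \<in> {1, -1}" and e: "unit_dir s \<in> U" and \<mu>0: "\<mu>0 \<in> M_null X R r"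
    and \<sigma>: "\<And>m. 0 < \<sigma> m" and \<mu>: "(\<lambda>m. (1 / \<sigma> m) *\<^sub>R (\<mu> m - \<mu>0)) \<longlonglongrightarrow> 0"
    and C: "stat 0 (unit_dir s) \<noteq> C"
  shows "(\<lambda>m. measure (gaussian (\<mu> m) ((\<sigma> m)\<^sup>2 *\<^sub>R Lam (near_unit s m))) {y. C \<le> stat r y})
    \<longlonglongrightarrow> of_bool (C < stat 0 (unit_dir s))"
proof -
  interpret std: prob_space "std_gaussian :: (real ^ 'n::{finite,linorder}) measure"
    by (rule prob_space_std_gaussian)
  let ?A = "\<lambda>m. {z. \<mu> m + \<sigma> m *\<^sub>R (ar_root (near_unit s m) *v z) \<in> {y. C \<le> stat r y}}"
  let ?B = "{z :: real ^ 'n::{finite,linorder}. C < stat 0 (unit_dir s :: real ^ 'n::{finite,linorder})}"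
  have "(\<lambda>m. measure std_gaussian (?A m)) \<longlonglongrightarrow> measure std_gaussian ?B"
  proof (rule std.tendsto_prob)
    have "AE z in lborel. z $ first_time + 0 \<noteq> (0 :: real)"
      by (rule AE_first_nonzero)
    then show "AE z in std_gaussian. \<forall>\<^sub>F m in sequentially. z \<in> ?A m \<longleftrightarrow> z \<in> ?B"
      unfolding AE_std_gaussian
    proof eventually_elim
      case (elim z)
      then have g: "z $ first_time * s \<noteq> 0" using s by auto
  \<comment> \<open>The observation, centred at \<open>\<mu>0\<close> and divided by its standard deviation.\<close>
      define x where "x m = (1 / \<sigma> m) *\<^sub>R (\<mu> m - \<mu>0) + ar_root (near_unit s m) *v z" for m
      have "x \<longlonglongrightarrow> 0 + (z $ first_time * s) *\<^sub>R unit_dir s"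
        unfolding x_def by (intro tendsto_add \<mu> near_unit_root_tendsto s)
      then have "x \<longlonglongrightarrow> (z $ first_time * s) *\<^sub>R unit_dir s" by simp
      then have lim: "(\<lambda>m. stat r (\<mu>0 + \<sigma> m *\<^sub>R x m)) \<longlonglongrightarrow> stat 0 (unit_dir s)"
        using \<sigma> by (intro stat_tendsto[OF \<mu>0 e g]) (auto simp: less_imp_neq[symmetric])
      have eq: "\<mu>0 + \<sigma> m *\<^sub>R x m = \<mu> m + \<sigma> m *\<^sub>R (ar_root (near_unit s m) *v z)" for m
        using \<sigma>[of m] by (simp add: x_def scaleR_add_right)
      show ?case
      proof (cases "C < stat 0 (unit_dir s :: real ^ 'n::{finite,linorder})")
        case True
        with lim have "\<forall>\<^sub>F m in sequentially. C < stat r (\<mu>0 + \<sigma> m *\<^sub>R x m)"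
          by (rule order_tendstoD)
        then show ?thesis by eventually_elim (use True in \<open>simp add: eq\<close>)
      next
        case False
        then have "stat 0 (unit_dir s :: real ^ 'n::{finite,linorder}) < C" using C by simp
        with lim have "\<forall>\<^sub>F m in sequentially. stat r (\<mu>0 + \<sigma> m *\<^sub>R x m) < C"
          by (rule order_tendstoD)
        then show ?thesis by eventually_elim (use False in \<open>simp add: eq\<close>)
      qed
    qed
    show "?A m \<in> std.events" for m
      by simp measurable
  qed auto
  moreover have "measure std_gaussian ?B = of_bool (C < stat 0 (unit_dir s :: real ^ 'n::{finite,linorder}))"
    using std.prob_space by auto
  moreover have "measure (gaussian (\<mu> m) ((\<sigma> m)\<^sup>2 *\<^sub>R Lam (near_unit s m))) {y. C \<le> stat r y} =
      measure std_gaussian (?A m)" for m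
    using \<sigma>[of m] by (subst measure_gaussian_Lam[OF near_unit_bound[OF s]]) auto
  ultimately show ?thesis by simp
qed

text \<open>The coefficient of the leading term of the statistic far out along a direction in the
  column space whose image under the restriction matrix is \<open>v\<close>.\<close>

definition slope :: "real ^ 'q \<Rightarrow> real ^ 'n::{finite,linorder} \<Rightarrow> real" where
  "slope v y = v \<bullet> (matrix_inv (Om y) *v v)"

lemma slope_shift: "y \<in> U \<Longrightarrow> slope v (y + X *v \<beta>) = slope v y"
  by (simp add: slope_def Om_shift)

lemma slope_region_measurable: "{y. y \<in> U \<and> 0 < slope v y} \<in> sets borel"
proof -
  have "continuous_on U (slope v)"
    unfolding slope_def by (intro continuous_intros cont_Om det_Om)
  then have [measurable]: "(\<lambda>y. if y \<in> U then slope v y else 0) \<in> borel_measurable borel"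
    using open_U by (intro borel_measurable_continuous_on_if) auto
  have "{y. y \<in> U \<and> 0 < slope v y} = {y. 0 < (if y \<in> U then slope v y else 0)}" by auto
  then show ?thesis by simp
qed

text \<open>Dividing by \<open>c m\<close> squared turns the statistic far out along \<open>X *v \<beta>\<close> into a perturbation
  of \<open>slope\<close>, so the sign of the slope decides about rejection for every critical value.\<close>

lemma far_out_rejection:
  assumes w: "w \<in> U" "wm \<longlonglongrightarrow> w" and d: "(\<lambda>m. 1 / c m) \<longlonglongrightarrow> 0" "\<And>m. c m \<noteq> 0"
    and sl: "slope (R *v \<beta>) w \<noteq> 0"
  shows "\<forall>\<^sub>F m in sequentially. C \<le> stat 0 (wm m + X *v (c m *\<^sub>R \<beta>)) \<longleftrightarrow> 0 < slope (R *v \<beta>) w"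
proof -
  have ev: "\<forall>\<^sub>F m in sequentially. wm m \<in> U"
    using w open_U by (auto dest: topological_tendstoD)
  define v where "v = R *v \<beta>"
  define p where "p m = v + (1 / c m) *\<^sub>R (R *v b (wm m))" for m
  define q where "q m = p m \<bullet> (matrix_inv (Om (wm m)) *v p m)" for m
  have bm: "(\<lambda>m. R *v b (wm m)) \<longlonglongrightarrow> R *v b w"
    by (rule continuous_on_tendsto_compose[of U "\<lambda>y. R *v b y"]) (use cont_b w ev in \<open>auto intro: continuous_intros\<close>)
  have "(\<lambda>m. (1 / c m) *\<^sub>R (R *v b (wm m))) \<longlonglongrightarrow> 0 *\<^sub>R (R *v b w)"
    by (intro tendsto_scaleR d bm)
  then have pm: "p \<longlonglongrightarrow> v"
    unfolding p_def using tendsto_add[OF tendsto_const] by fastforce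
  have im: "(\<lambda>m. matrix_inv (Om (wm m))) \<longlonglongrightarrow> matrix_inv (Om w)"
    by (rule continuous_on_tendsto_compose[of U "\<lambda>y. matrix_inv (Om y)"])
      (use w ev in \<open>auto intro!: continuous_intros cont_Om det_Om\<close>)
  have "q \<longlonglongrightarrow> v \<bullet> (matrix_inv (Om w) *v v)"
    unfolding q_def matrix_vector_mult_def using im pm
    by (intro tendsto_inner vec_tendstoI) (auto intro!: tendsto_intros)
  then have "(\<lambda>m. q m - C * (1 / c m)\<^sup>2) \<longlonglongrightarrow> slope v w - C * 0\<^sup>2"
    unfolding slope_def by (intro tendsto_intros d)
  then have lim: "(\<lambda>m. q m - C * (1 / c m)\<^sup>2) \<longlonglongrightarrow> slope v w" by simp
  have st: "C \<le> stat 0 (wm m + X *v (c m *\<^sub>R \<beta>)) \<longleftrightarrow> 0 \<le> q m - C * (1 / c m)\<^sup>2" if "wm m \<in> U" for m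
  proof -
    have "b (wm m + X *v (c m *\<^sub>R \<beta>)) = b (wm m) + c m *\<^sub>R \<beta>"
      by (rule b_shift[OF that])
    then have Rb: "R *v b (wm m + X *v (c m *\<^sub>R \<beta>)) = c m *\<^sub>R p m"
      using d(2)[of m] that
      by (simp only:) (simp add: p_def v_def matrix_vector_right_distrib matrix_vector_mult_scaleR scaleR_add_right)
    have "stat 0 (wm m + X *v (c m *\<^sub>R \<beta>)) = (c m)\<^sup>2 * q m"
      unfolding stat_def Rb Om_shift[OF that] using U_shift[OF that, of "c m *\<^sub>R \<beta>"]
      by (simp only: if_True diff_zero)
        (simp add: q_def matrix_vector_mult_scaleR power2_eq_square mult.assoc)
    moreover have "C \<le> (c m)\<^sup>2 * q m \<longleftrightarrow> C * (1 / c m)\<^sup>2 \<le> q m"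
      using d(2)[of m] by (simp add: field_simps)
    ultimately show ?thesis by simp
  qed
  show ?thesis
  proof (cases "0 < slope v w")
    case True
    with lim have "\<forall>\<^sub>F m in sequentially. 0 < q m - C * (1 / c m)\<^sup>2" by (rule order_tendstoD)
    with ev show ?thesis by eventually_elim (use True st in \<open>simp add: v_def\<close>)
  next
    case False
    with sl have "slope v w < 0" by (simp add: v_def)
    with lim have "\<forall>\<^sub>F m in sequentially. q m - C * (1 / c m)\<^sup>2 < 0" by (rule order_tendstoD)
    with ev show ?thesis by eventually_elim (use False st in \<open>simp add: v_def\<close>)
  qed
qed

text \<open>The limiting rejection probability when \<open>unit_dir s\<close> lies in the column space. It is
  determined by \<open>s\<close> and the image \<open>v\<close> of the coefficients, for all critical values, variances and
  restrictions \<open>r\<close> at once.\<close>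

definition crossing_prob :: "real \<Rightarrow> real ^ 'q \<Rightarrow> real" where
  "crossing_prob s v = measure std_gaussian {z. ar_lower s *v z \<in> U \<and> 0 < slope v (ar_lower s *v z)}"

lemma AE_generic:
  assumes "v \<noteq> 0"
  shows "AE z in lborel. ar_lower s *v z \<in> U \<and> slope v (ar_lower s *v z) \<noteq> 0"
  using AE_lborel_linear[OF det_ar_lower[of s] generic[OF assms]] by (simp add: slope_def)

lemma crossing_set_measurable:
  "{z. ar_lower s *v z \<in> U \<and> 0 < slope v (ar_lower s *v z)} \<in> sets borel"
  using measurable_sets_borel[OF matrix_vector_borel_measurable slope_region_measurable[of v], of "ar_lower s"]
  by (simp add: vimage_def)

text \<open>If the weight is positive definite on the whole domain, the slope is positive there, and the
  domain has full measure.\<close>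

lemma crossing_prob_1:
  assumes "\<And>y. y \<in> U \<Longrightarrow> pos_form (Om y)" and v: "v \<noteq> 0"
  shows "crossing_prob s v = 1"
proof -
  interpret std: prob_space "std_gaussian :: (real ^ 'n::{finite,linorder}) measure"
    by (rule prob_space_std_gaussian)
  have "AE z in lborel. ar_lower s *v z \<in> U \<and> 0 < slope v (ar_lower s *v z)"
    using AE_generic[OF v, of s]
  proof eventually_elim
    case (elim z)
    then have "pos_form (matrix_inv (Om (ar_lower s *v z)))"
      using assms(1) by (intro pos_form_inverse) blast
    then show ?case using elim v by (simp add: slope_def pos_form_def)
  qed
  then show ?thesis
    unfolding crossing_prob_def
    by (intro std.prob_eq_1[THEN iffD2]) (auto simp: AE_std_gaussian crossing_set_measurable)
qed

text \<open>Division by the scale of the innovations, which leaves the statistic unchanged, turns the sample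
  into \<open>wm m + c m * unit_dir s\<close>. Here \<open>wm m\<close> converges to the random vector \<open>ar_lower s *v z\<close> up
  to a multiple of \<open>unit_dir s\<close>, and \<open>c m\<close> diverges. The shift \<open>\<gamma>\<close> of the mean only changes the
  random factor in \<open>c m\<close>, so it does not affect the limit.\<close>

lemma rejection_tendsto_crossing:
  assumes s: "s \<in> {1, -1}" and e: "unit_dir s = X *v \<beta>" and v: "R *v \<beta> \<noteq> 0"
    and \<mu>0: "\<mu>0 \<in> M_null X R r" and \<sigma>: "0 < \<sigma>"
  shows "(\<lambda>m. measure (gaussian (\<mu>0 + \<gamma> *\<^sub>R unit_dir s) (\<sigma>\<^sup>2 *\<^sub>R Lam (near_unit s m))) {y. C \<le> stat r y})
    \<longlonglongrightarrow> crossing_prob s (R *v \<beta>)"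
proof -
  interpret std: prob_space "std_gaussian :: (real ^ 'n::{finite,linorder}) measure"
    by (rule prob_space_std_gaussian)
  let ?A = "\<lambda>m. {z. \<mu>0 + \<gamma> *\<^sub>R unit_dir s + \<sigma> *\<^sub>R (ar_root (near_unit s m) *v z) \<in> {y. C \<le> stat r y}}"
  let ?B = "{z. ar_lower s *v z \<in> U \<and> 0 < slope (R *v \<beta>) (ar_lower s *v z)}"
  have "(\<lambda>m. measure std_gaussian (?A m)) \<longlonglongrightarrow> measure std_gaussian ?B"
  proof (rule std.tendsto_prob)
    have "AE z in lborel. z $ first_time + \<gamma> * s / \<sigma> \<noteq> (0 :: real)"
      by (rule AE_first_nonzero)
    with AE_generic[OF v, of s] show "AE z in std_gaussian. \<forall>\<^sub>F m in sequentially. z \<in> ?A m \<longleftrightarrow> z \<in> ?B"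
      unfolding AE_std_gaussian
    proof eventually_elim
      case (elim z)
      then have z: "ar_lower s *v z \<in> U" by simp
      define a1 where "a1 = (axis first_time 1 :: real ^ 'n::{finite,linorder})"
  \<comment> \<open>The limiting coefficient of \<open>unit_dir s\<close> in the sample before rescaling.\<close>
      define g where "g = \<gamma> + \<sigma> * z $ first_time * s"
      have g: "g \<noteq> 0"
      proof
        assume "g = 0"
        then have "(\<gamma> + \<sigma> * z $ first_time * s) * s / \<sigma> = 0" by (simp add: g_def)
        then have "z $ first_time + \<gamma> * s / \<sigma> = 0" using s \<sigma> by (auto simp: field_simps)
        with elim show False by simp
      qed
      define c where "c m = g / (\<sigma> * near_innovation_sd s m)" for m
      have sd: "0 < near_innovation_sd s m" for m by (rule near_innovation_sd_pos[OF s])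
      have c: "c m \<noteq> 0" for m using g \<sigma> sd[of m] by (simp add: c_def)
      have "(\<lambda>m. near_innovation_sd s m * (\<sigma> / g)) \<longlonglongrightarrow> 0 * (\<sigma> / g)"
        by (intro tendsto_intros near_innovation_sd_tendsto s)
      then have clim: "(\<lambda>m. 1 / c m) \<longlonglongrightarrow> 0"
        by (simp add: c_def mult.commute)
      define wm where "wm m = z $ first_time *\<^sub>R ((1 / near_innovation_sd s m) *\<^sub>R (ar_lower (near_unit s m) *v a1 - s *\<^sub>R unit_dir s)) +
        ar_lower (near_unit s m) *v (z - z $ first_time *\<^sub>R a1)" for m
      define w where "w = ar_lower s *v z + X *v (- (z $ first_time * s) *\<^sub>R \<beta>)"
      have w: "w \<in> U" using elim U_shift by (simp only: w_def)
      have sl: "slope (R *v \<beta>) w = slope (R *v \<beta>) (ar_lower s *v z)"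
        unfolding w_def by (rule slope_shift) (use elim in simp)
      have "wm \<longlonglongrightarrow> z $ first_time *\<^sub>R 0 + ar_lower s *v (z - z $ first_time *\<^sub>R a1)"
        unfolding wm_def a1_def by (intro tendsto_intros ar_lower_axis_rate ar_lower_near_tendsto s)
      also have "z $ first_time *\<^sub>R 0 + ar_lower s *v (z - z $ first_time *\<^sub>R a1) = w"
        unfolding w_def a1_def matrix_vector_mult_diff_distrib matrix_vector_mult_scaleR
          ar_lower_axis_unit[OF s] e by simp
      finally have wlim: "wm \<longlonglongrightarrow> w" .
      have wmU: "\<forall>\<^sub>F m in sequentially. wm m \<in> U"
        using wlim w open_U by (auto dest: topological_tendstoD)
      have "\<forall>\<^sub>F m in sequentially. C \<le> stat 0 (wm m + X *v (c m *\<^sub>R \<beta>)) \<longleftrightarrow> 0 < slope (R *v \<beta>) w"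
        by (rule far_out_rejection[OF w wlim clim c]) (use elim sl in simp)
      with wmU show ?case
      proof eventually_elim
        case (elim m)
        have "\<mu>0 + \<gamma> *\<^sub>R unit_dir s + \<sigma> *\<^sub>R (ar_root (near_unit s m) *v z) =
            \<mu>0 + (\<sigma> * near_innovation_sd s m) *\<^sub>R (wm m + X *v (c m *\<^sub>R \<beta>))"
        proof -
          define P where "P = ar_lower (near_unit s m) *v a1"
          define Q where "Q = ar_lower (near_unit s m) *v (z - z $ first_time *\<^sub>R a1)"
          have "(\<sigma> * near_innovation_sd s m) *\<^sub>R (X *v (c m *\<^sub>R \<beta>)) = g *\<^sub>R unit_dir s"
            using \<sigma> sd[of m] by (simp add: matrix_vector_mult_scaleR c_def e)
          moreover have "(\<sigma> * near_innovation_sd s m) *\<^sub>R wm m =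
              \<sigma> *\<^sub>R (z $ first_time *\<^sub>R (P - s *\<^sub>R unit_dir s) + near_innovation_sd s m *\<^sub>R Q)"
            using sd[of m] unfolding wm_def P_def[symmetric] Q_def[symmetric]
            by (simp add: scaleR_add_right mult.commute)
          moreover have "ar_root (near_unit s m) *v z = z $ first_time *\<^sub>R P + near_innovation_sd s m *\<^sub>R Q"
            by (subst ar_root_apply) (simp add: near_innovation_sd_def a1_def P_def Q_def)
          ultimately show ?thesis
            by (simp add: g_def algebra_simps)
        qed
        moreover have "stat r (\<mu>0 + (\<sigma> * near_innovation_sd s m) *\<^sub>R (wm m + X *v (c m *\<^sub>R \<beta>))) =
            stat 0 (wm m + X *v (c m *\<^sub>R \<beta>))"
          using \<sigma> sd[of m] by (intro stat_affine[OF \<mu>0] U_shift[OF elim(1)]) simp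
        ultimately have "C \<le> stat r (\<mu>0 + \<gamma> *\<^sub>R unit_dir s + \<sigma> *\<^sub>R (ar_root (near_unit s m) *v z)) \<longleftrightarrow>
            0 < slope (R *v \<beta>) w"
          using elim(2) by (simp only:)
        then show ?case using z sl by (simp only: mem_Collect_eq) simp
      qed
    qed
    show "?A m \<in> std.events" for m
      by simp measurable
    show "?B \<in> std.events" by (simp add: crossing_set_measurable)
  qed
  moreover have "measure (gaussian (\<mu>0 + \<gamma> *\<^sub>R unit_dir s) (\<sigma>\<^sup>2 *\<^sub>R Lam (near_unit s m))) {y. C \<le> stat r y} =
      measure std_gaussian (?A m)" for m
    using \<sigma> by (subst measure_gaussian_Lam[OF near_unit_bound[OF s]]) auto
  ultimately show ?thesis by (simp add: crossing_prob_def)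
qed

end

section \<open>Size and power\<close>

context equivariant_wald
begin

lemma M_null_ne: "M_null X R r \<noteq> {}"
  using M_null_nonempty by (auto simp: M_null_def)

lemma M_alt_iff: "X *v \<beta> \<in> M_alt X R r \<longleftrightarrow> R *v \<beta> \<noteq> r"
  using X_inj by (auto simp: M_alt_def M_all_range M_null_def inj_eq)

text \<open>The alternative reaches arbitrarily close to each point of the null space, which transfers
  vanishing rejection probabilities from the null hypothesis to the alternative.\<close>

lemma M_alt_approx:
  assumes "\<mu>0 \<in> M_null X R r"
  obtains \<delta> where "\<And>c. c \<noteq> 0 \<Longrightarrow> \<mu>0 + c *\<^sub>R \<delta> \<in> M_alt X R r"
proof -
  from assms obtain \<beta> where \<beta>: "\<mu>0 = X *v \<beta>" "R *v \<beta> = r" by (auto simp: M_null_def)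
  \<comment> \<open>Any direction that the restriction matrix does not annihilate will do.\<close>
  obtain d where d: "R *v d = axis undefined 1" using M_null_nonempty by blast
  have "\<mu>0 + c *\<^sub>R (X *v d) \<in> M_alt X R r" if "c \<noteq> 0" for c
  proof -
    have "\<mu>0 + c *\<^sub>R (X *v d) = X *v (\<beta> + c *\<^sub>R d)"
      by (simp add: \<beta> matrix_vector_right_distrib matrix_vector_mult_scaleR)
    moreover have "R *v (\<beta> + c *\<^sub>R d) \<noteq> r"
      using that by (simp add: \<beta> d matrix_vector_right_distrib matrix_vector_mult_scaleR)
    ultimately show ?thesis by (simp only: M_alt_iff not_False_eq_True)
  qed
  then show ?thesis by (rule that)
qed

lemma stat_unit_dir:
  assumes "\<mu>0 \<in> M_null X R r" "e \<in> U"
  shows "stat r (e + \<mu>0) = stat 0 e"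
  using stat_affine[OF assms(1), of 1 e] assms(2) by (simp add: add.commute)

text \<open>At a point with positive definite weight, shifts within the column space move \<open>R b(y)\<close> freely
  while the weight stays fixed. This yields a rejection region of positive measure for every critical
  value.\<close>

lemma stat_unbounded:
  "\<exists>y\<in>U. C < stat r y"
proof -
  obtain u where u: "u \<in> U" "pos_form (Om u)" using pos_point by blast
  define w where "w = (axis undefined 1 :: real ^ 'q)"
  define a where "a = w \<bullet> (matrix_inv (Om u) *v w)"
  have "w \<noteq> 0" by (simp add: w_def)
  then have a: "0 < a" using pos_form_inverse[OF u(2)] by (simp add: a_def pos_form_def)
  \<comment> \<open>Large enough that \<open>t * a\<close> exceeds \<open>C\<close>, and at least 1 so that \<open>t\<^sup>2 * a\<close> does as well.\<close>
  define t where "t = (\<bar>C\<bar> + 1) / a + 1"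
  have t: "1 \<le> t" using a by (simp add: t_def)
  obtain \<beta> where \<beta>: "R *v \<beta> = t *\<^sub>R w + r - R *v b u" using M_null_nonempty by blast
  have "C < \<bar>C\<bar> + 1 + a" using a by linarith
  also have "\<dots> = t * a" using a by (simp add: t_def field_simps)
  also have "\<dots> \<le> t * (t * a)" using mult_right_mono[OF t, of "t * a"] a t by simp
  also have "\<dots> = stat r (u + X *v \<beta>)"
    by (simp add: stat_def u U_shift b_shift Om_shift matrix_vector_right_distrib \<beta> a_def matrix_vector_mult_scaleR)
  finally show ?thesis using U_shift[OF u(1)] by blast
qed

lemma crossing_alt:
  assumes e: "unit_dir s = X *v \<beta>" and v: "R *v \<beta> \<noteq> 0" and \<mu>0: "\<mu>0 \<in> M_null X R r" and "\<gamma> \<noteq> 0"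
  shows "\<mu>0 + \<gamma> *\<^sub>R unit_dir s \<in> M_alt X R r"
proof -
  from \<mu>0 obtain \<beta>0 where \<beta>0: "\<mu>0 = X *v \<beta>0" "R *v \<beta>0 = r" by (auto simp: M_null_def)
  have "\<mu>0 + \<gamma> *\<^sub>R unit_dir s = X *v (\<beta>0 + \<gamma> *\<^sub>R \<beta>)"
    by (simp add: \<beta>0 e matrix_vector_right_distrib matrix_vector_mult_scaleR)
  moreover have "R *v (\<beta>0 + \<gamma> *\<^sub>R \<beta>) \<noteq> r"
    using assms by (simp add: \<beta>0 matrix_vector_right_distrib matrix_vector_mult_scaleR)
  ultimately show ?thesis by (simp only: M_alt_iff not_False_eq_True)
qed

context
  fixes \<CC> :: "(real ^ 'n::{finite,linorder} ^ 'n::{finite,linorder}) set" and C :: real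
  assumes model: "covariance_model \<CC>" and AR1: "C_AR1 \<subseteq> \<CC>" and C: "0 < C"
begin

abbreviation reject :: "real ^ 'q \<Rightarrow> (real ^ 'n::{finite,linorder}) set" where
  "reject r \<equiv> {y. C \<le> stat r y}"

lemma Lam_in: "s \<in> {1, -1} \<Longrightarrow> Lam (near_unit s m) \<in> \<CC>"
  using near_unit_bound[of s m] AR1 by (auto simp: C_AR1_def abs_less_iff)

lemma prob_le_1:
  assumes "\<Sigma> \<in> \<CC>" "0 < \<sigma>2"
  shows "measure (gaussian \<mu> (\<sigma>2 *\<^sub>R \<Sigma>)) W \<le> 1"
proof -
  have "sym_pos_def \<Sigma>" using model assms(1) by (simp add: covariance_model_def)
  then have "sym_pos_def (\<sigma>2 *\<^sub>R \<Sigma>)"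
    using assms(2) by (simp add: sym_pos_def_def transpose_scalar scaleR_matrix_vector_assoc[symmetric])
  then show ?thesis by (intro prob_space.prob_le_1 prob_space_gaussian)
qed

lemma INF_cov_nonneg: "0 \<le> (INF \<Sigma>\<in>\<CC>. measure (gaussian \<mu> (\<sigma>2 *\<^sub>R \<Sigma>)) W)"
  using model by (intro cINF_greatest) (auto simp: covariance_model_def)

lemma INF_cov_le:
  assumes "s \<in> {1, -1}"
  shows "(INF \<Sigma>\<in>\<CC>. measure (gaussian \<mu> (\<sigma>2 *\<^sub>R \<Sigma>)) W) \<le> measure (gaussian \<mu> (\<sigma>2 *\<^sub>R Lam (near_unit s m))) W"
  using Lam_in[OF assms] by (intro cINF_lower) (auto intro!: bdd_belowI2[of _ 0])

lemma rejection_tendsto_fixed_scale: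
  assumes s: "s \<in> {1, -1}" and e: "unit_dir s \<in> U" and ne: "stat 0 (unit_dir s) \<noteq> C"
    and \<mu>0: "\<mu>0 \<in> M_null X R r" and \<mu>: "\<mu> \<longlonglongrightarrow> \<mu>0" and \<sigma>2: "0 < \<sigma>2"
  shows "(\<lambda>m. measure (gaussian (\<mu> m) (\<sigma>2 *\<^sub>R Lam (near_unit s m))) (reject r))
    \<longlonglongrightarrow> of_bool (C < stat 0 (unit_dir s))"
proof -
  have "(\<lambda>m. (1 / sqrt \<sigma>2) *\<^sub>R (\<mu> m - \<mu>0)) \<longlonglongrightarrow> (1 / sqrt \<sigma>2) *\<^sub>R (\<mu>0 - \<mu>0)"
    by (intro tendsto_intros \<mu>)
  then show ?thesis
    using rejection_tendsto[OF s e \<mu>0, where \<sigma> = "\<lambda>_. sqrt \<sigma>2" and \<mu> = \<mu> and C = C] ne \<sigma>2 by simp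
qed

lemma size_one:
  assumes s: "s \<in> {1, -1}" and e: "unit_dir s \<in> U" and gt: "C < stat 0 (unit_dir s)"
  shows "\<mu>0 \<in> M_null X R r \<Longrightarrow> 0 < \<sigma>2 \<Longrightarrow> (SUP \<Sigma>\<in>\<CC>. measure (gaussian \<mu>0 (\<sigma>2 *\<^sub>R \<Sigma>)) (reject r)) = 1"
    and "test_size X R r \<CC> (reject r) = 1"
proof -
  have lim: "(\<lambda>m. measure (gaussian \<mu>0 (\<sigma>2 *\<^sub>R Lam (near_unit s m))) (reject r)) \<longlonglongrightarrow> 1"
    if "\<mu>0 \<in> M_null X R r" "0 < \<sigma>2" for \<mu>0 \<sigma>2
    using rejection_tendsto_fixed_scale[OF s e _ that(1) tendsto_const that(2)] gt by simp
  show "(SUP \<Sigma>\<in>\<CC>. measure (gaussian \<mu>0 (\<sigma>2 *\<^sub>R \<Sigma>)) (reject r)) = 1"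
    if "\<mu>0 \<in> M_null X R r" "0 < \<sigma>2"
    by (rule cSUP_eq_limit[OF _ Lam_in[OF s] lim[OF that]]) (rule prob_le_1[OF _ that(2)])
  obtain \<mu>0 where "\<mu>0 \<in> M_null X R r" using M_null_ne by blast
  then show "test_size X R r \<CC> (reject r) = 1"
    unfolding test_size_def
    by (intro cSUP_eq_limit[where x = "\<lambda>m. (\<mu>0, 1, Lam (near_unit s m))"])
      (auto intro: prob_le_1 Lam_in[OF s] lim[of \<mu>0 1, simplified])
qed

text \<open>By continuity the rejection region contains a nonempty open set, and the standard Gaussian measure
  charges such sets. The uncorrelated model \<open>\<rho> = 0\<close> serves as witness.\<close>

lemma test_size_pos: "0 < test_size X R r \<CC> (reject r)"
proof -
  obtain \<mu>0 where \<mu>0: "\<mu>0 \<in> M_null X R r" using M_null_ne by blast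
  interpret std: prob_space "std_gaussian :: (real ^ 'n::{finite,linorder}) measure"
    by (rule prob_space_std_gaussian)
  let ?A = "ar_root 0 :: real ^ 'n::{finite,linorder} ^ 'n::{finite,linorder}"
  have dA: "det ?A \<noteq> 0" by (rule Lam_root) simp
  define O' where "O' = (\<lambda>z. \<mu>0 + ?A *v z) -` {y \<in> U. stat r y \<in> {C<..}}"
  have "open {y \<in> U. stat r y \<in> {C<..}}"
    using continuous_open_preimage[OF continuous_stat open_U, of "{C<..}"] by (simp add: Int_def vimage_def)
  then have "open O'"
    unfolding O'_def by (intro open_vimage continuous_intros)
  obtain y where y: "y \<in> U" "C < stat r y" using stat_unbounded by blast
  have "\<mu>0 + ?A *v (matrix_inv ?A *v (y - \<mu>0)) = y"
    by (simp add: matrix_vector_mul_assoc matrix_inv_right[OF dA])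
  then have "matrix_inv ?A *v (y - \<mu>0) \<in> O'"
    using y unfolding O'_def by (simp only: vimage_eq mem_Collect_eq greaterThan_iff)
  then have "O' \<noteq> {}" by blast
  have "measure std_gaussian {z. \<mu>0 + sqrt 1 *\<^sub>R (?A *v z) \<in> reject r} \<noteq> 0"
  proof
    have meas: "{z. \<mu>0 + sqrt 1 *\<^sub>R (?A *v z) \<in> reject r} \<in> std.events" by simp measurable
    assume "measure std_gaussian {z. \<mu>0 + sqrt 1 *\<^sub>R (?A *v z) \<in> reject r} = 0"
    then have "AE z in std_gaussian. z \<notin> {z. \<mu>0 + sqrt 1 *\<^sub>R (?A *v z) \<in> reject r}"
      using std.prob_eq_0[OF meas] by simp
    then have "AE z in lborel. z \<notin> O'"
      unfolding AE_std_gaussian by eventually_elim (auto simp: O'_def)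
    then have "O' \<in> null_sets lborel"
      using \<open>open O'\<close> by (subst AE_iff_null_sets) auto
    then have "negligible O'"
      unfolding negligible_iff_null_sets by (rule null_sets_completionI)
    then show False using open_not_negligible[OF \<open>open O'\<close> \<open>O' \<noteq> {}\<close>] by simp
  qed
  then have pos: "0 < measure (gaussian \<mu>0 (1 *\<^sub>R Lam 0)) (reject r)"
    by (subst measure_gaussian_Lam) (auto simp: zero_less_measure_iff)
  have "Lam 0 \<in> \<CC>" using AR1 by (auto simp: C_AR1_def)
  then have "measure (gaussian \<mu>0 (1 *\<^sub>R Lam 0)) (reject r) \<le> test_size X R r \<CC> (reject r)"
    unfolding test_size_def
    by (intro cSUP_upper2[where x = "(\<mu>0, 1, Lam 0)"] bdd_aboveI2[where M = 1])
      (auto simp: \<mu>0 intro!: prob_le_1)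
  with pos show ?thesis by linarith
qed

text \<open>The rejection probabilities vanish in the limit under a null mean, under alternatives that
  approach it, and, after rescaling by a diverging standard deviation, under each fixed
  alternative.\<close>

lemma power_zero:
  assumes s: "s \<in> {1, -1}" and e: "unit_dir s \<in> U" and lt: "stat 0 (unit_dir s) < C"
  shows "\<mu>0 \<in> M_null X R r \<Longrightarrow> 0 < \<sigma>2 \<Longrightarrow> (INF \<Sigma>\<in>\<CC>. measure (gaussian \<mu>0 (\<sigma>2 *\<^sub>R \<Sigma>)) (reject r)) = 0"
    and "0 < \<sigma>2 \<Longrightarrow> (INF \<mu>1\<in>M_alt X R r. INF \<Sigma>\<in>\<CC>. measure (gaussian \<mu>1 (\<sigma>2 *\<^sub>R \<Sigma>)) (reject r)) = 0"
    and "\<mu>1 \<in> M_alt X R r \<Longrightarrow> (INF \<sigma>2\<in>{0<..}. INF \<Sigma>\<in>\<CC>. measure (gaussian \<mu>1 (\<sigma>2 *\<^sub>R \<Sigma>)) (reject r)) = 0"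
    and "infimal_power X R r \<CC> (reject r) = 0"
    and "biased X R r \<CC> (reject r)"
proof -
  have lim: "(\<lambda>m. measure (gaussian (\<mu> m) (\<sigma>2 *\<^sub>R Lam (near_unit s m))) (reject r)) \<longlonglongrightarrow> 0"
    if "\<mu>0 \<in> M_null X R r" "\<mu> \<longlonglongrightarrow> \<mu>0" "0 < \<sigma>2" for \<mu>0 \<mu> \<sigma>2
    using rejection_tendsto_fixed_scale[OF s e _ that] lt by simp
  show "(INF \<Sigma>\<in>\<CC>. measure (gaussian \<mu>0 (\<sigma>2 *\<^sub>R \<Sigma>)) (reject r)) = 0"
    if "\<mu>0 \<in> M_null X R r" "0 < \<sigma>2"
    by (rule cINF_eq_limit[OF _ Lam_in[OF s] order_refl lim[OF that(1) tendsto_const that(2)]]) simp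
  obtain \<mu>0 where \<mu>0: "\<mu>0 \<in> M_null X R r" using M_null_ne by blast
  obtain \<delta> where \<delta>: "\<And>c. c \<noteq> 0 \<Longrightarrow> \<mu>0 + c *\<^sub>R \<delta> \<in> M_alt X R r" using M_alt_approx[OF \<mu>0] by blast
  define \<mu> where "\<mu> m = \<mu>0 + (1 / real (Suc m)) *\<^sub>R \<delta>" for m
  have "\<mu> \<longlonglongrightarrow> \<mu>0 + 0 *\<^sub>R \<delta>"
    unfolding \<mu>_def by (intro tendsto_intros LIMSEQ_Suc lim_1_over_n)
  then have \<mu>: "\<mu> \<longlonglongrightarrow> \<mu>0" by simp
  have alt: "\<mu> m \<in> M_alt X R r" for m unfolding \<mu>_def by (rule \<delta>) simp
  show "(INF \<mu>1\<in>M_alt X R r. INF \<Sigma>\<in>\<CC>. measure (gaussian \<mu>1 (\<sigma>2 *\<^sub>R \<Sigma>)) (reject r)) = 0" if "0 < \<sigma>2"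
    by (rule cINF_eq_limit[OF INF_cov_nonneg alt INF_cov_le[OF s] lim[OF \<mu>0 \<mu> that]])
  show infimal: "infimal_power X R r \<CC> (reject r) = 0"
    unfolding infimal_power_def
    by (rule cINF_eq_limit[where x = "\<lambda>m. (\<mu> m, 1, Lam (near_unit s m))", OF _ _ order_refl])
      (use alt Lam_in[OF s] lim[OF \<mu>0 \<mu>, of 1] in auto)
  then show "biased X R r \<CC> (reject r)"
    using test_size_pos by (simp add: biased_def)
  show "(INF \<sigma>2\<in>{0<..}. INF \<Sigma>\<in>\<CC>. measure (gaussian \<mu>1 (\<sigma>2 *\<^sub>R \<Sigma>)) (reject r)) = 0"
    if "\<mu>1 \<in> M_alt X R r"
  proof (rule cINF_eq_limit[OF INF_cov_nonneg _ INF_cov_le[OF s]])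
    have "(\<lambda>m. (1 / real (Suc m)) *\<^sub>R (\<mu>1 - \<mu>0)) \<longlonglongrightarrow> 0 *\<^sub>R (\<mu>1 - \<mu>0)"
      by (intro tendsto_intros LIMSEQ_Suc lim_1_over_n)
    then show "(\<lambda>m. measure (gaussian \<mu>1 ((real (Suc m))\<^sup>2 *\<^sub>R Lam (near_unit s m))) (reject r)) \<longlonglongrightarrow> 0"
      using rejection_tendsto[OF s e \<mu>0, where \<sigma> = "\<lambda>m. real (Suc m)" and \<mu> = "\<lambda>_. \<mu>1" and C = C] lt
      by simp
  qed simp
qed

text \<open>One limit serves both bounds: \<open>\<gamma> = M\<close> gives the upper bound for the infimum and \<open>\<gamma> = 0\<close> the lower
  bound for the supremum.\<close>

lemma crossing_bounds:
  assumes s: "s \<in> {1, -1}" and e: "unit_dir s = X *v \<beta>" and v: "R *v \<beta> \<noteq> 0"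
    and \<mu>0: "\<mu>0 \<in> M_null X R r" and \<sigma>: "0 < \<sigma>"
  shows "0 \<le> M \<Longrightarrow> (INF \<gamma>\<in>{\<gamma>. \<bar>\<gamma>\<bar> \<ge> M}. INF \<Sigma>\<in>\<CC>.
      measure (gaussian (\<mu>0 + \<gamma> *\<^sub>R unit_dir s) (\<sigma>\<^sup>2 *\<^sub>R \<Sigma>)) (reject r)) \<le> crossing_prob s (R *v \<beta>)"
    and "crossing_prob s (R *v \<beta>) \<le> (SUP \<Sigma>\<in>\<CC>. measure (gaussian \<mu>0 (\<sigma>\<^sup>2 *\<^sub>R \<Sigma>)) (reject r))"
proof -
  have lim: "(\<lambda>m. measure (gaussian (\<mu>0 + \<gamma> *\<^sub>R unit_dir s) (\<sigma>\<^sup>2 *\<^sub>R Lam (near_unit s m))) (reject r))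
      \<longlonglongrightarrow> crossing_prob s (R *v \<beta>)" for \<gamma>
    by (rule rejection_tendsto_crossing[OF s e v \<mu>0 \<sigma>])
  show "(INF \<gamma>\<in>{\<gamma>. \<bar>\<gamma>\<bar> \<ge> M}. INF \<Sigma>\<in>\<CC>.
      measure (gaussian (\<mu>0 + \<gamma> *\<^sub>R unit_dir s) (\<sigma>\<^sup>2 *\<^sub>R \<Sigma>)) (reject r)) \<le> crossing_prob s (R *v \<beta>)"
    (is "?I \<le> _") if "0 \<le> M"
  proof (rule LIMSEQ_le_const[OF lim[of M]], intro exI allI impI)
    fix m
    have "?I \<le> (INF \<Sigma>\<in>\<CC>. measure (gaussian (\<mu>0 + M *\<^sub>R unit_dir s) (\<sigma>\<^sup>2 *\<^sub>R \<Sigma>)) (reject r))"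
      using that by (intro cINF_lower bdd_belowI2[of _ 0] INF_cov_nonneg) simp
    also have "\<dots> \<le> measure (gaussian (\<mu>0 + M *\<^sub>R unit_dir s) (\<sigma>\<^sup>2 *\<^sub>R Lam (near_unit s m))) (reject r)"
      by (rule INF_cov_le[OF s])
    finally show "?I \<le> measure (gaussian (\<mu>0 + M *\<^sub>R unit_dir s) (\<sigma>\<^sup>2 *\<^sub>R Lam (near_unit s m))) (reject r)" .
  qed
  show "crossing_prob s (R *v \<beta>) \<le> (SUP \<Sigma>\<in>\<CC>. measure (gaussian \<mu>0 (\<sigma>\<^sup>2 *\<^sub>R \<Sigma>)) (reject r))"
  proof (rule LIMSEQ_le_const2[OF lim[of 0]], intro exI allI impI)
    fix m
    show "measure (gaussian (\<mu>0 + 0 *\<^sub>R unit_dir s) (\<sigma>\<^sup>2 *\<^sub>R Lam (near_unit s m))) (reject r) \<le>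
        (SUP \<Sigma>\<in>\<CC>. measure (gaussian \<mu>0 (\<sigma>\<^sup>2 *\<^sub>R \<Sigma>)) (reject r))"
      using \<sigma> by (simp, intro cSUP_upper Lam_in s bdd_aboveI2[where M = 1] prob_le_1) auto
  qed
qed

end

end

section \<open>Least squares residuals and the autocorrelation estimator\<close>

text \<open>For \<open>s = 1\<close> and \<open>s = -1\<close> this exhibits the sum of squares minus \<open>s\<close> times the lag-one sum of products
  as half a sum of squares. The terms of the latter vanish only if the sequence is zero.\<close>

lemma lag_sum_identity:
  fixes c :: "nat \<Rightarrow> real"
  assumes "s * s = 1" "1 \<le> N"
  shows "2 * ((\<Sum>t=1..N. (c t)\<^sup>2) - s * (\<Sum>t=2..N. c t * c (t - 1))) =
    (c 1)\<^sup>2 + (c N)\<^sup>2 + (\<Sum>t=2..N. (c t - s * c (t - 1))\<^sup>2)"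
  using assms(2)
proof (induction N rule: nat_induct_at_least)
  case base
  then show ?case by simp
next
  case (Suc N)
  have "(c (Suc N) - s * c N)\<^sup>2 = (c (Suc N))\<^sup>2 - 2 * s * (c (Suc N) * c N) + (s * s) * (c N)\<^sup>2"
    by (simp add: power2_eq_square algebra_simps)
  with Suc show ?case
    by (simp add: assms(1) algebra_simps)
qed

lemma lag_sum_less:
  fixes c :: "nat \<Rightarrow> real"
  assumes t0: "t0 \<in> {1..N}" "c t0 \<noteq> 0"
  shows "\<bar>\<Sum>t=2..N. c t * c (t - 1)\<bar> < (\<Sum>t=1..N. (c t)\<^sup>2)"
proof -
  have pos: "0 < (\<Sum>t=1..N. (c t)\<^sup>2) - s * (\<Sum>t=2..N. c t * c (t - 1))" if s: "s * s = 1" for s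
  proof (rule ccontr)
    assume neg: "\<not> ?thesis"
    have N: "1 \<le> N" using t0 by simp
    have nn: "0 \<le> (\<Sum>t=2..N. (c t - s * c (t - 1))\<^sup>2)" by (intro sum_nonneg) simp
    have "(c 1)\<^sup>2 + (c N)\<^sup>2 + (\<Sum>t=2..N. (c t - s * c (t - 1))\<^sup>2) \<le> 0"
      unfolding lag_sum_identity[OF s N, symmetric]
      using neg by (intro mult_nonneg_nonpos) (simp_all only: not_less zero_le_numeral)
    then have "(c 1)\<^sup>2 \<le> 0" "(\<Sum>t=2..N. (c t - s * c (t - 1))\<^sup>2) = 0"
      using nn zero_le_power2[of "c 1"] zero_le_power2[of "c N"] by linarith+
    then have c1: "c 1 = 0" and step: "\<And>t. t \<in> {2..N} \<Longrightarrow> c t = s * c (t - 1)"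
      by (auto simp: sum_nonneg_eq_0_iff)
    have "t \<le> N \<longrightarrow> c t = 0" if "1 \<le> t" for t
      using that
    proof (induction t rule: nat_induct_at_least)
      case (Suc t)
      then show ?case using step[of "Suc t"] by auto
    qed (use c1 in simp)
    then show False using t0 by auto
  qed
  show ?thesis using pos[of 1] pos[of "-1"] by (simp add: abs_less_iff)
qed

lemma coord_nonzero:
  fixes y :: "real ^ 'n::{finite,linorder}"
  assumes "y \<noteq> 0"
  obtains t where "t \<in> {1..CARD('n)}" "coord y t \<noteq> 0"
proof -
  from assms obtain i where "y $ i \<noteq> 0" by (auto simp: vec_eq_iff)
  then have "coord y (pos i) \<noteq> 0" by (simp add: coord_pos)
  with pos_bounds[of i] show ?thesis by (intro that) auto
qed

lemma open_nonzero:
  fixes f :: "'a::topological_space \<Rightarrow> real"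
  assumes "continuous_on V f" "open V"
  shows "open {y \<in> V. f y \<noteq> 0}"
proof -
  have "{y \<in> V. f y \<noteq> 0} = V \<inter> f -` (- {0})" by auto
  then show ?thesis using continuous_open_preimage[OF assms, of "- {0}"] by auto
qed

lemma finite_line_zeros:
  fixes f :: "'a::real_normed_vector \<Rightarrow> real"
  assumes "rational_fun (\<lambda>t. f (u + t *\<^sub>R v))" "continuous_on V f" "open V" "u \<in> V" "f u \<noteq> 0"
  shows "finite {t. f (u + t *\<^sub>R v) = 0}"
proof (rule rational_finite_zeros[OF assms(1)])
  have "isCont f (u + 0 *\<^sub>R v)" using assms(2-4) by (simp add: continuous_on_eq_continuous_at)
  then show "isCont (\<lambda>t. f (u + t *\<^sub>R v)) 0"
    by (rule isCont_o2[rotated]) (intro continuous_intros)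
qed (use assms(5) in simp)

locale ar_estimation =
  fixes X :: "real ^ 'k ^ 'n::{finite,linorder}" and a1 a2 :: nat
  assumes X_inj: "inj ((*v) X)" and k_less: "CARD('k) < CARD('n)"
    and a1: "a1 \<in> {1, 2}" and a2: "a2 \<in> {CARD('n) - 1, CARD('n)}" and window: "CARD('k) \<le> a2 - a1"
begin

lemma window_bounds: "1 \<le> a1" "a1 \<le> 2" "CARD('n) - 1 \<le> a2" "a2 \<le> CARD('n)" "a1 < a2" "2 \<le> CARD('n)"
proof -
  obtain j where j: "CARD('k) = Suc j" using gr0_implies_Suc[OF zero_less_card_finite] by blast
  from a1 a2 k_less window show "1 \<le> a1" "a1 \<le> 2" "CARD('n) - 1 \<le> a2" "a2 \<le> CARD('n)" "a1 < a2" "2 \<le> CARD('n)"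
    unfolding j by auto
qed

lemma pos_form_gram: "pos_form (transpose X ** X)"
  using pos_form_congruence[OF pos_form_mat_1 X_inj] by simp

lemmas det_gram = pos_form_det[OF pos_form_gram]

lemma beta_hat_linear: "beta_hat X y = (matrix_inv (transpose X ** X) ** transpose X) *v y"
  by (simp only: beta_hat_def matrix_vector_mul_assoc)

lemma beta_hat_X: "beta_hat X (X *v \<beta>) = \<beta>"
proof -
  have "beta_hat X (X *v \<beta>) = (matrix_inv (transpose X ** X) ** (transpose X ** X)) *v \<beta>"
    by (simp only: beta_hat_def matrix_vector_mul_assoc matrix_mul_assoc)
  then show ?thesis by (simp add: matrix_inv_left[OF det_gram])
qed

lemma beta_hat_affine: "beta_hat X (c *\<^sub>R y + X *v \<beta>) = c *\<^sub>R beta_hat X y + \<beta>"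
proof -
  have "beta_hat X (c *\<^sub>R y + X *v \<beta>) = c *\<^sub>R beta_hat X y + beta_hat X (X *v \<beta>)"
    unfolding beta_hat_linear by (simp only: matrix_vector_right_distrib matrix_vector_mult_scaleR)
  then show ?thesis by (simp add: beta_hat_X)
qed

lemma u_hat_affine: "u_hat X (c *\<^sub>R y + X *v \<beta>) = c *\<^sub>R u_hat X y"
  by (simp add: u_hat_def beta_hat_affine matrix_vector_right_distrib matrix_vector_mult_scaleR scaleR_diff_right)

lemma u_hat_nonzero: "u_hat X y \<noteq> 0 \<Longrightarrow> y \<noteq> X *v \<beta>"
  by (auto simp: u_hat_def beta_hat_X)

lemma coord_scaleR: "coord (c *\<^sub>R y) t = c * coord y t"
  by (simp add: coord_def)

lemma rho_num_affine: "rho_num X (c *\<^sub>R y + X *v \<beta>) = c\<^sup>2 * rho_num X y"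
  and rho_den_affine: "rho_den X a1 a2 (c *\<^sub>R y + X *v \<beta>) = c\<^sup>2 * rho_den X a1 a2 y"
  by (simp_all add: rho_num_def rho_den_def u_hat_affine coord_scaleR sum_distrib_left power2_eq_square mult_ac)

lemma rho_hat_affine: "c \<noteq> 0 \<Longrightarrow> rho_hat X a1 a2 (c *\<^sub>R y + X *v \<beta>) = rho_hat X a1 a2 y"
  by (simp add: rho_hat_def rho_num_affine rho_den_affine)

text \<open>Of any two consecutive time points at least one lies in the window of the denominator.\<close>

lemma N0_subset_N1: "N0 X a1 a2 \<subseteq> N1 X a1 a2"
proof
  fix y assume "y \<in> N0 X a1 a2"
  then have den: "rho_den X a1 a2 y = 0" by (simp add: N0_def)
  then have z: "coord (u_hat X y) t = 0" if "t \<in> {a1..a2}" for t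
    using that by (simp add: rho_den_def sum_nonneg_eq_0_iff)
  have "coord (u_hat X y) t * coord (u_hat X y) (t - 1) = 0" if "t \<in> {2..CARD('n)}" for t
  proof -
    have "t \<in> {a1..a2} \<or> t - 1 \<in> {a1..a2}" using that window_bounds by auto
    then show ?thesis using z by auto
  qed
  then have "rho_num X y = 0" unfolding rho_num_def by (rule sum.neutral[OF ballI])
  then show "y \<in> N1 X a1 a2" using den by (simp add: N1_def)
qed

lemma rho_den_nonneg: "0 \<le> rho_den X a1 a2 y"
  unfolding rho_den_def by (intro sum_nonneg) simp

lemma u_hat_nonzero_den: "rho_den X a1 a2 y \<noteq> 0 \<Longrightarrow> u_hat X y \<noteq> 0"
  by (auto simp: rho_den_def coord_def)

lemma rho_hat_less_1: "\<bar>rho_num X y\<bar> < rho_den X a1 a2 y \<Longrightarrow> \<bar>rho_hat X a1 a2 y\<bar> < 1"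
proof -
  assume less: "\<bar>rho_num X y\<bar> < rho_den X a1 a2 y"
  then have "0 < rho_den X a1 a2 y" by linarith
  with less show ?thesis by (simp add: rho_hat_def)
qed

lemma yule_walker_rho_less_1:
  assumes "a1 = 1" "a2 = CARD('n)" "rho_den X a1 a2 y \<noteq> 0"
  shows "\<bar>rho_hat X a1 a2 y\<bar> < 1"
proof -
  obtain t where "t \<in> {1..CARD('n)}" "coord (u_hat X y) t \<noteq> 0"
    using coord_nonzero[OF u_hat_nonzero_den[OF assms(3)]] .
  from lag_sum_less[of t "CARD('n)" "coord (u_hat X y)", OF this] show ?thesis
    by (intro rho_hat_less_1) (simp add: rho_num_def rho_den_def assms)
qed

text \<open>Off the exceptional set the estimated correlation matrix is invertible, even if the estimate is
  outside the stationary range.\<close>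

lemma rho_hat_neq_1: "y \<notin> N1 X a1 a2 \<Longrightarrow> (rho_hat X a1 a2 y)\<^sup>2 \<noteq> 1"
  using N0_subset_N1 rho_den_nonneg[of y]
  by (auto simp: N0_def N1_def rho_hat_def power2_eq_1_iff divide_eq_eq abs_if split: if_splits)

text \<open>The \<open>k\<close> orthogonality conditions of a residual vector and the conditions that it vanish outside the
  window are together fewer than \<open>n\<close>, because \<open>k \<le> a2 - a1\<close>. For a vector that satisfies all of
  them the denominator is the full sum of squares, as for the Yule--Walker estimator.\<close>

lemma residual_in_window:
  obtains u where "u_hat X u \<noteq> 0" "\<bar>rho_num X u\<bar> < rho_den X a1 a2 u"
proof -
  let ?A = "(\<lambda>t. axis (inv pos t) 1 :: real ^ 'n::{finite,linorder}) ` ({1..CARD('n)} - {a1..a2})"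
  let ?B = "columns X \<union> ?A"
  have "card (columns X) \<le> CARD('k)"
    unfolding columns_image_basis image_image by (metis card_image_le finite)
  moreover have "card ?A \<le> CARD('n) - (a2 + 1 - a1)"
  proof -
    have "card ?A \<le> card ({1..CARD('n)} - {a1..a2})" by (rule card_image_le) simp
    also have "\<dots> = CARD('n) - (a2 + 1 - a1)"
      using window_bounds by (subst card_Diff_subset) auto
    finally show ?thesis .
  qed
  ultimately have "card ?B < CARD('n)"
    using card_Un_le[of "columns X" ?A] window_bounds window by linarith
  moreover have "dim ?B \<le> card ?B"
    by (rule dim_le_card') (simp add: columns_image_basis)
  ultimately have "dim ?B < DIM(real ^ 'n::{finite,linorder})" by simp
  then obtain u where u: "u \<noteq> 0" and orth: "\<And>y. y \<in> span ?B \<Longrightarrow> orthogonal u y"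
    by (rule orthogonal_to_subspace_exists) blast
  have "transpose X *v u = 0"
  proof -
    have "(transpose X *v u) $ j = 0" for j
    proof -
      have "column j X \<in> span ?B" by (intro span_base) (auto simp: columns_def)
      then have "u \<bullet> column j X = 0" using orth by (simp add: orthogonal_def)
      then show ?thesis
        by (simp add: matrix_vector_mult_def transpose_def column_def inner_vec_def mult.commute)
    qed
    then show ?thesis by (simp add: vec_eq_iff)
  qed
  then have uu: "u_hat X u = u" by (simp add: u_hat_def beta_hat_def)
  have out: "coord u t = 0" if "t \<in> {1..CARD('n)} - {a1..a2}" for t
  proof -
    have "axis (inv pos t) 1 \<in> span ?B" using that by (intro span_base) auto
    then have "u \<bullet> axis (inv pos t) 1 = 0" using orth by (simp add: orthogonal_def)
    then show ?thesis by (simp add: coord_def inner_axis)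
  qed
  have "rho_den X a1 a2 u = (\<Sum>t=1..CARD('n). (coord u t)\<^sup>2)"
    unfolding rho_den_def uu using window_bounds out by (intro sum.mono_neutral_left) auto
  moreover obtain t where "t \<in> {1..CARD('n)}" "coord u t \<noteq> 0" using coord_nonzero[OF u] .
  ultimately have "\<bar>rho_num X u\<bar> < rho_den X a1 a2 u"
    using lag_sum_less[of t "CARD('n)" "coord u"] by (simp add: rho_num_def uu)
  then show ?thesis using u uu by (intro that) auto
qed

lemma continuous_beta_hat: "continuous_on S (beta_hat X)"
  unfolding beta_hat_def by (intro continuous_intros)

lemma continuous_u_hat: "continuous_on S (u_hat X)"
  unfolding u_hat_def by (intro continuous_intros continuous_beta_hat)

lemma continuous_rho_num: "continuous_on S (rho_num X)"
  and continuous_rho_den: "continuous_on S (rho_den X a1 a2)"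
  unfolding rho_num_def rho_den_def coord_def by (intro continuous_intros continuous_u_hat)+

lemma continuous_rho_hat: "continuous_on {y. rho_den X a1 a2 y \<noteq> 0} (rho_hat X a1 a2)"
  unfolding rho_hat_def by (intro continuous_intros continuous_rho_num continuous_rho_den) auto

lemma rational_beta_hat: "rational_vec (\<lambda>t. beta_hat X (u + t *\<^sub>R v))"
  unfolding beta_hat_linear by (intro rational_mat_intros)

lemma rational_u_hat: "rational_vec (\<lambda>t. u_hat X (u + t *\<^sub>R v))"
  unfolding u_hat_def by (intro rational_mat_intros rational_beta_hat)

lemma rational_coord_u_hat: "rational_fun (\<lambda>t. coord (u_hat X (u + t *\<^sub>R v)) i)"
  using rational_u_hat[of u v] by (simp add: rational_vec_def coord_def)

lemma rational_rho_num: "rational_fun (\<lambda>t. rho_num X (u + t *\<^sub>R v))"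
  and rational_rho_den: "rational_fun (\<lambda>t. rho_den X a1 a2 (u + t *\<^sub>R v))"
  unfolding rho_num_def rho_den_def by (intro rational_intros rational_coord_u_hat)+

lemma rational_Lam: "rational_mat (\<lambda>t. Lam (rho_hat X a1 a2 (u + t *\<^sub>R v)))"
  unfolding rational_mat_def Lam_def rho_hat_def vec_lambda_beta
  by (intro allI rational_intros rational_rho_num rational_rho_den)

end

section \<open>The OLS-based statistic\<close>

lemma inj_transpose:
  fixes R :: "real ^ 'k ^ 'q"
  assumes "surj ((*v) R)"
  shows "inj ((*v) (transpose R))"
proof -
  have "rank R = CARD('q)" using assms by (simp add: full_rank_surjective)
  then show ?thesis by (simp only: full_rank_injective[symmetric] rank_transpose)
qed

lemma inj_matrix_mult:
  assumes "inj ((*v) A)" "inj ((*v) B)"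
  shows "inj ((*v) (A ** B))"
  using inj_compose[OF assms] by (simp add: o_def matrix_vector_mul_assoc)

lemma inj_matrix_inv:
  fixes A :: "real ^ 'n ^ 'n"
  shows "det A \<noteq> 0 \<Longrightarrow> inj ((*v) (matrix_inv A))"
  by (intro inj_matrix_vector_mult invertible_det_nz[THEN iffD2] matrix_inv_eqI(2)[OF matrix_inv_left])

locale ar_testing = ar_estimation X a1 a2
  for X :: "real ^ 'k ^ 'n::{finite,linorder}" and a1 a2 :: nat +
  fixes R :: "real ^ 'k ^ 'q"
  assumes R_surj: "surj ((*v) R)"
begin

lemma dof_pos: "0 < real CARD('n) - real CARD('k)"
  using k_less by simp

lemma sigma2_hat_pos: "u_hat X y \<noteq> 0 \<Longrightarrow> 0 < sigma2_hat X y"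
  using dof_pos by (simp add: sigma2_hat_def)

text \<open>Written as a congruence, the sandwich inherits positivity from the estimated correlation
  matrix.\<close>

lemma OLS_sandwich_congruence:
  "OLS_sandwich X R a1 a2 y = transpose (X ** matrix_inv (transpose X ** X) ** transpose R) **
    Lam (rho_hat X a1 a2 y) ** (X ** matrix_inv (transpose X ** X) ** transpose R)"
proof -
  have "transpose (matrix_inv (transpose X ** X)) = matrix_inv (transpose X ** X)"
    by (rule matrix_inv_eqI(1)[symmetric])
      (metis det_gram matrix_inv_left matrix_transpose_mul transpose_mat transpose_transpose)
  then show ?thesis
    by (simp add: OLS_sandwich_def matrix_transpose_mul matrix_mul_assoc)
qed

lemma pos_form_OLS:
  assumes "\<bar>rho_hat X a1 a2 y\<bar> < 1"
  shows "pos_form (OLS_sandwich X R a1 a2 y)"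
  unfolding OLS_sandwich_congruence
  by (intro pos_form_congruence pos_form_Lam assms inj_matrix_mult inj_matrix_inv inj_transpose
      X_inj R_surj det_gram)

definition OLS_dom :: "(real ^ 'n::{finite,linorder}) set" where
  "OLS_dom = {y. rho_den X a1 a2 y \<noteq> 0 \<and> det (OLS_sandwich X R a1 a2 y) \<noteq> 0}"

lemma OLS_dom_iff: "y \<in> OLS_dom \<longleftrightarrow> y \<notin> N0_star X R a1 a2"
  by (simp add: OLS_dom_def N0_star_def N0_def)

lemma open_den: "open {y. rho_den X a1 a2 y \<noteq> 0}"
  using open_nonzero[OF continuous_rho_den[of UNIV]] by simp

lemma continuous_OLS_sandwich: "continuous_on {y. rho_den X a1 a2 y \<noteq> 0} (OLS_sandwich X R a1 a2)"
  unfolding OLS_sandwich_def by (intro continuous_intros continuous_rho_hat)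

lemma continuous_Omega_hat: "continuous_on {y. rho_den X a1 a2 y \<noteq> 0} (Omega_hat X R a1 a2)"
  unfolding Omega_hat_def sigma2_hat_def
  by (intro continuous_intros continuous_OLS_sandwich continuous_u_hat) (use dof_pos in auto)

lemma open_OLS_dom: "open OLS_dom"
  using open_nonzero[OF continuous_on_det[OF continuous_OLS_sandwich] open_den]
  by (simp add: OLS_dom_def)

lemma OLS_dom_subset: "OLS_dom \<subseteq> {y. rho_den X a1 a2 y \<noteq> 0}"
  by (auto simp: OLS_dom_def)

lemma det_Omega_hat: "y \<in> OLS_dom \<Longrightarrow> det (Omega_hat X R a1 a2 y) \<noteq> 0"
  using sigma2_hat_pos[OF u_hat_nonzero_den[of y]] by (auto simp: Omega_hat_def det_scaleR OLS_dom_def)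

lemma pos_form_Omega_hat:
  "\<bar>rho_hat X a1 a2 y\<bar> < 1 \<Longrightarrow> u_hat X y \<noteq> 0 \<Longrightarrow> pos_form (Omega_hat X R a1 a2 y)"
  unfolding Omega_hat_def by (intro pos_form_scaleR pos_form_OLS sigma2_hat_pos)

text \<open>All quantities are rational along lines through the point \<open>u\<close> of \<open>residual_in_window\<close>, where
  positive definiteness makes them nonzero.\<close>

lemma AE_OLS_generic:
  assumes w: "w \<noteq> 0"
  shows "AE y in lborel. y \<in> OLS_dom \<and> w \<bullet> (matrix_inv (Omega_hat X R a1 a2 y) *v w) \<noteq> 0"
proof -
  let ?V = "{y. rho_den X a1 a2 y \<noteq> 0}"
  let ?f = "\<lambda>y. w \<bullet> (matrix_inv (Omega_hat X R a1 a2 y) *v w)"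
  obtain u where u: "u_hat X u \<noteq> 0" "\<bar>rho_num X u\<bar> < rho_den X a1 a2 u" by (rule residual_in_window)
  note rho = rho_hat_less_1[OF u(2)]
  have uV: "u \<in> ?V" using u(2) by auto
  have ud: "u \<in> OLS_dom" using uV pos_form_det[OF pos_form_OLS[OF rho]] by (simp add: OLS_dom_def)
  have fu: "?f u \<noteq> 0"
    using pos_form_inverse[OF pos_form_Omega_hat[OF rho u(1)]] w by (auto simp: pos_form_def)
  have cf: "continuous_on OLS_dom ?f"
    by (intro continuous_intros det_Omega_hat continuous_on_subset[OF continuous_Omega_hat OLS_dom_subset])
  have "AE y in lborel. y \<notin> - {y \<in> OLS_dom. ?f y \<noteq> 0}"
  proof (rule AE_not_in_line_finite[of _ u])
    show "- {y \<in> OLS_dom. ?f y \<noteq> 0} \<in> sets borel"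
      by (intro borel_closed closed_Compl open_nonzero[OF cf open_OLS_dom])
    fix v
    let ?l = "\<lambda>t. u + t *\<^sub>R v"
    have rs: "rational_mat (\<lambda>t. OLS_sandwich X R a1 a2 (?l t))"
      unfolding OLS_sandwich_def by (intro rational_mat_intros rational_Lam)
    have ro: "rational_mat (\<lambda>t. Omega_hat X R a1 a2 (?l t))"
      unfolding Omega_hat_def sigma2_hat_def by (intro rational_mat_intros rational_intros rational_u_hat rs)
    have 1: "finite {t. rho_den X a1 a2 (?l t) = 0}"
      by (rule finite_line_zeros[OF rational_rho_den continuous_rho_den[of UNIV]]) (use uV in auto)
    have 2: "finite {t. det (OLS_sandwich X R a1 a2 (?l t)) = 0}"
      by (rule finite_line_zeros[OF rational_det[OF rs] continuous_on_det[OF continuous_OLS_sandwich] open_den uV])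
        (use ud in \<open>simp add: OLS_dom_def\<close>)
    have 3: "finite {t. det (Omega_hat X R a1 a2 (?l t)) = 0}"
      by (rule finite_line_zeros[OF rational_det[OF ro] continuous_on_det[OF continuous_Omega_hat] open_den uV])
        (rule det_Omega_hat[OF ud])
    have 4: "finite {t. ?f (?l t) = 0}"
      by (rule finite_line_zeros[OF _ cf open_OLS_dom ud fu])
        (intro rational_mat_intros rational_mat_inv ro 3)
    show "finite {t. ?l t \<in> - {y \<in> OLS_dom. ?f y \<noteq> 0}}"
      by (rule finite_subset[OF _ finite_UnI[OF finite_UnI[OF 1 2] 4]]) (auto simp: OLS_dom_def)
  qed
  then show ?thesis by simp
qed

lemma equivariant_OLS: "equivariant_wald X R OLS_dom (beta_hat X) (Omega_hat X R a1 a2)"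
proof
  show "inj ((*v) X)" "surj ((*v) R)" "open OLS_dom" by (fact X_inj R_surj open_OLS_dom)+
  have sand: "OLS_sandwich X R a1 a2 (c *\<^sub>R y + X *v \<beta>) = OLS_sandwich X R a1 a2 y" if "c \<noteq> 0" for c y \<beta>
    by (simp add: OLS_sandwich_def rho_hat_affine[OF that])
  show "c *\<^sub>R y + X *v \<beta> \<in> OLS_dom" if "c \<noteq> 0" "y \<in> OLS_dom" for c y \<beta>
    using that by (simp add: OLS_dom_def rho_den_affine sand)
  show "Omega_hat X R a1 a2 (c *\<^sub>R y + X *v \<beta>) = c\<^sup>2 *\<^sub>R Omega_hat X R a1 a2 y"
    if "c \<noteq> 0" "y \<in> OLS_dom" for c y \<beta>
    using that by (simp add: Omega_hat_def sand sigma2_hat_def u_hat_affine power2_eq_square)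
  show "continuous_on OLS_dom (Omega_hat X R a1 a2)"
    by (rule continuous_on_subset[OF continuous_Omega_hat OLS_dom_subset])
  obtain u where u: "u_hat X u \<noteq> 0" "\<bar>rho_num X u\<bar> < rho_den X a1 a2 u" by (rule residual_in_window)
  then show "\<exists>u\<in>OLS_dom. pos_form (Omega_hat X R a1 a2 u)"
    using pos_form_det[OF pos_form_OLS[OF rho_hat_less_1[OF u(2)]]]
    by (intro bexI[of _ u] pos_form_Omega_hat rho_hat_less_1) (auto simp: OLS_dom_def)
qed (use beta_hat_affine continuous_beta_hat det_Omega_hat AE_OLS_generic in auto)

end

section \<open>The FGLS-based statistic\<close>

context ar_testing
begin

definition residual_tilde :: "real ^ 'n::{finite,linorder} \<Rightarrow> real ^ 'n::{finite,linorder}" where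
  "residual_tilde y = y - X *v beta_tilde X a1 a2 y"

abbreviation Lam_inv :: "real ^ 'n::{finite,linorder} \<Rightarrow> real ^ 'n::{finite,linorder} ^ 'n::{finite,linorder}" where
  "Lam_inv y \<equiv> matrix_inv (Lam (rho_hat X a1 a2 y))"

abbreviation GLS_cov :: "real ^ 'n::{finite,linorder} \<Rightarrow> real ^ 'q ^ 'q" where
  "GLS_cov y \<equiv> R ** matrix_inv (GLS_gram X a1 a2 y) ** transpose R"

lemma sigma2_tilde_residual:
  "sigma2_tilde X a1 a2 y = (residual_tilde y \<bullet> (Lam_inv y *v residual_tilde y)) / (real CARD('n) - real CARD('k))"
  by (simp add: sigma2_tilde_def residual_tilde_def Let_def)

text \<open>The domain is built up in three steps, so that each ingredient is continuous on the open set
  obtained in the step before.\<close>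

definition N1_compl :: "(real ^ 'n::{finite,linorder}) set" where
  "N1_compl = - N1 X a1 a2"

definition N2_compl :: "(real ^ 'n::{finite,linorder}) set" where
  "N2_compl = {y \<in> N1_compl. det (GLS_gram X a1 a2 y) \<noteq> 0}"

definition FGLS_dom :: "(real ^ 'n::{finite,linorder}) set" where
  "FGLS_dom = {y \<in> N2_compl. sigma2_tilde X a1 a2 y \<noteq> 0 \<and> det (GLS_cov y) \<noteq> 0}"

lemma FGLS_dom_iff: "y \<in> FGLS_dom \<longleftrightarrow> y \<notin> N2_star X R a1 a2"
  by (simp add: FGLS_dom_def N2_compl_def N1_compl_def N2_star_def N2_def)

lemma N1_compl_den: "y \<in> N1_compl \<Longrightarrow> rho_den X a1 a2 y \<noteq> 0"
  using N0_subset_N1 by (auto simp: N1_compl_def N0_def)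

lemma N1_compl_iff: "y \<in> N1_compl \<longleftrightarrow> (rho_den X a1 a2 y)\<^sup>2 - (rho_num X y)\<^sup>2 \<noteq> 0"
  using rho_den_nonneg[of y] by (auto simp: N1_compl_def N1_def power2_eq_iff abs_if split: if_splits)

lemma open_N1_compl: "open N1_compl"
proof -
  have "continuous_on UNIV (\<lambda>y. (rho_den X a1 a2 y)\<^sup>2 - (rho_num X y)\<^sup>2)"
    by (intro continuous_intros continuous_rho_num continuous_rho_den)
  moreover have "N1_compl = {y \<in> UNIV. (rho_den X a1 a2 y)\<^sup>2 - (rho_num X y)\<^sup>2 \<noteq> 0}"
    using N1_compl_iff by blast
  ultimately show ?thesis by (simp only: open_nonzero open_UNIV)
qed

lemma det_Lam_N1_compl: "y \<in> N1_compl \<Longrightarrow> det (Lam (rho_hat X a1 a2 y) :: real ^ 'n::{finite,linorder} ^ 'n::{finite,linorder}) \<noteq> 0"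
  by (intro det_Lam rho_hat_neq_1) (simp add: N1_compl_def)

lemma continuous_Lam_inv: "continuous_on N1_compl Lam_inv"
  by (intro continuous_intros det_Lam_N1_compl continuous_on_subset[OF continuous_rho_hat]) (auto dest: N1_compl_den)

lemma continuous_GLS_gram: "continuous_on N1_compl (GLS_gram X a1 a2)"
  unfolding GLS_gram_def by (intro continuous_intros continuous_Lam_inv)

lemma open_N2_compl: "open N2_compl"
  unfolding N2_compl_def by (intro open_nonzero continuous_on_det continuous_GLS_gram open_N1_compl)

lemma N2_compl_subset: "N2_compl \<subseteq> N1_compl" and FGLS_dom_subset: "FGLS_dom \<subseteq> N2_compl"
  by (auto simp: N2_compl_def FGLS_dom_def)

lemma continuous_GLS_gram_inv: "continuous_on N2_compl (\<lambda>y. matrix_inv (GLS_gram X a1 a2 y))"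
  by (intro continuous_intros continuous_on_subset[OF continuous_GLS_gram N2_compl_subset])
    (simp add: N2_compl_def)

lemma continuous_beta_tilde: "continuous_on N2_compl (beta_tilde X a1 a2)"
  unfolding beta_tilde_def
  by (intro continuous_intros continuous_GLS_gram_inv continuous_on_subset[OF continuous_Lam_inv N2_compl_subset])

lemma continuous_sigma2_tilde: "continuous_on N2_compl (sigma2_tilde X a1 a2)"
  unfolding sigma2_tilde_residual residual_tilde_def
  by (intro continuous_intros continuous_beta_tilde continuous_on_subset[OF continuous_Lam_inv N2_compl_subset])
    (use dof_pos in auto)

lemma continuous_GLS_cov: "continuous_on N2_compl GLS_cov"
  by (intro continuous_intros continuous_GLS_gram_inv)

lemma continuous_Omega_tilde: "continuous_on N2_compl (Omega_tilde X R a1 a2)"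
  unfolding Omega_tilde_def by (intro continuous_intros continuous_sigma2_tilde continuous_GLS_cov)

lemma open_FGLS_dom: "open FGLS_dom"
proof -
  have "continuous_on N2_compl (\<lambda>y. sigma2_tilde X a1 a2 y * det (GLS_cov y))"
    by (intro continuous_on_mult continuous_sigma2_tilde continuous_on_det continuous_GLS_cov)
  from open_nonzero[OF this open_N2_compl] show ?thesis by (simp add: FGLS_dom_def)
qed

lemma det_Omega_tilde: "y \<in> FGLS_dom \<Longrightarrow> det (Omega_tilde X R a1 a2 y) \<noteq> 0"
  by (simp add: Omega_tilde_def det_scaleR FGLS_dom_def)

text \<open>Inside the stationary range of the estimate every matrix in the construction is positive
  definite.\<close>

lemma
  assumes rho: "\<bar>rho_hat X a1 a2 y\<bar> < 1"
  shows pos_form_Lam_inv: "pos_form (Lam_inv y :: real ^ 'n::{finite,linorder} ^ 'n::{finite,linorder})"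
    and pos_form_GLS_gram: "pos_form (GLS_gram X a1 a2 y)"
    and pos_form_GLS_cov: "pos_form (GLS_cov y)"
proof -
  show 1: "pos_form (Lam_inv y :: real ^ 'n::{finite,linorder} ^ 'n::{finite,linorder})"
    by (intro pos_form_inverse pos_form_Lam rho)
  show 2: "pos_form (GLS_gram X a1 a2 y)"
    unfolding GLS_gram_def by (intro pos_form_congruence 1 X_inj)
  show "pos_form (GLS_cov y)"
    using pos_form_congruence[OF pos_form_inverse[OF 2] inj_transpose[OF R_surj]] by simp
qed

lemma sigma2_tilde_pos:
  assumes rho: "\<bar>rho_hat X a1 a2 y\<bar> < 1" and "u_hat X y \<noteq> 0"
  shows "0 < sigma2_tilde X a1 a2 y"
proof -
  have "residual_tilde y \<noteq> 0"
    using u_hat_nonzero[OF assms(2)] by (simp add: residual_tilde_def)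
  then show ?thesis
    using pos_form_Lam_inv[OF rho] dof_pos by (simp add: sigma2_tilde_residual pos_form_def)
qed

lemma pos_form_Omega_tilde:
  "\<bar>rho_hat X a1 a2 y\<bar> < 1 \<Longrightarrow> u_hat X y \<noteq> 0 \<Longrightarrow> pos_form (Omega_tilde X R a1 a2 y)"
  unfolding Omega_tilde_def by (intro pos_form_scaleR pos_form_GLS_cov sigma2_tilde_pos)

lemma FGLS_domI:
  assumes rho: "\<bar>rho_hat X a1 a2 y\<bar> < 1" and u: "u_hat X y \<noteq> 0" and "y \<in> N1_compl"
  shows "y \<in> FGLS_dom"
  using assms sigma2_tilde_pos[OF rho u] pos_form_det[OF pos_form_GLS_gram[OF rho]]
    pos_form_det[OF pos_form_GLS_cov[OF rho]]
  by (simp add: FGLS_dom_def N2_compl_def)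

text \<open>As in the OLS case, but the domain is defined by successive conditions, each of which makes the
  next quantity continuous and rational: first the invertibility of the estimated correlation matrix,
  then that of the GLS Gram matrix, and then the conditions on the variance estimate and on the
  restricted covariance.\<close>

lemma AE_FGLS_generic:
  assumes w: "w \<noteq> 0"
  shows "AE y in lborel. y \<in> FGLS_dom \<and> w \<bullet> (matrix_inv (Omega_tilde X R a1 a2 y) *v w) \<noteq> 0"
proof -
  let ?f = "\<lambda>y. w \<bullet> (matrix_inv (Omega_tilde X R a1 a2 y) *v w)"
  let ?g = "\<lambda>y. (rho_den X a1 a2 y)\<^sup>2 - (rho_num X y)\<^sup>2"
  obtain u where u: "u_hat X u \<noteq> 0" "\<bar>rho_num X u\<bar> < rho_den X a1 a2 u" by (rule residual_in_window)
  note rho = rho_hat_less_1[OF u(2)]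
  have u1: "u \<in> N1_compl" using u(2) by (auto simp: N1_compl_def N1_def)
  have ud: "u \<in> FGLS_dom" by (rule FGLS_domI[OF rho u(1) u1])
  then have u2: "u \<in> N2_compl" using FGLS_dom_subset by blast
  have fu: "?f u \<noteq> 0"
    using pos_form_inverse[OF pos_form_Omega_tilde[OF rho u(1)]] w by (auto simp: pos_form_def)
  have cf: "continuous_on FGLS_dom ?f"
    by (intro continuous_intros det_Omega_tilde continuous_on_subset[OF continuous_Omega_tilde FGLS_dom_subset])
  have "AE y in lborel. y \<notin> - {y \<in> FGLS_dom. ?f y \<noteq> 0}"
  proof (rule AE_not_in_line_finite[of _ u])
    show "- {y \<in> FGLS_dom. ?f y \<noteq> 0} \<in> sets borel"
      by (intro borel_closed closed_Compl open_nonzero[OF cf open_FGLS_dom])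
    fix v
    let ?l = "\<lambda>t. u + t *\<^sub>R v"
  \<comment> \<open>The difference of squares is a polynomial version of the condition that defines \<open>N1\<close>.\<close>
    have 1: "finite {t. ?g (?l t) = 0}"
    proof (rule finite_line_zeros[where V = UNIV])
      show "rational_fun (\<lambda>t. ?g (?l t))"
        by (intro rational_intros rational_rho_den rational_rho_num)
      show "continuous_on UNIV ?g"
        by (intro continuous_intros continuous_rho_num continuous_rho_den)
    qed (use u1 in \<open>simp_all add: N1_compl_iff\<close>)
    have rL: "rational_mat (\<lambda>t. Lam_inv (?l t) :: real ^ 'n::{finite,linorder} ^ 'n::{finite,linorder})"
    proof (rule rational_mat_inv[OF rational_Lam])
      show "finite {t. det (Lam (rho_hat X a1 a2 (?l t)) :: real ^ 'n::{finite,linorder} ^ 'n::{finite,linorder}) = 0}"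
        by (rule finite_subset[OF _ 1]) (use det_Lam_N1_compl N1_compl_iff in blast)
    qed
    have rG: "rational_mat (\<lambda>t. GLS_gram X a1 a2 (?l t))"
      unfolding GLS_gram_def by (intro rational_mat_intros rL)
    have 2: "finite {t. det (GLS_gram X a1 a2 (?l t)) = 0}"
      by (rule finite_line_zeros[OF rational_det[OF rG] continuous_on_det[OF continuous_GLS_gram] open_N1_compl u1])
        (use u2 in \<open>simp add: N2_compl_def\<close>)
    have rGi: "rational_mat (\<lambda>t. matrix_inv (GLS_gram X a1 a2 (?l t)))"
      by (rule rational_mat_inv[OF rG 2])
    have rb: "rational_vec (\<lambda>t. beta_tilde X a1 a2 (?l t))"
      unfolding beta_tilde_def by (intro rational_mat_intros rL rGi)
    have rs: "rational_fun (\<lambda>t. sigma2_tilde X a1 a2 (?l t))"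
      unfolding sigma2_tilde_residual residual_tilde_def
      by (intro rational_divide rational_const rational_mat_intros rL rb)
    have 3: "finite {t. sigma2_tilde X a1 a2 (?l t) = 0}"
      by (rule finite_line_zeros[OF rs continuous_sigma2_tilde open_N2_compl u2])
        (use ud in \<open>simp add: FGLS_dom_def\<close>)
    have rc: "rational_mat (\<lambda>t. GLS_cov (?l t))"
      by (intro rational_mat_intros rGi)
    have 4: "finite {t. det (GLS_cov (?l t)) = 0}"
      by (rule finite_line_zeros[OF rational_det[OF rc] continuous_on_det[OF continuous_GLS_cov] open_N2_compl u2])
        (use ud in \<open>simp add: FGLS_dom_def\<close>)
    have ro: "rational_mat (\<lambda>t. Omega_tilde X R a1 a2 (?l t))"
      unfolding Omega_tilde_def by (intro rational_mat_intros rs rGi)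
    have 5: "finite {t. det (Omega_tilde X R a1 a2 (?l t)) = 0}"
      by (rule finite_line_zeros[OF rational_det[OF ro] continuous_on_det[OF continuous_Omega_tilde] open_N2_compl u2])
        (rule det_Omega_tilde[OF ud])
    have 6: "finite {t. ?f (?l t) = 0}"
      by (rule finite_line_zeros[OF _ cf open_FGLS_dom ud fu])
        (intro rational_mat_intros rational_mat_inv ro 5)
    have "finite ({t. ?g (?l t) = 0} \<union> {t. det (GLS_gram X a1 a2 (?l t)) = 0} \<union>
        {t. sigma2_tilde X a1 a2 (?l t) = 0} \<union> {t. det (GLS_cov (?l t)) = 0} \<union> {t. ?f (?l t) = 0})"
      using 1 2 3 4 6 by simp
    then show "finite {t. ?l t \<in> - {y \<in> FGLS_dom. ?f y \<noteq> 0}}"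
      by (rule rev_finite_subset) (auto simp: FGLS_dom_def N2_compl_def N1_compl_iff)
  qed
  then show ?thesis by simp
qed

lemma
  assumes c: "c \<noteq> 0"
  shows GLS_gram_affine: "GLS_gram X a1 a2 (c *\<^sub>R y + X *v \<beta>) = GLS_gram X a1 a2 y"
    and N1_compl_affine: "y \<in> N1_compl \<Longrightarrow> c *\<^sub>R y + X *v \<beta> \<in> N1_compl"
    and beta_tilde_affine: "y \<in> N2_compl \<Longrightarrow> beta_tilde X a1 a2 (c *\<^sub>R y + X *v \<beta>) = c *\<^sub>R beta_tilde X a1 a2 y + \<beta>"
    and sigma2_tilde_affine: "y \<in> N2_compl \<Longrightarrow> sigma2_tilde X a1 a2 (c *\<^sub>R y + X *v \<beta>) = c\<^sup>2 * sigma2_tilde X a1 a2 y"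
proof -
  show gram: "GLS_gram X a1 a2 (c *\<^sub>R y + X *v \<beta>) = GLS_gram X a1 a2 y"
    by (simp add: GLS_gram_def rho_hat_affine[OF c])
  show "c *\<^sub>R y + X *v \<beta> \<in> N1_compl" if "y \<in> N1_compl"
    using that c by (simp add: N1_compl_def N1_def rho_num_affine rho_den_affine abs_mult)
  show beta: "beta_tilde X a1 a2 (c *\<^sub>R y + X *v \<beta>) = c *\<^sub>R beta_tilde X a1 a2 y + \<beta>" if "y \<in> N2_compl"
  proof -
    have lin: "beta_tilde X a1 a2 (c *\<^sub>R y + X *v \<beta>) = c *\<^sub>R beta_tilde X a1 a2 y +
        matrix_inv (GLS_gram X a1 a2 y) *v (transpose X *v (Lam_inv y *v (X *v \<beta>)))"
      unfolding beta_tilde_def gram rho_hat_affine[OF c]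
      by (simp only: matrix_vector_right_distrib matrix_vector_mult_scaleR)
    have "matrix_inv (GLS_gram X a1 a2 y) *v (transpose X *v (Lam_inv y *v (X *v \<beta>))) =
        (matrix_inv (GLS_gram X a1 a2 y) ** GLS_gram X a1 a2 y) *v \<beta>"
      unfolding GLS_gram_def by (simp only: matrix_vector_mul_assoc matrix_mul_assoc)
    also have "\<dots> = \<beta>" using that by (simp add: matrix_inv_left N2_compl_def)
    finally show ?thesis using lin by simp
  qed
  show "sigma2_tilde X a1 a2 (c *\<^sub>R y + X *v \<beta>) = c\<^sup>2 * sigma2_tilde X a1 a2 y" if "y \<in> N2_compl"
  proof -
    have "residual_tilde (c *\<^sub>R y + X *v \<beta>) = c *\<^sub>R residual_tilde y"
      by (simp add: residual_tilde_def beta[OF that] matrix_vector_right_distrib matrix_vector_mult_scaleR scaleR_diff_right)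
    then show ?thesis
      by (simp add: sigma2_tilde_residual rho_hat_affine[OF c] matrix_vector_mult_scaleR power2_eq_square)
  qed
qed

lemma equivariant_FGLS: "equivariant_wald X R FGLS_dom (beta_tilde X a1 a2) (Omega_tilde X R a1 a2)"
proof
  show "inj ((*v) X)" "surj ((*v) R)" "open FGLS_dom" by (fact X_inj R_surj open_FGLS_dom)+
  show "c *\<^sub>R y + X *v \<beta> \<in> FGLS_dom" if "c \<noteq> 0" "y \<in> FGLS_dom" for c y \<beta>
    using that by (simp add: FGLS_dom_def N2_compl_def GLS_gram_affine N1_compl_affine sigma2_tilde_affine)
  have N2: "y \<in> N2_compl" if "y \<in> FGLS_dom" for y using that FGLS_dom_subset by blast
  show "beta_tilde X a1 a2 (c *\<^sub>R y + X *v \<beta>) = c *\<^sub>R beta_tilde X a1 a2 y + \<beta>"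
    if "c \<noteq> 0" "y \<in> FGLS_dom" for c y \<beta>
    using that N2 by (simp add: beta_tilde_affine)
  show "Omega_tilde X R a1 a2 (c *\<^sub>R y + X *v \<beta>) = c\<^sup>2 *\<^sub>R Omega_tilde X R a1 a2 y"
    if "c \<noteq> 0" "y \<in> FGLS_dom" for c y \<beta>
    using that N2 by (simp add: Omega_tilde_def sigma2_tilde_affine GLS_gram_affine)
  show "continuous_on FGLS_dom (beta_tilde X a1 a2)" "continuous_on FGLS_dom (Omega_tilde X R a1 a2)"
    by (rule continuous_on_subset[OF _ FGLS_dom_subset], rule continuous_beta_tilde continuous_Omega_tilde)+
  obtain u where u: "u_hat X u \<noteq> 0" "\<bar>rho_num X u\<bar> < rho_den X a1 a2 u" by (rule residual_in_window)
  then show "\<exists>u\<in>FGLS_dom. pos_form (Omega_tilde X R a1 a2 u)"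
    by (intro bexI[of _ u] pos_form_Omega_tilde rho_hat_less_1 FGLS_domI) (auto simp: N1_compl_def N1_def)
qed (use det_Omega_tilde AE_FGLS_generic in auto)

text \<open>With the full sum of squares as denominator the estimate is inside \<open>(-1, 1)\<close> wherever it is
  defined, by strict domination of the lag-one sum of products.\<close>

lemma yule_walker_pos_form:
  assumes yw: "a1 = 1" "a2 = CARD('n)"
  shows "y \<in> OLS_dom \<Longrightarrow> pos_form (Omega_hat X R a1 a2 y)"
    and "y \<in> FGLS_dom \<Longrightarrow> pos_form (Omega_tilde X R a1 a2 y)"
proof -
  show "pos_form (Omega_hat X R a1 a2 y)" if "y \<in> OLS_dom"
    using that OLS_dom_subset
    by (intro pos_form_Omega_hat yule_walker_rho_less_1 yw u_hat_nonzero_den) auto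
  show "pos_form (Omega_tilde X R a1 a2 y)" if "y \<in> FGLS_dom"
    using that FGLS_dom_subset N2_compl_subset N1_compl_den
    by (intro pos_form_Omega_tilde yule_walker_rho_less_1 yw u_hat_nonzero_den) blast+
qed

end

section \<open>Size and power of the two tests\<close>

theorem theorem3p15:
  fixes X :: "real ^ 'k ^ 'n::{finite,linorder}"
    and R :: "real ^ 'k ^ 'q"
    and a1 a2 :: nat
    and T :: "real ^ 'q \<Rightarrow> real ^ 'n::{finite,linorder} \<Rightarrow> real"
    and Nstar :: "(real ^ 'n::{finite,linorder}) set"
  assumes "CARD('k) < CARD('n)"
    and "rank X = CARD('k)"
    and "rank R = CARD('q)"
    and "a1 \<in> {1, 2}"
    and "a2 \<in> {CARD('n) - 1, CARD('n)}"
    and "a1 \<le> a2"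
    and "CARD('k) \<le> a2 - a1"
    and "(T, Nstar) \<in> {(T_FGLS X R a1 a2, N2_star X R a1 a2), (T_OLS X R a1 a2, N0_star X R a1 a2)}"
  shows
    "(\<forall>r \<CC> C W. covariance_model \<CC> \<and> C_AR1 \<subseteq> \<CC> \<and> 0 < C \<and> W = {y. T r y \<ge> C} \<longrightarrow>
        (\<forall>e\<in>{e_plus, e_minus}. e \<notin> Nstar \<longrightarrow>
            (\<exists>\<mu>0\<in>M_null X R r. T r (e + \<mu>0) > C) \<longrightarrow> (\<forall>\<mu>0\<in>M_null X R r. T r (e + \<mu>0) > C)) \<and>
        ((\<exists>e\<in>{e_plus, e_minus}. e \<notin> Nstar \<and> (\<exists>\<mu>0\<in>M_null X R r. T r (e + \<mu>0) > C)) \<longrightarrow>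
            (\<forall>\<mu>0\<in>M_null X R r. \<forall>\<sigma>2>0. (SUP \<Sigma>\<in>\<CC>. measure (gaussian \<mu>0 (\<sigma>2 *\<^sub>R \<Sigma>)) W) = 1) \<and>
            test_size X R r \<CC> W = 1) \<and>
        (\<forall>e\<in>{e_plus, e_minus}. e \<notin> Nstar \<longrightarrow>
            (\<exists>\<mu>0\<in>M_null X R r. T r (e + \<mu>0) < C) \<longrightarrow> (\<forall>\<mu>0\<in>M_null X R r. T r (e + \<mu>0) < C)) \<and>
        ((\<exists>e\<in>{e_plus, e_minus}. e \<notin> Nstar \<and> (\<exists>\<mu>0\<in>M_null X R r. T r (e + \<mu>0) < C)) \<longrightarrow>
            (\<forall>\<mu>0\<in>M_null X R r. \<forall>\<sigma>2>0. (INF \<Sigma>\<in>\<CC>. measure (gaussian \<mu>0 (\<sigma>2 *\<^sub>R \<Sigma>)) W) = 0) \<and>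
            (\<forall>\<sigma>2>0. (INF \<mu>1\<in>M_alt X R r. INF \<Sigma>\<in>\<CC>. measure (gaussian \<mu>1 (\<sigma>2 *\<^sub>R \<Sigma>)) W) = 0) \<and>
            biased X R r \<CC> W \<and>
            (\<forall>\<mu>1\<in>M_alt X R r. (INF \<sigma>2\<in>{0<..}. INF \<Sigma>\<in>\<CC>. measure (gaussian \<mu>1 (\<sigma>2 *\<^sub>R \<Sigma>)) W) = 0) \<and>
            infimal_power X R r \<CC> W = 0)) \<and>
     (\<forall>e\<in>{e_plus, e_minus}. e \<in> M_all X \<and> R *v beta_hat X e \<noteq> 0 \<longrightarrow>
        (\<exists>K::real.
            (a1 = 1 \<and> a2 = CARD('n) \<longrightarrow> K = 1) \<and>
            (\<forall>r \<CC> C W. covariance_model \<CC> \<and> C_AR1 \<subseteq> \<CC> \<and> 0 < C \<and> W = {y. T r y \<ge> C} \<longrightarrow>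
               (\<forall>\<mu>0\<in>M_null X R r. \<forall>\<sigma>>0. \<forall>M\<ge>0.
                  (INF \<gamma>\<in>{\<gamma>. \<bar>\<gamma>\<bar> \<ge> M}. INF \<Sigma>\<in>\<CC>. measure (gaussian (\<mu>0 + \<gamma> *\<^sub>R e) (\<sigma>\<^sup>2 *\<^sub>R \<Sigma>)) W) \<le> K \<and>
                  K \<le> (SUP \<Sigma>\<in>\<CC>. measure (gaussian \<mu>0 (\<sigma>\<^sup>2 *\<^sub>R \<Sigma>)) W)) \<and>
               (\<forall>\<mu>0\<in>M_null X R r. \<forall>\<gamma>. \<gamma> \<noteq> 0 \<longrightarrow> \<mu>0 + \<gamma> *\<^sub>R e \<in> M_alt X R r) \<and>
               (a1 = 1 \<and> a2 = CARD('n) \<longrightarrow>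
                  (\<forall>\<mu>0\<in>M_null X R r. \<forall>\<sigma>2>0. (SUP \<Sigma>\<in>\<CC>. measure (gaussian \<mu>0 (\<sigma>2 *\<^sub>R \<Sigma>)) W) = 1)))))"
    (is "?items12 \<and> ?item3")
proof -
  interpret ar_testing X a1 a2 R
    by unfold_locales (use assms in \<open>auto simp: full_rank_injective full_rank_surjective\<close>)
  \<comment> \<open>Both tests are instances of the equivariant Wald statistic.\<close>
  obtain U b Om where wald: "equivariant_wald X R U b Om"
    and dom: "\<And>y. y \<in> U \<longleftrightarrow> y \<notin> Nstar"
    and T: "\<And>r y. T r y = (if y \<in> U then (R *v b y - r) \<bullet> (matrix_inv (Om y) *v (R *v b y - r)) else 0)"
    and yw: "\<And>y. a1 = 1 \<Longrightarrow> a2 = CARD('n) \<Longrightarrow> y \<in> U \<Longrightarrow> pos_form (Om y)"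
  proof -
    from assms(8) consider (FGLS) "T = T_FGLS X R a1 a2" "Nstar = N2_star X R a1 a2"
      | (OLS) "T = T_OLS X R a1 a2" "Nstar = N0_star X R a1 a2" by auto
    then show ?thesis
    proof cases
      case FGLS
      show ?thesis
      proof (rule that[OF equivariant_FGLS])
        show "pos_form (Omega_tilde X R a1 a2 y)" if "a1 = 1" "a2 = CARD('n)" "y \<in> FGLS_dom" for y
          using that by (rule yule_walker_pos_form(2))
      qed (simp_all add: FGLS FGLS_dom_iff T_FGLS_def Let_def)
    next
      case OLS
      show ?thesis
      proof (rule that[OF equivariant_OLS])
        show "pos_form (Omega_hat X R a1 a2 y)" if "a1 = 1" "a2 = CARD('n)" "y \<in> OLS_dom" for y
          using that by (rule yule_walker_pos_form(1))
      qed (simp_all add: OLS OLS_dom_iff T_OLS_def Let_def)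
    qed
  qed
  interpret equivariant_wald X R U b Om by (rule wald)
  have T_eq: "T r y = stat r y" for r y by (simp add: T stat_def)
  have dir: "\<exists>s\<in>{1, -1}. e = unit_dir s" if "e \<in> {e_plus, e_minus}" for e :: "real ^ 'n::{finite,linorder}"
    using that unfolding unit_dir_simps[symmetric] by blast
  have const: "T r (e + \<mu>0) = stat 0 e" if "e \<notin> Nstar" "\<mu>0 \<in> M_null X R r" for e \<mu>0 r
    using stat_unit_dir[of \<mu>0 r e] that dom by (simp add: T_eq)
  have ?items12
  proof (intro allI impI conjI; (elim conjE)?)
    fix r and \<CC> :: "(real ^ 'n::{finite,linorder} ^ 'n::{finite,linorder}) set" and C W
    assume model: "covariance_model \<CC>" "C_AR1 \<subseteq> \<CC>" "0 < C" and W: "W = {y. C \<le> T r y}"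
    have WW: "W = {y. C \<le> stat r y}" by (simp add: W T_eq)
    show "\<forall>e\<in>{e_plus, e_minus}. e \<notin> Nstar \<longrightarrow>
        (\<exists>\<mu>0\<in>M_null X R r. T r (e + \<mu>0) > C) \<longrightarrow> (\<forall>\<mu>0\<in>M_null X R r. T r (e + \<mu>0) > C)"
      using const by metis
    show "\<forall>e\<in>{e_plus, e_minus}. e \<notin> Nstar \<longrightarrow>
        (\<exists>\<mu>0\<in>M_null X R r. T r (e + \<mu>0) < C) \<longrightarrow> (\<forall>\<mu>0\<in>M_null X R r. T r (e + \<mu>0) < C)"
      using const by metis
    {
      assume "\<exists>e\<in>{e_plus, e_minus}. e \<notin> Nstar \<and> (\<exists>\<mu>0\<in>M_null X R r. T r (e + \<mu>0) > C)"
      then obtain s where s: "s \<in> {1, -1}" and e: "unit_dir s \<in> U" and gt: "C < stat 0 (unit_dir s)"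
        using dir const dom by metis
      note size = size_one[OF model s e gt, where r = r, folded WW]
      show "\<forall>\<mu>0\<in>M_null X R r. \<forall>\<sigma>2>0. (SUP \<Sigma>\<in>\<CC>. measure (gaussian \<mu>0 (\<sigma>2 *\<^sub>R \<Sigma>)) W) = 1"
        using size(1) by blast
      show "test_size X R r \<CC> W = 1" by (rule size(2))
    }
    {
      assume "\<exists>e\<in>{e_plus, e_minus}. e \<notin> Nstar \<and> (\<exists>\<mu>0\<in>M_null X R r. T r (e + \<mu>0) < C)"
      then obtain s where s: "s \<in> {1, -1}" and e: "unit_dir s \<in> U" and lt: "stat 0 (unit_dir s) < C"
        using dir const dom by metis
      note power = power_zero[OF model s e lt, where r = r, folded WW]
      show "\<forall>\<mu>0\<in>M_null X R r. \<forall>\<sigma>2>0. (INF \<Sigma>\<in>\<CC>. measure (gaussian \<mu>0 (\<sigma>2 *\<^sub>R \<Sigma>)) W) = 0"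
        using power(1) by blast
      show "(INF \<mu>1\<in>M_alt X R r. INF \<Sigma>\<in>\<CC>. measure (gaussian \<mu>1 (\<sigma>2 *\<^sub>R \<Sigma>)) W) = 0"
        if "0 < \<sigma>2" for \<sigma>2
        using that by (rule power(2))
      show "biased X R r \<CC> W" by (rule power(5))
      show "\<forall>\<mu>1\<in>M_alt X R r. (INF \<sigma>2\<in>{0<..}. INF \<Sigma>\<in>\<CC>. measure (gaussian \<mu>1 (\<sigma>2 *\<^sub>R \<Sigma>)) W) = 0"
        using power(3) by blast
      show "infimal_power X R r \<CC> W = 0" by (rule power(4))
    }
  qed
  moreover have ?item3
  proof (intro ballI impI, elim conjE)
    fix e :: "real ^ 'n::{finite,linorder}"
    assume "e \<in> {e_plus, e_minus}" and "e \<in> M_all X" and Rb: "R *v beta_hat X e \<noteq> 0"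
    then obtain s where s: "s \<in> {1, -1}" and es: "e = unit_dir s" using dir by blast
    from \<open>e \<in> M_all X\<close> obtain \<beta> where \<beta>: "e = X *v \<beta>" by (auto simp: M_all_range)
    have e: "unit_dir s = X *v \<beta>" using \<beta> es by simp
    have v: "R *v \<beta> \<noteq> 0" using Rb by (simp add: \<beta> beta_hat_X)
    let ?K = "crossing_prob s (R *v \<beta>)"
    have K1: "?K = 1" if "a1 = 1 \<and> a2 = CARD('n)"
      using that yw v by (intro crossing_prob_1) auto
    show "\<exists>K::real.
            (a1 = 1 \<and> a2 = CARD('n) \<longrightarrow> K = 1) \<and>
            (\<forall>r \<CC> C W. covariance_model \<CC> \<and> C_AR1 \<subseteq> \<CC> \<and> 0 < C \<and> W = {y. T r y \<ge> C} \<longrightarrow>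
               (\<forall>\<mu>0\<in>M_null X R r. \<forall>\<sigma>>0. \<forall>M\<ge>0.
                  (INF \<gamma>\<in>{\<gamma>. \<bar>\<gamma>\<bar> \<ge> M}. INF \<Sigma>\<in>\<CC>. measure (gaussian (\<mu>0 + \<gamma> *\<^sub>R e) (\<sigma>\<^sup>2 *\<^sub>R \<Sigma>)) W) \<le> K \<and>
                  K \<le> (SUP \<Sigma>\<in>\<CC>. measure (gaussian \<mu>0 (\<sigma>\<^sup>2 *\<^sub>R \<Sigma>)) W)) \<and>
               (\<forall>\<mu>0\<in>M_null X R r. \<forall>\<gamma>. \<gamma> \<noteq> 0 \<longrightarrow> \<mu>0 + \<gamma> *\<^sub>R e \<in> M_alt X R r) \<and>
               (a1 = 1 \<and> a2 = CARD('n) \<longrightarrow>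
                  (\<forall>\<mu>0\<in>M_null X R r. \<forall>\<sigma>2>0. (SUP \<Sigma>\<in>\<CC>. measure (gaussian \<mu>0 (\<sigma>2 *\<^sub>R \<Sigma>)) W) = 1)))"
    proof (rule exI[of _ ?K], intro conjI allI impI ballI; (elim conjE)?)
      show "?K = 1" if "a1 = 1" "a2 = CARD('n)" using that K1 by blast
    next
      fix r and \<CC> :: "(real ^ 'n::{finite,linorder} ^ 'n::{finite,linorder}) set" and C W
      assume model: "covariance_model \<CC>" "C_AR1 \<subseteq> \<CC>" "0 < C" and W: "W = {y. C \<le> T r y}"
      have WW: "W = {y. C \<le> stat r y}" by (simp add: W T_eq)
      fix \<mu>0 assume \<mu>0: "\<mu>0 \<in> M_null X R r"
      show "(INF \<gamma>\<in>{\<gamma>. \<bar>\<gamma>\<bar> \<ge> M}. INF \<Sigma>\<in>\<CC>. measure (gaussian (\<mu>0 + \<gamma> *\<^sub>R e) (\<sigma>\<^sup>2 *\<^sub>R \<Sigma>)) W) \<le> ?K"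
        if "0 < \<sigma>" "0 \<le> M" for \<sigma> M
        unfolding WW es by (rule crossing_bounds(1)[OF model s e v \<mu>0 that])
      show upper: "?K \<le> (SUP \<Sigma>\<in>\<CC>. measure (gaussian \<mu>0 (\<sigma>\<^sup>2 *\<^sub>R \<Sigma>)) W)" if "0 < \<sigma>" for \<sigma>
        unfolding WW by (rule crossing_bounds(2)[OF model s e v \<mu>0 that])
      show "\<mu>0 + \<gamma> *\<^sub>R e \<in> M_alt X R r" if "\<gamma> \<noteq> 0" for \<gamma>
        unfolding es by (rule crossing_alt[OF e v \<mu>0 that])
      show "(SUP \<Sigma>\<in>\<CC>. measure (gaussian \<mu>0 (\<sigma>2 *\<^sub>R \<Sigma>)) W) = 1"
        if "a1 = 1" "a2 = CARD('n)" "0 < \<sigma>2" for \<sigma>2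
      proof (rule antisym)
        show "(SUP \<Sigma>\<in>\<CC>. measure (gaussian \<mu>0 (\<sigma>2 *\<^sub>R \<Sigma>)) W) \<le> 1"
          using model(1) that(3) prob_le_1[OF model]
          by (intro cSUP_least) (auto simp: covariance_model_def)
        show "1 \<le> (SUP \<Sigma>\<in>\<CC>. measure (gaussian \<mu>0 (\<sigma>2 *\<^sub>R \<Sigma>)) W)"
          using upper[of "sqrt \<sigma>2"] K1 that by simp
      qed
    qed
  qed
  ultimately show ?thesis by (rule conjI)
qed

end
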